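(* Let $G$ be a unicyclic graph whose unique cycle is the odd cycle $C_{2n+1}=(x_1,\ldots,x_{2n+1})$, $n\ge 1$, let $l=|E(G)\setminus E(C_{2n+1})|$, and let $I=I(G)$ be its edge ideal. Let $s\in\mathbb{N}$ and write $s=k(n+1)+r$ with $k\ge 1$ an integer and $0\le r\le n$. With the numbers $|\mathscr{G}_j|$ ($j\ge 0$) defined in the context, $$\operatorname{sdefect}(I,s)=|\mathscr{G}_{(k-1)(n+1)+r}|+|\mathscr{G}_{(k-2)(n+1)+r}|+\cdots+|\mathscr{G}_{(n+1)+r}|+|\mathscr{G}_{r}|=\sum_{j=0}^{k-1}|\mathscr{G}_{j(n+1)+r}|.$$
   Context: A unicyclic graph is a finite simple connected graph containing exactly one cycle. $R=\mathbb{K}[V(G)]$ is the polynomial ring over a field $\mathbb{K}$ whose variables are the vertices of $G$; the edge ideal is $I(G)=\langle uv : \{u,v\}\in E(G)\rangle\subset R$. The $s$-th symbolic power of $I$ is $I^{(s)}=\bigcap_{p\in\operatorname{Ass} I}(I^sR_p\cap R)$, and $\operatorname{sdefect}(I,s)=\mu(I^{(s)}/I^s)$ is the minimal number of generators of the $R$-module $I^{(s)}/I^s$. Multichoose notation: $\left(\!\!\binom{a}{b}\!\!\right)=\binom{a+b-1}{b}$ for $b\ge 0$, and $\left(\!\!\binom{a}{b}\!\!\right)=0$ if $b<0$. Edge covers for the cycle in $G$: an edge cover for $C_{2n+1}$ in $G$ is a set $L\subseteq E(G)$ such that every vertex of $C_{2n+1}$ is incident to some edge of $L$. It is Type-I if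 $L\subseteq E(C_{2n+1})$, and Type-II if $L$ contains some edge of $E(G)\setminus E(C_{2n+1})$. A Type-I (resp. Type-II) minimum edge cover for $C_{2n+1}$ in $G$ is a Type-I (resp. Type-II) edge cover of smallest possible cardinality among all Type-I (resp. Type-II) edge covers for $C_{2n+1}$ in $G$. For $n+1\le j\le 2n+1+l$, $d_j$ is the number of subsets of $E(G)$ of cardinality $j$ that contain a Type-I or a Type-II minimum edge cover for $C_{2n+1}$ in $G$. The numbers $|\mathscr{G}_j|$: for $0\le j\le n$, $|\mathscr{G}_{j}|=\left(\!\!\binom{2n+1+l}{j}\!\!\right)$; for $j\ge n+1$, $$|\mathscr{G}_{j}|=\left(\!\!\binom{2n+1+l}{j}\!\!\right)-\sum_{i=0}^{n+l} d_{n+1+i}\left(\!\!\binom{n+1+i}{j-(n+1)-i}\!\!\right).$$ *)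

theory Defs
  imports "HOL-Algebra.QuotRing" "HOL-Algebra.Ideal_Product" "HOL-Algebra.Module"
    "HOL-Library.Poly_Mapping"
begin

section \<open>Unicyclic graphs\<close>

text \<open>The vertex set of a finite graph is a finite type \<open>'v\<close>; an edge is a two-element set of
  vertices, so that a graph is given by its set of edges.\<close>

definition simple_graph :: "'v::finite set set \<Rightarrow> bool" where
  "simple_graph E \<longleftrightarrow> (\<forall>e\<in>E. card e = 2)"

definition connected_graph :: "'v::finite set set \<Rightarrow> bool" where
  "connected_graph E \<longleftrightarrow> (\<forall>u v. (u, v) \<in> {(a, b). {a, b} \<in> E}\<^sup>*)"

definition cycle_edges :: "'v list \<Rightarrow> 'v set set" where
  "cycle_edges xs = {{xs ! i, xs ! (Suc i mod length xs)} |i. i < length xs}"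

definition is_cycle :: "'v::finite set set \<Rightarrow> 'v list \<Rightarrow> bool" where
  "is_cycle E xs \<longleftrightarrow> 3 \<le> length xs \<and> distinct xs \<and> cycle_edges xs \<subseteq> E"

text \<open>A cycle in a graph is a subgraph; as such it is determined by its edge set, whereas rotating
  or reversing \<open>xs\<close> gives the same cycle. Cycles are therefore counted by their edge sets.\<close>

definition unicyclic :: "'v::finite set set \<Rightarrow> bool" where
  "unicyclic E \<longleftrightarrow> simple_graph E \<and> connected_graph E \<and>
     (\<exists>!C. \<exists>xs. is_cycle E xs \<and> C = cycle_edges xs)"


section \<open>Edge covers of the cycle and the numbers $|\mathscr{G}_j|$\<close>

definition edge_cover :: "'v set set \<Rightarrow> 'v list \<Rightarrow> 'v set set \<Rightarrow> bool" where
  "edge_cover E xs L \<longleftrightarrow> L \<subseteq> E \<and> (\<forall>x\<in>set xs. \<exists>e\<in>L. x \<in> e)"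

definition type_I_cover :: "'v set set \<Rightarrow> 'v list \<Rightarrow> 'v set set \<Rightarrow> bool" where
  "type_I_cover E xs L \<longleftrightarrow> edge_cover E xs L \<and> L \<subseteq> cycle_edges xs"

definition type_II_cover :: "'v set set \<Rightarrow> 'v list \<Rightarrow> 'v set set \<Rightarrow> bool" where
  "type_II_cover E xs L \<longleftrightarrow> edge_cover E xs L \<and> L \<inter> (E - cycle_edges xs) \<noteq> {}"

definition type_I_min_cover :: "'v set set \<Rightarrow> 'v list \<Rightarrow> 'v set set \<Rightarrow> bool" where
  "type_I_min_cover E xs L \<longleftrightarrow> is_arg_min card (type_I_cover E xs) L"

definition type_II_min_cover :: "'v set set \<Rightarrow> 'v list \<Rightarrow> 'v set set \<Rightarrow> bool" where
  "type_II_min_cover E xs L \<longleftrightarrow> is_arg_min card (type_II_cover E xs) L"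

definition cover_count :: "'v set set \<Rightarrow> 'v list \<Rightarrow> nat \<Rightarrow> nat" where
  "cover_count E xs j = card {A. A \<subseteq> E \<and> card A = j \<and>
     (\<exists>L\<subseteq>A. type_I_min_cover E xs L \<or> type_II_min_cover E xs L)}"

definition multichoose :: "nat \<Rightarrow> int \<Rightarrow> nat" where
  "multichoose a b = (if b < 0 then 0 else (a + nat b - 1) choose nat b)"

text \<open>Integer-valued because of the subtraction; \<open>cover_count E xs j\<close> is the number $d_j$.\<close>

definition G_number :: "'v::finite set set \<Rightarrow> 'v list \<Rightarrow> nat \<Rightarrow> nat \<Rightarrow> nat \<Rightarrow> int" where
  "G_number E xs n l j =
     (if j \<le> n then int (multichoose (2 * n + 1 + l) (int j))
      else int (multichoose (2 * n + 1 + l) (int j)) -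
           (\<Sum>i = 0..n + l. int (cover_count E xs (n + 1 + i)) *
              int (multichoose (n + 1 + i) (int j - int (n + 1) - int i))))"


section \<open>Modules, associated primes and minimal numbers of generators\<close>

text \<open>An ideal \<open>J\<close> (for example the whole ring) as an \<open>R\<close>-module. The \<open>mult\<close> and \<open>one\<close> fields of
  a module record play no role in the locale \<^locale>\<open>module\<close>.\<close>

definition ideal_module :: "('a, 'b) ring_scheme \<Rightarrow> 'a set \<Rightarrow> ('a, 'a) module" where
  "ideal_module R J = \<lparr>carrier = J, mult = mult R, one = one R, zero = zero R, add = add R,
     smult = mult R\<rparr>"

definition quotient_module :: "('a, 'b, 'c) module_scheme \<Rightarrow> 'b set \<Rightarrow> ('a, 'b set) module" where
  "quotient_module M N = \<lparr>carrier = a_rcosets\<^bsub>M\<^esub> N, mult = rcoset_mult M N,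
     one = N +>\<^bsub>M\<^esub> \<one>\<^bsub>M\<^esub>, zero = N, add = set_add M,
     smult = (\<lambda>r X. \<Union>x\<in>X. N +>\<^bsub>M\<^esub> (r \<odot>\<^bsub>M\<^esub> x))\<rparr>"

definition Ass_module :: "('a, 'r) ring_scheme \<Rightarrow> ('a, 'b, 'c) module_scheme \<Rightarrow> 'a set set" where
  "Ass_module R M = {p. primeideal p R \<and>
     (\<exists>m\<in>carrier M. p = {r \<in> carrier R. r \<odot>\<^bsub>M\<^esub> m = \<zero>\<^bsub>M\<^esub>})}"

text \<open>As usual, the associated primes of an ideal \<open>I\<close> are those of the module \<open>R/I\<close>.\<close>

definition Ass :: "('a, 'r) ring_scheme \<Rightarrow> 'a set \<Rightarrow> 'a set set" where
  "Ass R I = Ass_module R (quotient_module (ideal_module R (carrier R)) I)"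

definition generates :: "('a, 'r) ring_scheme \<Rightarrow> ('a, 'b, 'c) module_scheme \<Rightarrow> 'b set \<Rightarrow> bool" where
  "generates R M F \<longleftrightarrow> F \<subseteq> carrier M \<and> \<Inter> {H. submodule H R M \<and> F \<subseteq> H} = carrier M"

definition min_gens :: "('a, 'r) ring_scheme \<Rightarrow> ('a, 'b, 'c) module_scheme \<Rightarrow> nat" where
  "min_gens R M = (LEAST m. \<exists>F. finite F \<and> card F = m \<and> generates R M F)"


section \<open>Localization at a prime ideal and symbolic powers\<close>

text \<open>The fraction $a/t$, as the class of all $(b,u)$ with $v(au - bt) = 0$ for some $v \notin p$.\<close>

definition loc_frac :: "('a, 'r) ring_scheme \<Rightarrow> 'a set \<Rightarrow> 'a \<Rightarrow> 'a \<Rightarrow> ('a \<times> 'a) set" where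
  "loc_frac R p a t = {(b, u). b \<in> carrier R \<and> u \<in> carrier R - p \<and>
     (\<exists>v\<in>carrier R - p. v \<otimes>\<^bsub>R\<^esub> ((a \<otimes>\<^bsub>R\<^esub> u) \<ominus>\<^bsub>R\<^esub> (b \<otimes>\<^bsub>R\<^esub> t)) = \<zero>\<^bsub>R\<^esub>)}"

definition localization :: "('a, 'r) ring_scheme \<Rightarrow> 'a set \<Rightarrow> ('a \<times> 'a) set ring" where
  "localization R p =
     \<lparr>carrier = {loc_frac R p a t |a t. a \<in> carrier R \<and> t \<in> carrier R - p},
      mult = (\<lambda>X Y. \<Union>(a, t)\<in>X. \<Union>(b, u)\<in>Y. loc_frac R p (a \<otimes>\<^bsub>R\<^esub> b) (t \<otimes>\<^bsub>R\<^esub> u)),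
      one = loc_frac R p \<one>\<^bsub>R\<^esub> \<one>\<^bsub>R\<^esub>,
      zero = loc_frac R p \<zero>\<^bsub>R\<^esub> \<one>\<^bsub>R\<^esub>,
      add = (\<lambda>X Y. \<Union>(a, t)\<in>X. \<Union>(b, u)\<in>Y.
               loc_frac R p ((a \<otimes>\<^bsub>R\<^esub> u) \<oplus>\<^bsub>R\<^esub> (b \<otimes>\<^bsub>R\<^esub> t)) (t \<otimes>\<^bsub>R\<^esub> u))\<rparr>"

definition loc_map :: "('a, 'r) ring_scheme \<Rightarrow> 'a set \<Rightarrow> 'a \<Rightarrow> ('a \<times> 'a) set" where
  "loc_map R p a = loc_frac R p a \<one>\<^bsub>R\<^esub>"

text \<open>$J R_p \cap R$, the contraction to \<open>R\<close> of the ideal of $R_p$ generated by the image of \<open>J\<close>.\<close>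

definition loc_contraction :: "('a, 'r) ring_scheme \<Rightarrow> 'a set \<Rightarrow> 'a set \<Rightarrow> 'a set" where
  "loc_contraction R p J =
     {a \<in> carrier R. loc_map R p a \<in> genideal (localization R p) (loc_map R p ` J)}"

definition ideal_power :: "('a, 'r) ring_scheme \<Rightarrow> 'a set \<Rightarrow> nat \<Rightarrow> 'a set" where
  "ideal_power R I s = I [^]\<^bsub>ideals_set R\<^esub> s"

definition symbolic_power :: "('a, 'r) ring_scheme \<Rightarrow> 'a set \<Rightarrow> nat \<Rightarrow> 'a set" where
  "symbolic_power R I s =
     carrier R \<inter> (\<Inter>p\<in>Ass R I. loc_contraction R p (ideal_power R I s))"

definition sdefect :: "('a, 'r) ring_scheme \<Rightarrow> 'a set \<Rightarrow> nat \<Rightarrow> nat" where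
  "sdefect R I s =
     min_gens R (quotient_module (ideal_module R (symbolic_power R I s)) (ideal_power R I s))"


section \<open>The polynomial ring on the vertices and the edge ideal\<close>

text \<open>Monomials are exponent functions \<open>'v \<Rightarrow>\<^sub>0 nat\<close>; the product of \<^typ>\<open>('v \<Rightarrow>\<^sub>0 nat) \<Rightarrow>\<^sub>0 'k\<close> is
  the convolution product, i.e. multiplication of polynomials.\<close>

definition poly_ring :: "(('v::finite \<Rightarrow>\<^sub>0 nat) \<Rightarrow>\<^sub>0 'k::field) ring" where
  "poly_ring = \<lparr>carrier = UNIV, mult = (*), one = 1, zero = 0, add = (+)\<rparr>"

definition vertex_var :: "'v \<Rightarrow> ('v \<Rightarrow>\<^sub>0 nat) \<Rightarrow>\<^sub>0 'k::field" where
  "vertex_var v = Poly_Mapping.single (Poly_Mapping.single v 1) 1"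

definition edge_ideal :: "'v::finite set set \<Rightarrow> (('v \<Rightarrow>\<^sub>0 nat) \<Rightarrow>\<^sub>0 'k::field) set" where
  "edge_ideal E = genideal poly_ring {vertex_var u * vertex_var v |u v. {u, v} \<in> E}"

lemma cring_poly_ring: "cring (poly_ring :: (('v::finite \<Rightarrow>\<^sub>0 nat) \<Rightarrow>\<^sub>0 'k::field) ring)"
proof (rule cringI)
  show "abelian_group (poly_ring :: (('v \<Rightarrow>\<^sub>0 nat) \<Rightarrow>\<^sub>0 'k) ring)"
    by (rule abelian_groupI)
      (auto simp: poly_ring_def algebra_simps intro: exI[of _ "- x" for x])
  show "comm_monoid (poly_ring :: (('v \<Rightarrow>\<^sub>0 nat) \<Rightarrow>\<^sub>0 'k) ring)"
    by (rule comm_monoidI) (auto simp: poly_ring_def algebra_simps)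
qed (auto simp: poly_ring_def algebra_simps)

end

theory Submission
  imports "HOL-Library.Multiset" "HOL.Vector_Spaces" Defs
begin

text \<open>Let \<open>u\<close> be the product of the vertices of the cycle. A monomial lies in the symbolic power iff every
  vertex cover has weight at least \<open>s\<close> under its exponents. Removing leaves, one reduces to weights on
  the cycle alone, where the incidence equation can be solved explicitly: the weights of the \<open>2n + 1\<close>
  alternating vertex covers are the exponents of the edges up to a constant. This shows that the
  symbolic power is generated by the monomials \<open>u^a g\<close> with \<open>g\<close> a product of \<open>s - a (n + 1)\<close> edges.

  Such a monomial has degree \<open>2s - a\<close>, so it is outside the ordinary power iff \<open>a > 0\<close>. As the
  incidence matrix of the graph is invertible, distinct pairs \<open>(a, g)\<close> give distinct monomials. The
  monomial \<open>u^a g\<close> is redundant iff the edges occurring in \<open>g\<close> contain a minimum edge cover of the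
  cycle: \<open>n + 1\<close> edges covering the cycle have product \<open>u\<close> times a variable, and conversely
  \<open>g = u^c h w\<close> with \<open>deg w = c > 0\<close> forces such a cover in \<open>g\<close>, as one sees from the inverse of the
  incidence matrix. Counting multisets of edges by their support gives the numbers \<open>G_number\<close>.\<close>

section \<open>Products of edges and vertex covers\<close>

text \<open>The odd length is where \<open>u\<close> gets its role: every vertex cover meets the
  cycle in at least \<open>n + 1\<close> vertices, so one factor \<open>u\<close> is worth
  \<open>n + 1\<close> edges, yet its degree \<open>2n + 1\<close> is one less than that of their
  product. The induction on \<open>s\<close> peels leaves off the support of the weights until that
  support is exactly the cycle. The obstacle there is positivity: the explicit solution has
  nonnegative exponents only in a balanced range, and all other weights have to be moved into that
  range or reduced to a path by deleting a suitable edge. The associated primes are never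
  classified. One inclusion for the symbolic power uses only that minimal vertex covers give
  associated primes, the other only that each variable in an associated prime has a neighbour
  outside it. Since the powers involved are spanned by monomials, membership becomes a question
  about exponents once cancellation in products is excluded.\<close>

definition inc :: "'v set multiset \<Rightarrow> 'v \<Rightarrow> nat" where
  "inc g v = size {#e \<in># g. v \<in> e#}"

lemma inc_empty [simp]: "inc {#} v = 0"
  by (simp add: inc_def)

lemma inc_add_mset [simp]: "inc (add_mset e g) v = (if v \<in> e then Suc (inc g v) else inc g v)"
  by (simp add: inc_def)

lemma inc_union [simp]: "inc (g + h) v = inc g v + inc h v"
  by (simp add: inc_def)

lemma inc_sum: "inc (\<Sum>i\<in>A. f i) v = (\<Sum>i\<in>A. inc (f i) v)"
  by (induction A rule: infinite_finite_induct) auto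

lemma inc_replicate [simp]: "inc (replicate_mset k e) v = (if v \<in> e then k else 0)"
  by (induction k) auto

lemma sum_inc_weighted:
  fixes c :: "'v::finite \<Rightarrow> 'a::comm_semiring_1"
  shows "(\<Sum>v\<in>UNIV. c v * of_nat (inc g v)) = (\<Sum>e\<in>#g. \<Sum>v\<in>e. c v)"
proof (induction g)
  case empty
  show ?case by simp
next
  case (add e g)
  have "(\<Sum>v\<in>UNIV. c v * of_nat (inc (add_mset e g) v)) =
      (\<Sum>v\<in>UNIV. c v * of_nat (inc g v)) + (\<Sum>v\<in>UNIV. if v \<in> e then c v else 0)"
    by (subst sum.distrib [symmetric], rule sum.cong) (auto simp: algebra_simps)
  also have "(\<Sum>v\<in>UNIV. if v \<in> e then c v else 0) = (\<Sum>v\<in>e. c v)"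
    by (simp add: sum.If_cases)
  finally show ?case by (simp add: add add_ac)
qed

lemma sum_inc:
  fixes g :: "'v::finite set multiset"
  assumes "\<And>e. e \<in># g \<Longrightarrow> card e = 2"
  shows "(\<Sum>v\<in>UNIV. inc g v) = 2 * size g"
proof -
  have "(\<Sum>v\<in>UNIV. inc g v) = (\<Sum>e\<in>#g. card e)"
    using sum_inc_weighted [of "\<lambda>_. 1 :: nat" g] by simp
  also have "\<dots> = (\<Sum>e\<in>#g. 2)"
    using assms by (intro arg_cong [of _ _ sum_mset] image_mset_cong) auto
  finally show ?thesis by simp
qed

text \<open>This says that the monomial \<open>m\<close> lies in the \<open>s\<close>-th power of
  the prime generated by any vertex cover of \<open>F\<close>. The edge set is a parameter because
  leaf removal passes to subgraphs.\<close>

definition cover_bound :: "'v::finite set set \<Rightarrow> ('v \<Rightarrow> nat) \<Rightarrow> nat \<Rightarrow> bool" where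
  "cover_bound F m s \<longleftrightarrow> (\<forall>W. (\<forall>e\<in>F. e \<inter> W \<noteq> {}) \<longrightarrow> s \<le> (\<Sum>v\<in>W. m v))"

lemma cover_boundD: "cover_bound F m s \<Longrightarrow> (\<And>e. e \<in> F \<Longrightarrow> e \<inter> W \<noteq> {}) \<Longrightarrow> s \<le> (\<Sum>v\<in>W. m v)"
  by (auto simp: cover_bound_def)

text \<open>Vertices of weight zero can be added to a cover for free, and they cover all discarded
  edges.\<close>

lemma cover_bound_restrict:
  assumes "cover_bound F m s"
  shows "cover_bound {e \<in> F. \<forall>v\<in>e. m v > 0} m s"
  unfolding cover_bound_def
proof (intro allI impI)
  fix W assume W: "\<forall>e\<in>{e \<in> F. \<forall>v\<in>e. m v > 0}. e \<inter> W \<noteq> {}"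
  have "s \<le> (\<Sum>v\<in>W \<union> {v. m v = 0}. m v)"
    by (rule cover_boundD [OF assms]) (use W in fastforce)
  also have "\<dots> = (\<Sum>v\<in>W. m v)"
    by (rule sum.mono_neutral_right) auto
  finally show "s \<le> (\<Sum>v\<in>W. m v)" .
qed

lemma sum_remove_two:
  fixes m :: "'v::finite \<Rightarrow> nat"
  assumes "p \<noteq> q" "m p > 0" "m q > 0"
  shows "(\<Sum>v\<in>W. m v) = (\<Sum>v\<in>W. (m(p := m p - 1, q := m q - 1)) v) + card (W \<inter> {p, q})"
proof -
  have "(\<Sum>v\<in>W. m v) = (\<Sum>v\<in>W. (m(p := m p - 1, q := m q - 1)) v + (if v \<in> {p, q} then 1 else 0))"
    using assms by (intro sum.cong) auto
  also have "\<dots> = (\<Sum>v\<in>W. (m(p := m p - 1, q := m q - 1)) v) + (\<Sum>v\<in>W \<inter> {p, q}. 1)"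
    by (subst sum.inter_restrict) (auto simp: sum.distrib)
  finally show ?thesis by simp
qed

text \<open>A cover that contains both ends can drop \<open>q\<close>, whose only edge is
  \<open>{p, q}\<close>; a cover without both ends loses at most one unit.\<close>

lemma cover_bound_remove_leaf:
  assumes "cover_bound F m (Suc s)" "p \<noteq> q" "{p, q} \<in> F" "m p > 0" "m q > 0"
    and leaf: "\<And>e. e \<in> F \<Longrightarrow> q \<in> e \<Longrightarrow> e = {p, q}"
  shows "cover_bound F (m(p := m p - 1, q := m q - 1)) s"
  unfolding cover_bound_def
proof (intro allI impI)
  fix W assume W: "\<forall>e\<in>F. e \<inter> W \<noteq> {}"
  let ?m = "m(p := m p - 1, q := m q - 1)"
  define W' where "W' = (if p \<in> W then W - {q} else W)"
  have cov: "e \<inter> W' \<noteq> {}" if "e \<in> F" for e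
  proof (cases "p \<in> W \<and> q \<in> e")
    case True
    then have "p \<in> e" using leaf [OF that] by blast
    then show ?thesis using True assms(2) by (auto simp: W'_def)
  next
    case False
    then show ?thesis using W that by (auto simp: W'_def)
  qed
  have "card (W' \<inter> {p, q}) \<le> 1"
    unfolding W'_def by (auto simp: Int_insert_right)
  moreover have "Suc s \<le> (\<Sum>v\<in>W'. m v)"
    by (rule cover_boundD [OF assms(1)]) (use cov in auto)
  ultimately have "s \<le> (\<Sum>v\<in>W'. ?m v)"
    using sum_remove_two [OF assms(2,4,5), of W'] by linarith
  also have "\<dots> \<le> (\<Sum>v\<in>W. ?m v)"
    by (rule sum_mono2) (auto simp: W'_def)
  finally show "s \<le> (\<Sum>v\<in>W. ?m v)" .
qed

section \<open>An odd cycle with trees attached\<close>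

text \<open>Indexing the cycle periodically by all natural numbers avoids most wrap-around cases.
  The trees are stored as parent pointers, with \<open>depth\<close> the height above the cycle, so
  each vertex off the cycle contributes the edge to its parent.\<close>

locale cycle_with_trees =
  fixes E :: "'v::finite set set" and n :: nat and x :: "nat \<Rightarrow> 'v"
    and par :: "'v \<Rightarrow> 'v" and depth :: "'v \<Rightarrow> nat"
  assumes n_pos: "n \<ge> 1"
    and x_eq_iff: "x i = x j \<longleftrightarrow> i mod (2 * n + 1) = j mod (2 * n + 1)"
    and depth_eq_0_iff: "depth v = 0 \<longleftrightarrow> v \<in> range x"
    and depth_par: "depth v > 0 \<Longrightarrow> depth v = Suc (depth (par v))"
    and E_eq: "E = range (\<lambda>i. {x i, x (Suc i)}) \<union> {{v, par v} |v. depth v > 0}"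
begin

section \<open>Arithmetic of indices modulo the length of the cycle\<close>

definition N :: nat where "N = 2 * n + 1"
definition ce :: "nat \<Rightarrow> 'v set" where "ce i = {x i, x (Suc i)}"
abbreviation C :: "'v set set" where "C \<equiv> range ce"

lemma E_cases [consumes 1, case_names cycle tree]:
  assumes "e \<in> E"
  obtains i where "e = ce i" | v where "depth v > 0" "e = {v, par v}"
  using assms unfolding E_eq ce_def by auto

lemma C_sub_E: "C \<subseteq> E"
  unfolding E_eq ce_def by auto

lemma tree_edge_in_E: "depth v > 0 \<Longrightarrow> {v, par v} \<in> E"
  unfolding E_eq by auto

lemma x_eqI: "i mod N = j mod N \<Longrightarrow> x i = x j"
  using x_eq_iff by (simp add: N_def)

lemma x_add_N [simp]: "x (i + N) = x i"
  by (rule x_eqI) simp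

lemma mod_Suc_cong: "i mod N = j mod N \<Longrightarrow> Suc i mod N = Suc j mod N"
  by (metis mod_Suc_eq)

lemma ce_eqI: "i mod N = j mod N \<Longrightarrow> ce i = ce j"
  unfolding ce_def using x_eqI mod_Suc_cong by metis

lemma ce_eq_add_N [simp]: "ce (i + N) = ce i"
  by (rule ce_eqI) simp

lemma mod_N_cancel: "(a + b) mod N = (a + c) mod N \<longleftrightarrow> b mod N = c mod N"
proof -
  have "(int a + int b) mod int N = (int a + int c) mod int N \<longleftrightarrow> int b mod int N = int c mod int N"
    by (simp add: mod_eq_dvd_iff)
  then show ?thesis
    by (simp only: of_nat_add [symmetric] of_nat_mod [symmetric] of_nat_eq_iff)
qed

lemma x_iff: "x i = x j \<longleftrightarrow> i mod N = j mod N"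
  using x_eq_iff by (simp add: N_def)

lemma depth_x [simp]: "depth (x i) = 0"
  by (simp add: depth_eq_0_iff)

lemma N_ge: "N \<ge> 3"
  using n_pos by (simp add: N_def)

lemma Suc_mod_N: "Suc i mod N \<noteq> i mod N"
proof
  assume "Suc i mod N = i mod N"
  then have "1 mod N = 0 mod N" using mod_N_cancel [of i 1 0] by simp
  then show False using N_ge by simp
qed

lemma x_Suc_neq: "x (Suc i) \<noteq> x i"
  using Suc_mod_N x_eq_iff by (simp add: N_def)

lemma x_mem_ce_iff: "x j \<in> ce i \<longleftrightarrow> j mod N = i mod N \<or> j mod N = Suc i mod N"
  unfolding ce_def by (simp add: x_eq_iff N_def)

lemma ce_eq_iff: "ce i = ce j \<longleftrightarrow> i mod N = j mod N"
proof
  assume *: "ce i = ce j"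
  then have "x i \<in> ce j" "x (Suc i) \<in> ce j" by (auto simp: ce_def)
  moreover have "Suc i mod N = j mod N \<and> i mod N = Suc j mod N \<Longrightarrow> False"
  proof -
    assume "Suc i mod N = j mod N \<and> i mod N = Suc j mod N"
    \<comment> \<open>Matching the end points in reverse order would identify positions two steps
      apart, impossible as \<open>N\<close> is at least 3.\<close>
    then have "(i + 2) mod N = (i + 0) mod N"
      by (metis add_2_eq_Suc' mod_Suc_cong add_0_right)
    then show False using N_ge by (simp only: mod_N_cancel) simp
  qed
  ultimately show "i mod N = j mod N"
    unfolding x_mem_ce_iff using Suc_mod_N by metis
qed (rule ce_eqI)

lemma par_neq: "depth v > 0 \<Longrightarrow> par v \<noteq> v"
  by (metis depth_par n_not_Suc_n)

lemma card_edge: "e \<in> E \<Longrightarrow> card e = 2"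
  by (cases e rule: E_cases) (auto simp: ce_def x_Suc_neq [symmetric] par_neq [symmetric])

text \<open>Inside the cycle, a missing edge followed by a present one exposes a leaf; otherwise the
  deepest tree vertex whose parent edge is in \<open>F\<close> is a leaf.\<close>

lemma ex_leaf:
  assumes "F \<subseteq> E" "F \<noteq> {}" "F \<noteq> C"
  obtains p q where "p \<noteq> q" "{p, q} \<in> F" "\<And>e. e \<in> F \<Longrightarrow> q \<in> e \<Longrightarrow> e = {p, q}"
proof (cases "F \<subseteq> C")
  case True
  then obtain i where i: "ce i \<notin> F" using assms(3) by blast
  obtain j where j: "ce j \<in> F" using True assms(2) by blast
  have "\<exists>i. ce i \<notin> F \<and> ce (Suc i) \<in> F"
  proof (rule ccontr)
    assume *: "\<not> ?thesis"
    have "ce (i + k) \<notin> F" for k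
      by (induction k) (use i * in auto)
    \<comment> \<open>Walking \<open>j + i * (N - 1)\<close> steps from \<open>i\<close> reaches a
      position congruent to \<open>j\<close> without subtracting.\<close>
    then have "ce (i + (j + i * (N - 1))) \<notin> F" .
    moreover have "i + (j + i * (N - 1)) = j + N * i"
      using N_ge by (cases N) auto
    ultimately have "ce (j + N * i) \<notin> F" by (simp only: not_False_eq_True)
    moreover have "ce (j + N * i) = ce j" by (rule ce_eqI) (simp only: mod_mult_self2)
    ultimately show False using j by simp
  qed
  then obtain i where i: "ce i \<notin> F" "ce (Suc i) \<in> F" by blast
  show ?thesis
  proof (rule that [of "x (Suc (Suc i))" "x (Suc i)"])
    show "x (Suc (Suc i)) \<noteq> x (Suc i)" by (rule x_Suc_neq)
    show "{x (Suc (Suc i)), x (Suc i)} \<in> F" using i by (simp add: ce_def insert_commute)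
    fix e assume e: "e \<in> F" "x (Suc i) \<in> e"
    then obtain k where k: "e = ce k" using True by blast
    then have "Suc i mod N = k mod N \<or> Suc i mod N = Suc k mod N"
      using e x_mem_ce_iff by simp
    moreover have "Suc i mod N = Suc k mod N \<longleftrightarrow> i mod N = k mod N"
      using mod_N_cancel [of 1 i k] by simp
    ultimately have "e = ce (Suc i)" using e i k ce_eqI by metis
    then show "e = {x (Suc (Suc i)), x (Suc i)}" by (auto simp: ce_def)
  qed
next
  case False
  let ?V = "{v. depth v > 0 \<and> {v, par v} \<in> F}"
  have "?V \<noteq> {}"
  proof -
    obtain e where e: "e \<in> F" "e \<notin> C" using False by (meson subsetI)
    with assms(1) have "e \<in> E" by (meson subsetD)
    then obtain v where "depth v > 0" "e = {v, par v}"
      by (cases e rule: E_cases) (use e in auto)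
    then show ?thesis using e by auto
  qed
  then have "Max (depth ` ?V) \<in> depth ` ?V" by (intro Max_in) auto
  then obtain v where v: "v \<in> ?V" "depth v = Max (depth ` ?V)" by (metis (no_types, lifting) imageE)
  have max: "depth v' \<le> depth v" if "v' \<in> ?V" for v'
    unfolding v(2) by (rule Max_ge) (use that in auto)
  show ?thesis
  proof (rule that [of "par v" v])
    show "par v \<noteq> v" using v par_neq by blast
    show "{par v, v} \<in> F" using v by (simp add: insert_commute)
    fix e assume e: "e \<in> F" "v \<in> e"
    with assms(1) have "e \<in> E" by blast
    then show "e = {par v, v}"
    proof (cases e rule: E_cases)
      case (cycle i)
      then show ?thesis using e v by (auto simp: ce_def)
    next
      case (tree v')
      then show ?thesis using e max [of v'] depth_par [of v'] by auto
    qed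
  qed
qed

section \<open>Decompositions and leaf removal\<close>

definition cycle_part :: "nat \<Rightarrow> 'v \<Rightarrow> nat" where
  "cycle_part a v = (if depth v = 0 then a else 0)"

text \<open>Divisibility of \<open>m\<close> by \<open>u^a\<close> times the product of
  \<open>g\<close>. A factor \<open>u\<close> counts as \<open>n + 1\<close> because that is the
  least number of cycle vertices in a vertex cover.\<close>

definition decomposable :: "'v set set \<Rightarrow> ('v \<Rightarrow> nat) \<Rightarrow> nat \<Rightarrow> bool" where
  "decomposable F m s \<longleftrightarrow> (\<exists>a g. set_mset g \<subseteq> F \<and> size g + a * (n + 1) = s \<and>
     (\<forall>v. cycle_part a v + inc g v \<le> m v))"

text \<open>The case \<open>a = 0\<close>, which is membership in the ordinary power.\<close>

definition matchable :: "'v set set \<Rightarrow> ('v \<Rightarrow> nat) \<Rightarrow> nat \<Rightarrow> bool" where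
  "matchable F m s \<longleftrightarrow> (\<exists>g. set_mset g \<subseteq> F \<and> size g = s \<and> (\<forall>v. inc g v \<le> m v))"

lemma matchable_imp_decomposable: "matchable F m s \<Longrightarrow> decomposable F m s"
  unfolding matchable_def decomposable_def cycle_part_def
  by (rule exI [of _ 0]) auto

text \<open>Passing to the edges of positive weight makes both ends of the leaf edge reducible. This
  subgraph is nonempty, since otherwise the empty cover would have weight at least
  \<open>Suc s\<close>.\<close>

lemma leaf_step:
  assumes "cover_bound F m (Suc s)" "F \<subseteq> E" "{e \<in> F. \<forall>v\<in>e. m v > 0} \<noteq> C"
  obtains F' p q where "F' \<subseteq> F" "p \<noteq> q" "{p, q} \<in> F'" "m p > 0" "m q > 0"
    "cover_bound F' (m(p := m p - 1, q := m q - 1)) s"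
proof -
  let ?F = "{e \<in> F. \<forall>v\<in>e. m v > 0}"
  have cov: "cover_bound ?F m (Suc s)" by (rule cover_bound_restrict) fact
  have "?F \<noteq> {}"
  proof
    assume empty: "?F = {}"
    have "cover_bound {} m (Suc s)" using cov unfolding empty .
    then have "Suc s \<le> (\<Sum>v\<in>{}. m v)" by (rule cover_boundD) simp
    then show False by simp
  qed
  moreover have "?F \<subseteq> E" using assms(2) by auto
  ultimately obtain p q where pq: "p \<noteq> q" "{p, q} \<in> ?F" "\<And>e. e \<in> ?F \<Longrightarrow> q \<in> e \<Longrightarrow> e = {p, q}"
    using ex_leaf [OF _ _ assms(3)] by blast
  then have pos: "m p > 0" "m q > 0" by auto
  show ?thesis
    by (rule that [of ?F p q])
      (use pq pos cover_bound_remove_leaf [OF cov pq(1,2) pos pq(3)] in auto)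
qed

lemma inc_add_edge_le:
  assumes "\<forall>v. k v + inc g v \<le> (m(p := m p - 1, q := m q - 1)) v" "p \<noteq> q" "m p > 0" "m q > 0"
  shows "\<forall>v. k v + inc (add_mset {p, q} g) v \<le> m v"
proof
  fix v
  show "k v + inc (add_mset {p, q} g) v \<le> m v"
    using assms(1) [rule_format, of v] assms(2-4) by (auto split: if_splits)
qed

text \<open>With a cycle edge missing, the support can never be the whole cycle, so leaves can be
  removed until \<open>s\<close> is used up.\<close>

lemma matchable_forest:
  "cover_bound F m s \<Longrightarrow> F \<subseteq> E \<Longrightarrow> \<not> C \<subseteq> F \<Longrightarrow> matchable F m s"
proof (induction s arbitrary: F m)
  case 0
  show ?case unfolding matchable_def by (rule exI [of _ "{#}"]) auto
next
  case (Suc s)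
  have "{e \<in> F. \<forall>v\<in>e. m v > 0} \<noteq> C" using Suc.prems(3) by auto
  then obtain F' p q where *: "F' \<subseteq> F" "p \<noteq> q" "{p, q} \<in> F'" "m p > 0" "m q > 0"
    "cover_bound F' (m(p := m p - 1, q := m q - 1)) s"
    using leaf_step [OF Suc.prems(1,2)] by blast
  have "\<not> C \<subseteq> F'" using * Suc.prems by blast
  then obtain g where g: "set_mset g \<subseteq> F'" "size g = s"
    "\<forall>v. inc g v \<le> (m(p := m p - 1, q := m q - 1)) v"
    using Suc.IH [OF *(6)] * Suc.prems unfolding matchable_def by blast
  have "\<forall>v. inc (add_mset {p, q} g) v \<le> m v"
    using inc_add_edge_le [of "\<lambda>_. 0" g m p q] g * by simp
  then show ?case unfolding matchable_def
    by (intro exI [of _ "add_mset {p, q} g"]) (use g * in auto)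
qed

text \<open>The edges occupy the disjoint position pairs \<open>2t, 2t + 1\<close>, all below
  \<open>N\<close>, so nothing wraps around.\<close>

lemma inc_matching:
  assumes "k \<le> n"
  shows "inc (\<Sum>t<k. {#ce (2 * t)#}) v \<le> cycle_part 1 v"
proof -
  have "inc (\<Sum>t<k. {#ce (2 * t)#}) v = (\<Sum>t<k. if v \<in> ce (2 * t) then 1 else 0)"
    unfolding inc_sum by (rule sum.cong) simp_all
  also have "\<dots> = card {t. t < k \<and> v \<in> ce (2 * t)}"
    by (simp add: sum.If_cases Int_def)
  also have "\<dots> \<le> cycle_part 1 v"
  proof (cases "v \<in> range x")
    case True
    then obtain j where j: "v = x j" by blast
    have "t = u" if "t < k" "u < k" "v \<in> ce (2 * t)" "v \<in> ce (2 * u)" for t u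
    proof -
      have "2 * t < N" "2 * u < N" "Suc (2 * t) < N" "Suc (2 * u) < N"
        using that(1,2) assms by (simp_all add: N_def)
      then have "2 * t mod N = 2 * t" "2 * u mod N = 2 * u" "Suc (2 * t) mod N = Suc (2 * t)"
        "Suc (2 * u) mod N = Suc (2 * u)"
        by (simp_all only: mod_less)
      then have "j mod N = 2 * t \<or> j mod N = Suc (2 * t)" "j mod N = 2 * u \<or> j mod N = Suc (2 * u)"
        using that(3,4) unfolding j x_mem_ce_iff by simp_all
      moreover define J where "J = j mod N"
      ultimately show ?thesis unfolding J_def [symmetric] by presburger
    qed
    then have "card {t. t < k \<and> v \<in> ce (2 * t)} \<le> 1"
      by (intro card_le_Suc0_iff_eq [THEN iffD2, simplified One_nat_def [symmetric]]) auto
    then show ?thesis using j by (simp add: cycle_part_def)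
  next
    case False
    then have "{t. t < k \<and> v \<in> ce (2 * t)} = {}" by (auto simp: ce_def)
    then show ?thesis by (metis card.empty le0)
  qed
  finally show ?thesis .
qed

lemma decomposable_Suc:
  assumes "decomposable F m (Suc s)" "C \<subseteq> F"
  shows "decomposable F m s"
proof -
  obtain a g where g: "set_mset g \<subseteq> F" "size g + a * (n + 1) = Suc s"
    "\<forall>v. cycle_part a v + inc g v \<le> m v"
    using assms(1) unfolding decomposable_def by blast
  show ?thesis
  proof (cases g)
    case empty
    \<comment> \<open>With no edge left to drop, one factor \<open>u\<close> is replaced by a
      matching of \<open>n\<close> cycle edges dividing it; the value falls from
      \<open>n + 1\<close> to \<open>n\<close>.\<close>
    then obtain b where b: "a = Suc b" using g(2) by (cases a) auto
    let ?g = "\<Sum>t<n. {#ce (2 * t)#}"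
    have "cycle_part b v + inc ?g v \<le> m v" for v
      using g(3) [rule_format, of v] inc_matching [of n v] empty b
      by (auto simp: cycle_part_def split: if_splits)
    moreover have "set_mset ?g \<subseteq> F" using assms(2) by (auto simp: set_mset_sum)
    moreover have "size ?g = n" by (simp add: size_multiset_sum)
    ultimately show ?thesis using g(2) empty b unfolding decomposable_def
      by (intro exI [of _ b] exI [of _ ?g]) auto
  next
    case (add e h)
    have "cycle_part a v + inc h v \<le> m v" for v
      using g(3) [rule_format, of v] add by (auto split: if_splits)
    then show ?thesis using g add unfolding decomposable_def
      by (intro exI [of _ a] exI [of _ h]) auto
  qed
qed

lemma decomposable_mono:
  assumes "decomposable F m t" "s \<le> t" "C \<subseteq> F"
  shows "decomposable F m s"
  using assms(2,1) by (induction rule: inc_induct) (use decomposable_Suc assms(3) in auto)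

text \<open>Stepping by two from \<open>x (Suc i)\<close>, the walk goes twice around the cycle and ends in \<open>x i\<close>. So
  \<open>alt_cover i\<close> is the vertex cover of the cycle that contains both ends of \<open>ce i\<close> and alternates
  otherwise.\<close>

definition alt_cover :: "nat \<Rightarrow> 'v set" where
  "alt_cover i = (\<lambda>t. x (i + 1 + 2 * t)) ` {..n}"

section \<open>Sums along the cycle and alternating covers\<close>

lemma sum_shift_one:
  fixes f :: "nat \<Rightarrow> 'b::comm_monoid_add"
  assumes "\<And>i. f (i + N) = f i"
  shows "(\<Sum>i<N. f (Suc i)) = (\<Sum>i<N. f i)"
proof -
  obtain M where M: "N = Suc M" by (auto simp: N_def)
  have "(\<Sum>i<N. f (Suc i)) = (\<Sum>i<M. f (Suc i)) + f (0 + N)"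
    unfolding M by simp
  also have "\<dots> = (\<Sum>i<N. f i)"
    unfolding assms unfolding M by (simp only: sum.lessThan_Suc_shift add.commute)
  finally show ?thesis .
qed

lemma sum_shift:
  fixes f :: "nat \<Rightarrow> 'b::comm_monoid_add"
  assumes per: "\<And>i. f (i + N) = f i"
  shows "(\<Sum>i<N. f (k + i)) = (\<Sum>i<N. f i)"
proof (induction k)
  case (Suc k)
  have "(\<Sum>i<N. f (k + Suc i)) = (\<Sum>i<N. f (k + i))"
    by (rule sum_shift_one) (metis per add.assoc)
  then show ?case using Suc by simp
qed simp

lemma inj_on_walk: "inj_on (\<lambda>t. x (i + t)) {..<N}"
  by (rule inj_onI) (simp add: x_iff mod_N_cancel)

lemma range_x_eq: "range x = (\<lambda>t. x (i + t)) ` {..<N}"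
proof -
  have "x j \<in> (\<lambda>t. x (i + t)) ` {..<N}" for j
  \<comment> \<open>The number \<open>j + i * (N - 1)\<close> represents \<open>j - i\<close> modulo
    \<open>N\<close>.\<close>
  proof (rule image_eqI [where x = "(j + i * (N - 1)) mod N"])
    have "(i + (j + i * (N - 1)) mod N) mod N = (i + (j + i * (N - 1))) mod N"
      by (simp add: mod_add_right_eq)
    also have "i + (j + i * (N - 1)) = j + N * i"
      using N_ge by (cases N) auto
    finally show "x j = x (i + (j + i * (N - 1)) mod N)"
      by (intro x_eqI) (simp only: mod_mult_self2)
  qed (use N_ge in auto)
  then show ?thesis by auto
qed

lemma sum_cycle_walk:
  fixes m :: "'v \<Rightarrow> 'b::comm_monoid_add"
  shows "(\<Sum>v\<in>range x. m v) = (\<Sum>t<N. m (x (i + t)))"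
  unfolding range_x_eq [of i] by (simp add: sum.reindex inj_on_walk)

lemma sum_double_split:
  fixes f :: "nat \<Rightarrow> 'b::comm_monoid_add"
  shows "(\<Sum>t\<le>2 * k. f t) = (\<Sum>t\<le>k. f (2 * t)) + (\<Sum>t<k. f (Suc (2 * t)))"
  by (induction k) (simp_all add: add_ac)

lemma N_Suc: "{..<N} = {..2 * n}"
  by (auto simp: N_def)

lemma alt_cover_walk:
  assumes "t \<le> 2 * n"
  shows "x (i + 1 + t) \<in> alt_cover i \<longleftrightarrow> even t"
proof
  assume "x (i + 1 + t) \<in> alt_cover i"
  then obtain u where u: "u \<le> n" "x (i + 1 + t) = x (i + 1 + 2 * u)" by (auto simp: alt_cover_def)
  then have "t = 2 * u" using inj_onD [OF inj_on_walk [of "i + 1"] u(2)] assms by (simp add: N_def)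
  then show "even t" by simp
qed (use assms in \<open>auto simp: alt_cover_def elim!: evenE\<close>)

text \<open>On the walk from \<open>x (i + 1)\<close> the even positions are in the cover and every
  odd one is followed by an even one; the closing edge joins the even positions \<open>2 * n\<close>
  and 0.\<close>

lemma alt_cover_covers: "ce j \<inter> alt_cover i \<noteq> {}"
proof -
  have "x j \<in> range x" by simp
  then obtain t where t: "t < N" "x j = x (i + 1 + t)"
    using range_x_eq [of "i + 1"] by auto
  then have j: "j mod N = (i + 1 + t) mod N" by (simp add: x_iff)
  show ?thesis
  proof (cases "even t")
    case True
    then show ?thesis using t alt_cover_walk [of t i] by (auto simp: ce_def N_def)
  next
    case False
    then have "t < 2 * n" using t by (cases "t = 2 * n") (auto simp: N_def)
    then have "x (i + 1 + Suc t) \<in> alt_cover i" using alt_cover_walk [of "Suc t" i] False by simp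
    moreover have "x (Suc j) = x (i + 1 + Suc t)"
      using mod_Suc_cong [OF j] by (intro x_eqI) simp
    ultimately show ?thesis by (auto simp: ce_def)
  qed
qed

lemma sum_alt_cover:
  fixes m :: "'v \<Rightarrow> 'b::comm_monoid_add"
  shows "(\<Sum>v\<in>alt_cover i. m v) = (\<Sum>t\<le>n. m (x (i + 1 + 2 * t)))"
proof -
  have "inj_on (\<lambda>t. x (i + 1 + 2 * t)) {..n}"
  proof (rule inj_onI)
    fix t u assume "t \<in> {..n}" "u \<in> {..n}" "x (i + 1 + 2 * t) = x (i + 1 + 2 * u)"
    then have "2 * t = 2 * u" using inj_onD [OF inj_on_walk [of "i + 1"], of "2 * t" "2 * u"] by (simp add: N_def)
    then show "t = u" by simp
  qed
  then show ?thesis unfolding alt_cover_def by (simp add: sum.reindex)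
qed

lemma alt_cover_sub: "alt_cover i \<subseteq> range x"
  by (auto simp: alt_cover_def)

text \<open>The weight of \<open>alt_cover i\<close> by \<open>sum_alt_cover\<close>, written along
  the walk so that periodicity in \<open>i\<close> is visible.\<close>

definition alt_sum :: "('v \<Rightarrow> nat) \<Rightarrow> nat \<Rightarrow> nat" where
  "alt_sum m i = (\<Sum>t\<le>n. m (x (i + 1 + 2 * t)))"

definition cycle_sum :: "('v \<Rightarrow> nat) \<Rightarrow> nat" where
  "cycle_sum m = (\<Sum>v\<in>range x. m v)"

lemma alt_sum_cong: "i mod N = j mod N \<Longrightarrow> alt_sum m i = alt_sum m j"
  unfolding alt_sum_def by (intro sum.cong refl arg_cong [of _ _ m] x_eqI) (metis mod_add_cong)

lemma alt_sum_add_N: "alt_sum m (i + N) = alt_sum m i"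
  by (rule alt_sum_cong) simp

text \<open>The two walks interleave to one full turn that also returns to its starting vertex, so
  \<open>x (Suc i)\<close> counts twice. Read backwards, this solves the incidence equation at that
  vertex up to the constant \<open>cycle_sum m\<close>.\<close>

lemma alt_sum_add_Suc: "alt_sum m i + alt_sum m (Suc i) = cycle_sum m + m (x (Suc i))"
proof -
  have "alt_sum m i + alt_sum m (Suc i) = (\<Sum>t\<le>n. m (x (i + 1 + 2 * t))) + (\<Sum>t\<le>n. m (x (i + 1 + Suc (2 * t))))"
    unfolding alt_sum_def by (simp add: add_ac)
  also have "\<dots> = (\<Sum>t\<le>2 * n. m (x (i + 1 + t))) + m (x (i + 1 + Suc (2 * n)))"
    unfolding sum_double_split by (simp add: lessThan_Suc_atMost [symmetric] add_ac)
  also have "(\<Sum>t\<le>2 * n. m (x (i + 1 + t))) = cycle_sum m"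
    unfolding cycle_sum_def sum_cycle_walk [of m "i + 1"] N_Suc ..
  also have "i + 1 + Suc (2 * n) = Suc i + N" by (simp add: N_def)
  also have "x (Suc i + N) = x (Suc i)" by (rule x_add_N)
  finally show ?thesis .
qed

text \<open>Each of the \<open>n + 1\<close> positions in the cover runs once through the cycle as
  \<open>i\<close> varies.\<close>

lemma sum_alt_sum: "(\<Sum>i<N. alt_sum m i) = (n + 1) * cycle_sum m"
proof -
  have "(\<Sum>i<N. alt_sum m i) = (\<Sum>t\<le>n. \<Sum>i<N. m (x (i + 1 + 2 * t)))"
    unfolding alt_sum_def by (rule sum.swap)
  also have "\<dots> = (\<Sum>t\<le>n. cycle_sum m)"
  proof (rule sum.cong)
    fix t
    show "(\<Sum>i<N. m (x (i + 1 + 2 * t))) = cycle_sum m"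
      unfolding cycle_sum_def sum_cycle_walk [of m "1 + 2 * t"]
      by (intro sum.cong refl arg_cong [of _ _ m] arg_cong [of _ _ x]) simp
  qed simp
  finally show ?thesis by simp
qed

lemma alt_sum_ge:
  assumes "cover_bound C m s"
  shows "s \<le> alt_sum m i"
  unfolding alt_sum_def sum_alt_cover [symmetric]
  by (rule cover_boundD [OF assms]) (use alt_cover_covers in blast)

lemma sum_incident_cycle_edges:
  fixes f :: "nat \<Rightarrow> nat"
  assumes per: "\<And>i. f (i + N) = f i"
  shows "(\<Sum>i<N. if x (Suc j) \<in> ce i then f i else 0) = f j + f (Suc j)"
proof -
  let ?h = "\<lambda>i. if x (Suc j) \<in> ce i then f i else 0"
  have fc: "f i = f k" if "i mod N = k mod N" for i k
  proof -
    have *: "f (i + N * q) = f i" for i q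
    proof (induction q)
      case (Suc q)
      have "f (i + N * Suc q) = f ((i + N * q) + N)" by (simp add: add_ac)
      then show ?case using Suc per by simp
    qed simp
    have "f i = f (i mod N)" "f k = f (k mod N)"
      using * [of "i mod N" "i div N"] * [of "k mod N" "k div N"] by simp_all
    then show ?thesis using that by simp
  qed
  \<comment> \<open>When the sum starts at \<open>j\<close>, the two edges at
    \<open>x (Suc j)\<close> have offsets 0 and 1.\<close>
  have "(\<Sum>i<N. ?h i) = (\<Sum>i<N. ?h (j + i))"
    by (rule sum_shift [symmetric]) (simp only: ce_eq_add_N per)
  also have "\<dots> = (\<Sum>i\<in>{0, 1}. ?h (j + i))"
  proof (rule sum.mono_neutral_right)
    show "{0, 1} \<subseteq> {..<N}" using N_ge by auto
    show "\<forall>i\<in>{..<N} - {0, 1}. ?h (j + i) = 0"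
    proof
      fix i assume i: "i \<in> {..<N} - {0, 1}"
      have "(j + 1) mod N \<noteq> (j + i) mod N" "(j + 1) mod N \<noteq> (j + Suc i) mod N"
        unfolding mod_N_cancel
      proof -
        show "1 mod N \<noteq> i mod N" using i by auto
        show "1 mod N \<noteq> Suc i mod N"
        proof (cases "Suc i = N")
          case True
          then show ?thesis using N_ge by simp
        next
          case False
          then show ?thesis using i by auto
        qed
      qed
      then show "?h (j + i) = 0" by (simp add: x_mem_ce_iff)
    qed
  qed simp
  also have "\<dots> = f j + f (Suc j)" by (simp add: ce_def)
  finally show ?thesis .
qed

lemma x_obtain_Suc:
  assumes "depth v = 0"
  obtains j where "v = x (Suc j)"
proof -
  obtain i where "v = x i" using assms depth_eq_0_iff by auto
  moreover have "Suc (i + 2 * n) = i + N" by (simp add: N_def)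
  ultimately have "v = x (Suc (i + 2 * n))" by (simp only: x_add_N)
  then show ?thesis by (rule that)
qed

text \<open>Subtracting \<open>s\<close> from the alternating sums solves the incidence equation
  exactly, with \<open>2 * s - cycle_sum m\<close> copies of \<open>u\<close> making up the
  constant. The two hypotheses say that these exponents are nonnegative.\<close>

lemma decomposable_balanced:
  assumes ge: "\<And>i. s \<le> alt_sum m i" and le: "cycle_sum m \<le> 2 * s"
  shows "decomposable C m s"
proof -
  define g where "g = (\<Sum>i<N. replicate_mset (alt_sum m i - s) (ce i))"
  define a where "a = 2 * s - cycle_sum m"
  have "(\<Sum>i<N. alt_sum m i - s) + (\<Sum>i<N. s) = (\<Sum>i<N. alt_sum m i)"
    unfolding sum.distrib [symmetric] using ge by (intro sum.cong) simp_all
  then have "size g + N * s = (n + 1) * cycle_sum m"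
    unfolding g_def by (simp add: size_multiset_sum sum_alt_sum)
  moreover have "a + cycle_sum m = 2 * s" using le by (simp add: a_def)
  then have "(n + 1) * a + (n + 1) * cycle_sum m = (n + 1) * (2 * s)"
    by (metis distrib_left)
  \<comment> \<open>The identity \<open>2 * (n + 1) = N + 1\<close> makes the total value exactly
    \<open>s\<close>.\<close>
  moreover have "(n + 1) * (2 * s) = N * s + s" by (simp add: N_def algebra_simps)
  ultimately have "size g + a * (n + 1) = s" by (simp add: mult.commute)
  moreover have "set_mset g \<subseteq> C"
    unfolding g_def by (auto simp: set_mset_sum split: if_splits)
  moreover have "cycle_part a v + inc g v \<le> m v" for v
  proof (cases "depth v = 0")
    case True
    then obtain j where v: "v = x (Suc j)" by (rule x_obtain_Suc)
    have "inc g v = (\<Sum>i<N. if x (Suc j) \<in> ce i then alt_sum m i - s else 0)"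
      unfolding g_def inc_sum v by simp
    also have "\<dots> = (alt_sum m j - s) + (alt_sum m (Suc j) - s)"
      by (rule sum_incident_cycle_edges) (simp only: alt_sum_add_N)
    finally show ?thesis
      using alt_sum_add_Suc [of m j] ge [of j] ge [of "Suc j"] le True
      unfolding v a_def cycle_part_def by simp
  next
    case False
    then have "v \<notin> ce i" for i by (auto simp: ce_def)
    then show ?thesis using False by (simp add: g_def inc_sum cycle_part_def)
  qed
  ultimately show ?thesis unfolding decomposable_def by blast
qed

end

text \<open>Sliding a window by \<open>u\<close> loses the first \<open>u\<close> terms and gains
  the next \<open>u\<close>.\<close>

lemma sum_window:
  fixes f :: "nat \<Rightarrow> 'b::comm_monoid_add"
  shows "(\<Sum>q\<le>k. f (u + q)) + (\<Sum>q<u. f q) = (\<Sum>q\<le>k. f q) + (\<Sum>q<u. f (k + 1 + q))"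
proof (induction u)
  case (Suc u)
  have "(\<Sum>q\<le>k. f (Suc u + q)) + f u = (\<Sum>q\<le>Suc k. f (u + q))"
    unfolding sum.atMost_Suc_shift by (simp add: add.commute)
  also have "\<dots> = (\<Sum>q\<le>k. f (u + q)) + f (k + 1 + u)"
    by (simp add: add_ac)
  finally have "(\<Sum>q\<le>k. f (Suc u + q)) + f u = (\<Sum>q\<le>k. f (u + q)) + f (k + 1 + u)" .
  moreover have "(\<Sum>q\<le>k. f (Suc u + q)) + (\<Sum>q<Suc u. f q) =
      ((\<Sum>q\<le>k. f (Suc u + q)) + f u) + (\<Sum>q<u. f q)"
    by (simp only: sum.lessThan_Suc add_ac)
  ultimately have "(\<Sum>q\<le>k. f (Suc u + q)) + (\<Sum>q<Suc u. f q) =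
      ((\<Sum>q\<le>k. f (u + q)) + (\<Sum>q<u. f q)) + f (k + 1 + u)"
    by (simp only: add_ac)
  then show ?case unfolding Suc.IH by (simp only: sum.lessThan_Suc add_ac)
qed simp

section \<open>Weights on the cycle alone\<close>

context cycle_with_trees begin

lemma ce_obtain_walk:
  obtains t where "t < N" "ce j = ce (i + t)"
proof -
  have "x j \<in> range x" by simp
  then obtain t where t: "t < N" "x j = x (i + t)"
    using range_x_eq [of "i"] by auto
  then have "ce j = ce (i + t)" by (intro ce_eqI) (simp add: x_iff)
  then show ?thesis using t(1) by (intro that)
qed

text \<open>If a cover \<open>W\<close> of the path misses the deleted edge, shift it along an initial segment of the
  path by one step; the minimality of \<open>alt_sum m i\<close> makes this shift cheap.\<close>

lemma cover_bound_delete_edge: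
  assumes cov: "cover_bound C m s"
    and min: "\<And>j. alt_sum m i \<le> alt_sum m j"
    and small: "2 * alt_sum m i \<le> cycle_sum m"
  shows "cover_bound (C - {ce i}) m s"
  unfolding cover_bound_def
proof (intro allI impI)
  fix W assume W: "\<forall>e\<in>C - {ce i}. e \<inter> W \<noteq> {}"
  show "s \<le> (\<Sum>v\<in>W. m v)"
  proof (cases "ce i \<inter> W = {}")
    case False
    then show ?thesis using W by (intro cover_boundD [OF cov]) blast
  next
    case True
    define p where "p t = x (i + 1 + t)" for t
    have p_inj: "t = u" if "p t = p u" "t < N" "u < N" for t u
      using inj_onD [OF inj_on_walk [of "i + 1"], of t u] that by (simp add: p_def)
    have p_wrap: "p (t + N) = p t" for t
    proof -
      have "i + 1 + (t + N) = (i + 1 + t) + N" by simp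
      then show ?thesis unfolding p_def by (simp only: x_add_N)
    qed
    have p0: "p 0 \<notin> W" using True by (auto simp: p_def ce_def)
    have edge: "p t \<in> W \<or> p (Suc t) \<in> W" if "t < 2 * n" for t
    proof -
      have "p t \<noteq> p (2 * n)" using p_inj [of t "2 * n"] that by (auto simp: N_def)
      moreover have "i + 1 + 2 * n = i + N" by (simp add: N_def)
      then have "p (2 * n) = x i" unfolding p_def by (simp only: x_add_N)
      ultimately have "ce (i + 1 + t) \<noteq> ce i" by (auto simp: ce_eq_iff p_def x_iff)
      then have "ce (i + 1 + t) \<inter> W \<noteq> {}" using W by blast
      then show ?thesis by (auto simp: p_def ce_def)
    qed
    show ?thesis
    proof (cases "\<exists>t. t \<le> n \<and> p (2 * t) \<in> W")
      case False
      \<comment> \<open>No even position is in \<open>W\<close>, so \<open>W\<close> contains every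
        odd one. These form the complement of \<open>alt_cover i\<close>, which weighs at least as
        much as \<open>alt_cover i\<close> by \<open>small\<close>.\<close>
      have "range x - alt_cover i \<subseteq> W"
      proof
        fix v assume v: "v \<in> range x - alt_cover i"
        then obtain t where t: "t < N" "v = p t"
          unfolding p_def using range_x_eq [of "i + 1"] by auto
        then have "odd t" using v alt_cover_walk [of t i] by (auto simp: p_def N_def)
        then obtain u where u: "t = Suc (2 * u)" by (elim oddE) simp
        then show "v \<in> W" using edge [of "2 * u"] False t by (auto simp: N_def)
      qed
      then have "(\<Sum>v\<in>range x - alt_cover i. m v) \<le> (\<Sum>v\<in>W. m v)"
        by (intro sum_mono2) auto
      moreover have "(\<Sum>v\<in>range x - alt_cover i. m v) = cycle_sum m - alt_sum m i"
        unfolding cycle_sum_def alt_sum_def sum_alt_cover [symmetric]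
        by (rule sum_diff_nat) (auto simp: alt_cover_sub)
      ultimately show ?thesis using small alt_sum_ge [OF cov, of i] by linarith
    next
      case True
      \<comment> \<open>Before the first even position \<open>2 * u\<close> in \<open>W\<close>, the
        cover uses the odd positions. Exchanging them for the even ones brings in
        \<open>p 0\<close>, an end of the deleted edge.\<close>
      define u where "u = (LEAST t. t \<le> n \<and> p (2 * t) \<in> W)"
      have u: "u \<le> n" "p (2 * u) \<in> W" using LeastI_ex [OF True] unfolding u_def by auto
      have less: "p (2 * t) \<notin> W" if "t < u" for t
        using not_less_Least [of t "\<lambda>t. t \<le> n \<and> p (2 * t) \<in> W"] that u unfolding u_def by auto
      have u_pos: "0 < u" using u p0 by (cases u) auto
      define Ev where "Ev = (\<lambda>t. p (2 * t)) ` {..<u}"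
      define Od where "Od = (\<lambda>t. p (Suc (2 * t))) ` {..<u}"
      have Od_W: "Od \<subseteq> W"
      proof -
        have "p (Suc (2 * t)) \<in> W" if "t < u" for t
          using less [OF that] edge [of "2 * t"] that u(1) by auto
        then show ?thesis by (auto simp: Od_def)
      qed
      have Od_less: "p t \<notin> Od" if "2 * u \<le> t" "t < N" for t
        unfolding Od_def using that u(1) by (auto dest!: p_inj simp: N_def)
      define W' where "W' = (W - Od) \<union> Ev"
      have "s \<le> (\<Sum>v\<in>W'. m v)"
      proof (rule cover_boundD [OF cov])
        fix e assume "e \<in> C"
        then obtain j where j: "e = ce j" by blast
        obtain t where t: "t < N" "ce j = {p t, p (Suc t)}"
          using ce_obtain_walk [of j "i + 1"] unfolding p_def ce_def by auto
        have "t < 2 * n + 1" using t(1) by (simp add: N_def)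
        then have "even t \<and> t < 2 * u \<or> odd t \<and> Suc t < 2 * u \<or> Suc t = 2 * u \<or>
            2 * u \<le> t \<and> t < 2 * n \<or> t = 2 * n"
          by presburger
        then consider "even t" "t < 2 * u" | "odd t" "Suc t < 2 * u" | "Suc t = 2 * u" |
            "2 * u \<le> t" "t < 2 * n" | "t = 2 * n"
          by blast
        then have "p t \<in> W' \<or> p (Suc t) \<in> W'"
        proof cases
          case 1
          then obtain b where b: "t = 2 * b" by (elim evenE)
          then have "b \<in> {..<u}" using 1 by auto
          then have "p t \<in> Ev" unfolding Ev_def b by blast
          then show ?thesis by (simp add: W'_def)
        next
          case 2
          then obtain b where b: "t = Suc (2 * b)" by (elim oddE) simp
          then have "Suc b \<in> {..<u}" "Suc t = 2 * Suc b" using 2 by auto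
          then have "p (Suc t) \<in> Ev" unfolding Ev_def by (metis imageI)
          then show ?thesis by (simp add: W'_def)
        next
          case 3
          then have "p (Suc t) \<in> W - Od" using Od_less [of "2 * u"] u by (simp add: N_def)
          then show ?thesis by (auto simp: W'_def)
        next
          case 4
          then show ?thesis using edge [of t] Od_less [of t] Od_less [of "Suc t"]
            by (auto simp: W'_def N_def)
        next
          case 5
          then have "p (Suc t) = p 0" using p_wrap [of 0] by (simp add: N_def)
          moreover have "p (2 * 0) \<in> Ev" unfolding Ev_def using u_pos by blast
          ultimately show ?thesis by (simp add: W'_def)
        qed
        then show "e \<inter> W' \<noteq> {}" using j t by auto
      qed
      also have "\<dots> \<le> (\<Sum>v\<in>W - Od. m v) + (\<Sum>v\<in>Ev. m v)"
        unfolding W'_def by (simp add: sum_Un_nat)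
      \<comment> \<open>Sliding \<open>alt_cover i\<close> by \<open>2 * u\<close> exchanges
        \<open>Ev\<close> for \<open>Od\<close>, because position \<open>2 * (n + 1 + t)\<close> is
        \<open>Suc (2 * t)\<close> one turn later. By minimality the slid cover is not
        lighter.\<close>
      also have "(\<Sum>v\<in>Ev. m v) \<le> (\<Sum>v\<in>Od. m v)"
      proof -
        have "(\<Sum>v\<in>Ev. m v) = (\<Sum>t<u. m (p (2 * t)))"
          unfolding Ev_def using u(1)
          by (subst sum.reindex) (auto simp: inj_on_def N_def dest!: p_inj)
        moreover have "(\<Sum>v\<in>Od. m v) = (\<Sum>t<u. m (p (Suc (2 * t))))"
          unfolding Od_def using u(1)
          by (subst sum.reindex) (auto simp: inj_on_def N_def dest!: p_inj)
        moreover have "p (2 * (n + 1 + t)) = p (Suc (2 * t))" for t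
        proof -
          have "2 * (n + 1 + t) = Suc (2 * t) + N" by (simp add: N_def)
          then show ?thesis by (simp only: p_wrap)
        qed
        moreover have "alt_sum m (i + 2 * u) = (\<Sum>q\<le>n. m (p (2 * (u + q))))"
          unfolding alt_sum_def p_def by (simp add: algebra_simps)
        moreover have "alt_sum m i = (\<Sum>q\<le>n. m (p (2 * q)))"
          unfolding alt_sum_def p_def ..
        ultimately show ?thesis
          using sum_window [of "\<lambda>q. m (p (2 * q))" u n] min [of "i + 2 * u"] by simp
      qed
      also have "(\<Sum>v\<in>W - Od. m v) + (\<Sum>v\<in>Od. m v) = (\<Sum>v\<in>W. m v)"
        using Od_W by (simp add: sum.subset_diff [of Od W m])
      finally show ?thesis by simp
    qed
  qed
qed

lemma decomposable_superset: "decomposable F m s \<Longrightarrow> F \<subseteq> F' \<Longrightarrow> decomposable F' m s"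
  unfolding decomposable_def by blast

text \<open>The explicit solution needs \<open>cycle_sum m \<le> 2 * s\<close> and alternating sums
  at least \<open>s\<close>. If the weights are too large but balanced, \<open>s\<close> is raised
  until they fit; if some alternating cover is lighter than half of the cycle, a lightest one shows
  which edge can be deleted.\<close>

lemma decomposable_cycle:
  assumes cov: "cover_bound C m s"
  shows "decomposable C m s"
proof -
  consider "cycle_sum m \<le> 2 * s" | "2 * s < cycle_sum m" "\<And>i. cycle_sum m \<le> 2 * alt_sum m i"
    | i where "2 * alt_sum m i < cycle_sum m" by (meson not_le)
  then show ?thesis
  proof cases
    case 1
    then show ?thesis using alt_sum_ge [OF cov] by (intro decomposable_balanced)
  next
    case 2
    \<comment> \<open>The least value satisfying \<open>cycle_sum m \<le> 2 * ?s\<close>; every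
      alternating sum still reaches it.\<close>
    let ?s = "(cycle_sum m + 1) div 2"
    have "decomposable C m ?s"
    proof (rule decomposable_balanced)
      show "?s \<le> alt_sum m i" for i using 2(2) [of i] by linarith
    qed linarith
    then show ?thesis by (rule decomposable_mono) (use 2 in auto)
  next
    case 3
    define i' where "i' = arg_min (alt_sum m) (\<lambda>_. True)"
    have min: "alt_sum m i' \<le> alt_sum m j" for j
      unfolding i'_def by (rule arg_min_nat_le) simp
    have "cover_bound (C - {ce i'}) m s"
      using 3 min [of i] by (intro cover_bound_delete_edge [OF cov min]) linarith
    then have "matchable (C - {ce i'}) m s"
      by (rule matchable_forest) (use C_sub_E in auto)
    then show ?thesis
      by (rule decomposable_superset [OF matchable_imp_decomposable]) auto
  qed
qed

text \<open>The subgraph \<open>F\<close> varies because the support shrinks. Leaf removal stops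
  when the support is exactly the cycle, where \<open>decomposable_cycle\<close> takes over.\<close>

theorem decomposable_if_cover_bound:
  "cover_bound F m s \<Longrightarrow> F \<subseteq> E \<Longrightarrow> decomposable E m s"
proof (induction s arbitrary: F m)
  case 0
  show ?case unfolding decomposable_def cycle_part_def
    by (rule exI [of _ 0], rule exI [of _ "{#}"]) auto
next
  case (Suc s)
  show ?case
  proof (cases "{e \<in> F. \<forall>v\<in>e. m v > 0} = C")
    case True
    then show ?thesis
      using decomposable_cycle cover_bound_restrict [OF Suc.prems(1)] decomposable_superset C_sub_E
      by metis
  next
    case False
    then obtain F' p q where *: "F' \<subseteq> F" "p \<noteq> q" "{p, q} \<in> F'" "m p > 0" "m q > 0"
      "cover_bound F' (m(p := m p - 1, q := m q - 1)) s"
      using leaf_step [OF Suc.prems(1,2)] by blast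
    then obtain a g where g: "set_mset g \<subseteq> E" "size g + a * (n + 1) = s"
      "\<forall>v. cycle_part a v + inc g v \<le> (m(p := m p - 1, q := m q - 1)) v"
      using Suc.IH [OF *(6)] Suc.prems unfolding decomposable_def by blast
    have "\<forall>v. cycle_part a v + inc (add_mset {p, q} g) v \<le> m v"
      by (rule inc_add_edge_le) (use g * in auto)
    then show ?thesis unfolding decomposable_def
      by (intro exI [of _ a] exI [of _ "add_mset {p, q} g"]) (use g * Suc.prems in auto)
  qed
qed

end

section \<open>Edge covers of the cycle and redundant generators\<close>

lemma inc_pos_iff: "0 < inc g v \<longleftrightarrow> (\<exists>e\<in>#g. v \<in> e)"
  by (induction g) auto

section \<open>The inverse of the incidence matrix and short edge covers\<close>

context cycle_with_trees begin

definition root :: "'v \<Rightarrow> 'v" where "root v = (par ^^ depth v) v"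

lemma root_par:
  assumes "depth v > 0"
  shows "root (par v) = root v"
proof -
  have "root v = (par ^^ Suc (depth (par v))) v" unfolding root_def by (metis assms depth_par)
  then show ?thesis by (simp only: root_def funpow_Suc_right o_apply)
qed

lemma root_eq_self: "depth v = 0 \<Longrightarrow> root v = v"
  by (simp add: root_def)

lemma root_in_cycle: "root v \<in> range x"
proof (induction "depth v" arbitrary: v)
  case 0
  then show ?case by (metis depth_eq_0_iff root_eq_self)
next
  case (Suc k)
  then have "k = depth (par v)" using depth_par [of v] by simp
  then show ?case using Suc root_par [of v] by (metis zero_less_Suc)
qed

text \<open>The row of the inverse incidence matrix that belongs to the edge \<open>ce i\<close>, times two.\<close>

definition dual :: "nat \<Rightarrow> 'v \<Rightarrow> int" where
  "dual i v = (-1) ^ depth v * (if root v \<in> alt_cover i then 1 else -1)"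

lemma dual_cases: "dual i v = 1 \<or> dual i v = -1"
proof -
  have "(-1) ^ depth v = (1::int) \<or> (-1) ^ depth v = (-1::int)"
    by (cases "even (depth v)") auto
  then show ?thesis unfolding dual_def by auto
qed

lemma dual_x: "dual i (x j) = (if x j \<in> alt_cover i then 1 else -1)"
  by (simp add: dual_def root_eq_self)

lemma dual_walk:
  assumes "t \<le> 2 * n"
  shows "dual i (x (i + 1 + t)) = (if even t then 1 else -1)"
  unfolding dual_x alt_cover_walk [OF assms] ..

lemma ce_walk_eq_iff:
  assumes "t \<le> 2 * n"
  shows "ce (i + 1 + t) = ce i \<longleftrightarrow> t = 2 * n"
proof -
  have "ce (i + 1 + t) = ce i \<longleftrightarrow> (i + (1 + t)) mod N = (i + 0) mod N"
    by (simp add: ce_eq_iff)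
  also have "\<dots> \<longleftrightarrow> (1 + t) mod N = 0"
    unfolding mod_N_cancel by simp
  also have "\<dots> \<longleftrightarrow> t = 2 * n"
    using assms by (cases "t = 2 * n") (auto simp: N_def)
  finally show ?thesis .
qed

lemma x_walk_end: "x (i + 1 + 2 * n) = x i"
proof -
  have "i + 1 + 2 * n = i + N" by (simp add: N_def)
  then show ?thesis by (simp only: x_add_N)
qed

lemma sum_ce: "(\<Sum>v\<in>ce j. f v) = f (x j) + f (x (Suc j))"
  unfolding ce_def using x_Suc_neq [of j] by (subst sum.insert) auto

text \<open>Along a tree edge the root stays and the depth changes parity, so the signs cancel.
  Around the cycle the signs alternate, except that both ends of \<open>ce i\<close> are in
  \<open>alt_cover i\<close>.\<close>

lemma dual_edge:
  assumes "e \<in> E"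
  shows "(\<Sum>v\<in>e. dual i v) = (if e = ce i then 2 else 0)"
  using assms
proof (cases e rule: E_cases)
  case (cycle j)
  obtain t where t: "t < N" "ce j = ce (i + 1 + t)" by (rule ce_obtain_walk)
  have sum: "(\<Sum>v\<in>e. dual i v) = dual i (x (i + 1 + t)) + dual i (x (i + 1 + Suc t))"
    unfolding cycle t(2) sum_ce by simp
  show ?thesis
  proof (cases "t = 2 * n")
    case True
    have "x (i + 1 + Suc t) = x (i + 1 + 0)"
      using x_walk_end [of "Suc i"] True by simp
    then have "(\<Sum>v\<in>e. dual i v) = 2"
      unfolding sum using dual_walk [of t i] dual_walk [of 0 i] True by simp
    then show ?thesis using cycle t True ce_walk_eq_iff [of t i] by simp
  next
    case False
    then have "(\<Sum>v\<in>e. dual i v) = 0"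
      unfolding sum using dual_walk [of t i] dual_walk [of "Suc t" i] t(1) by (simp add: N_def)
    then show ?thesis using cycle t False ce_walk_eq_iff [of t i] by (simp add: N_def)
  qed
next
  case (tree v)
  have "u \<in> ce i \<Longrightarrow> depth u = 0" for u by (auto simp: ce_def)
  moreover have "v \<in> e" using tree(2) by simp
  ultimately have "e \<noteq> ce i" using tree(1) by (metis less_irrefl)
  moreover have "(\<Sum>u\<in>e. dual i u) = dual i v + dual i (par v)"
    unfolding tree using par_neq [OF tree(1)] by simp
  moreover have "dual i v = - dual i (par v)"
    unfolding dual_def root_par [OF tree(1)] depth_par [OF tree(1)] by simp
  ultimately show ?thesis by simp
qed

lemma sum_dual_inc:
  assumes "set_mset g \<subseteq> E"
  shows "(\<Sum>v\<in>UNIV. dual i v * int (inc g v)) = 2 * int (count g (ce i))"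
proof -
  have "(\<Sum>v\<in>UNIV. dual i v * int (inc g v)) = (\<Sum>e\<in>#g. \<Sum>v\<in>e. dual i v)"
    by (rule sum_inc_weighted)
  also have "\<dots> = 2 * int (count g (ce i))"
    using assms by (induction g) (auto simp: dual_edge)
  finally show ?thesis .
qed

lemma sum_alternating: "(\<Sum>t\<le>2 * (k::nat). if even t then 1 else -1 :: int) = 1"
  by (induction k) auto

text \<open>Around an odd cycle, alternating signs that start with a plus add up to 1.\<close>

lemma sum_dual_cycle_part: "(\<Sum>v\<in>UNIV. dual i v * int (cycle_part c v)) = int c"
proof -
  have "(\<Sum>v\<in>UNIV. dual i v * int (cycle_part c v)) = (\<Sum>v\<in>range x. dual i v * int (cycle_part c v))"
    by (rule sum.mono_neutral_right) (auto simp: cycle_part_def depth_eq_0_iff)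
  also have "\<dots> = (\<Sum>t\<le>2 * n. dual i (x (i + 1 + t)) * int c)"
    unfolding sum_cycle_walk [of _ "i + 1"] N_Suc by (simp add: cycle_part_def)
  also have "\<dots> = (\<Sum>t\<le>2 * n. if even t then 1 else -1 :: int) * int c"
    unfolding sum_distrib_right by (intro sum.cong refl) (use dual_walk [of _ i] in auto)
  finally show ?thesis by (simp add: sum_alternating)
qed

lemma count_cycle_edge:
  assumes "set_mset g \<subseteq> E" "set_mset h \<subseteq> E"
    and "\<And>v. inc g v = cycle_part c v + inc h v + w v"
  shows "2 * int (count g (ce i)) = int c + 2 * int (count h (ce i)) + (\<Sum>v\<in>UNIV. dual i v * int (w v))"
  unfolding sum_dual_inc [OF assms(1), symmetric] sum_dual_inc [OF assms(2), symmetric]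
    sum_dual_cycle_part [of i c, symmetric]
  by (simp add: assms(3) algebra_simps sum.distrib)

text \<open>After cancelling the common part, a leaf of the joint support would lie on an edge of
  only one multiset. If the support is the whole cycle there is no leaf, and \<open>dual 0\<close>
  compares the multiplicities of \<open>ce 0\<close>.\<close>

lemma inc_inject:
  assumes "set_mset g \<subseteq> E" "set_mset h \<subseteq> E" and eq: "\<And>v. inc g v = inc h v"
  shows "g = h"
proof -
  define d where "d = g \<inter># h"
  define g' where "g' = g - d"
  define h' where "h' = h - d"
  have gd: "g = g' + d" and hd: "h = h' + d" unfolding g'_def h'_def d_def by (auto intro!: multiset_eqI)
  have disj: "set_mset g' \<inter> set_mset h' = {}"
  proof -
    have "count g' e = 0 \<or> count h' e = 0" for e
      unfolding g'_def h'_def d_def by auto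
    then show ?thesis by (metis disjoint_iff not_in_iff)
  qed
  have sub: "set_mset g' \<subseteq> E" "set_mset h' \<subseteq> E"
    using assms(1,2) unfolding gd hd by auto
  have eq': "inc g' v = inc h' v" for v using eq [of v] unfolding gd hd by simp
  have "set_mset g' \<union> set_mset h' = {}"
  proof (rule ccontr)
    assume ne: "set_mset g' \<union> set_mset h' \<noteq> {}"
    show False
    proof (cases "set_mset g' \<union> set_mset h' = C")
      case True
      have "count g' (ce 0) = count h' (ce 0)"
        using sum_dual_inc [OF sub(1), of 0] sum_dual_inc [OF sub(2), of 0] eq' by simp
      moreover have "ce 0 \<in># g' \<or> ce 0 \<in># h'" using True by blast
      ultimately show False using disj by (metis disjoint_iff not_in_iff)
    next
      case False
      then obtain p q where pq: "{p, q} \<in> set_mset g' \<union> set_mset h'"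
        "\<And>e. e \<in> set_mset g' \<union> set_mset h' \<Longrightarrow> q \<in> e \<Longrightarrow> e = {p, q}"
        using ex_leaf [OF _ ne False] sub by (metis Un_subset_iff)
      have "0 < inc g' q \<or> 0 < inc h' q" using pq(1) by (auto simp: inc_pos_iff)
      then have "0 < inc g' q" "0 < inc h' q" using eq' [of q] by simp_all
      then show False using pq(2) disj unfolding inc_pos_iff by (metis UnI1 UnI2 disjoint_iff)
    qed
  qed
  then show ?thesis unfolding gd hd by simp
qed

text \<open>By \<open>min_cover_iff\<close> these are the minimum covers of either type: whenever
  covers of a type exist, the minimum is \<open>n + 1\<close>.\<close>

definition short_cover :: "'v set set \<Rightarrow> bool" where
  "short_cover L \<longleftrightarrow> L \<subseteq> E \<and> range x \<subseteq> \<Union>L \<and> card L = n + 1"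

lemma card_cycle: "card (range x) = N"
  unfolding range_x_eq [of 0] by (subst card_image) (use inj_on_walk [of 0] in simp_all)

text \<open>An edge covers at most two of the \<open>2 * n + 1\<close> cycle vertices.\<close>

lemma card_cover_ge:
  assumes "L \<subseteq> E" "range x \<subseteq> \<Union>L"
  shows "n + 1 \<le> card L"
proof -
  have "N \<le> card (\<Union>L)" unfolding card_cycle [symmetric] using assms by (intro card_mono) auto
  also have "\<dots> \<le> (\<Sum>e\<in>L. card e)" by (rule card_Union_le_sum_card)
  also have "\<dots> = (\<Sum>e\<in>L. 2)" using assms card_edge by (intro sum.cong) auto
  finally show ?thesis by (simp add: N_def)
qed

text \<open>A perfect matching of the cycle without \<open>x (Suc j)\<close>.\<close>

definition almost_matching :: "nat \<Rightarrow> 'v set set" where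
  "almost_matching j = (\<lambda>t. ce (j + 2 + 2 * t)) ` {..<n}"

lemma insert_almost_matching:
  assumes "x (Suc j) \<in> f"
  shows "range x \<subseteq> \<Union>(insert f (almost_matching j))" "card (insert f (almost_matching j)) \<le> n + 1"
proof -
  show "range x \<subseteq> \<Union>(insert f (almost_matching j))"
  proof
    fix u assume "u \<in> range x"
    then obtain t where t: "t < N" "u = x (Suc j + t)" using range_x_eq [of "Suc j"] by auto
    show "u \<in> \<Union>(insert f (almost_matching j))"
    proof (cases t)
      case 0
      then show ?thesis using assms t by simp
    next
      case (Suc q)
      then have "u \<in> ce (j + 2 + 2 * (q div 2))"
        unfolding ce_def t(2) by (cases "even q") (auto elim!: evenE oddE)
      moreover have "q div 2 < n" using t(1) Suc by (simp add: N_def)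
      then have "ce (j + 2 + 2 * (q div 2)) \<in> almost_matching j"
        unfolding almost_matching_def by (intro imageI) simp
      ultimately show ?thesis by (metis UnionI insertCI)
    qed
  qed
  show "card (insert f (almost_matching j)) \<le> n + 1"
    unfolding almost_matching_def
    using card_image_le [of "{..<n}" "\<lambda>t. ce (j + 2 + 2 * t)"] by (simp add: card_insert_if)
qed

text \<open>Solve the incidence equation for the coefficients of the cycle edges. A vertex of even depth in
  the support of \<open>w\<close> forces a cover inside the cycle; a vertex of odd depth forces a perfect
  matching of the cycle minus its root, and every vertex of the cycle is incident to some edge of \<open>g\<close>.\<close>

lemma short_cover_if_excess:
  assumes gh: "set_mset g \<subseteq> E" "set_mset h \<subseteq> E"
    and eq: "\<And>v. inc g v = cycle_part c v + inc h v + w v"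
    and w: "(\<Sum>v\<in>UNIV. w v) = c" "c > 0"
  obtains L where "L \<subseteq> set_mset g" "short_cover L"
proof -
  \<comment> \<open>Since \<open>w\<close> has degree \<open>c\<close>, the constant can be
    distributed over \<open>w\<close>, and every term \<open>(1 + dual i v) * w v\<close> is
    nonnegative. One positive term forces \<open>ce i\<close> into \<open>g\<close>.\<close>
  have mem: "ce i \<in># g" if "w v > 0" "dual i v = 1" for v i
  proof -
    have "2 * int (count g (ce i)) = 2 * int (count h (ce i)) + (\<Sum>v\<in>UNIV. (1 + dual i v) * int (w v))"
      unfolding count_cycle_edge [OF gh eq] w(1) [symmetric] by (simp add: algebra_simps sum.distrib)
    moreover have "0 < (\<Sum>v\<in>UNIV. (1 + dual i v) * int (w v))"
      by (rule sum_pos2 [of _ v]) (use that dual_cases [of i] in \<open>auto simp: mult_nonneg_nonneg\<close>, smt (verit) mult_nonneg_nonneg of_nat_0_le_iff)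
    ultimately have "count g (ce i) > 0" by linarith
    then show ?thesis by simp
  qed
  obtain v0 where v0: "w v0 > 0" using w by (metis gr0I less_irrefl sum.neutral)
  have "\<exists>L\<subseteq>set_mset g. range x \<subseteq> \<Union>L \<and> card L \<le> n + 1"
  proof (cases "\<exists>v. w v > 0 \<and> even (depth v)")
    case True
    then obtain v where v: "w v > 0" "even (depth v)" by blast
    obtain j where j: "root v = x j" using root_in_cycle [of v] by blast
    have *: "ce (j + 2 * t) \<in># g" if "t \<le> n" for t
    proof (rule mem [OF v(1)])
      \<comment> \<open>From \<open>j + 2 * t + 1\<close>, another \<open>n - t\<close> double steps
        end at \<open>x j\<close>, so the root lies in each of these covers.\<close>
      have "j + 2 * t + 1 + 2 * (n - t) = j + N" using that by (simp add: N_def)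
      then have "x j = x (j + 2 * t + 1 + 2 * (n - t))" by (simp only: x_add_N)
      also have "\<dots> \<in> alt_cover (j + 2 * t)" unfolding alt_cover_def using that by auto
      finally show "dual (j + 2 * t) v = 1" unfolding dual_def using j v(2) by simp
    qed
    have "ce (j + 2 + 2 * t) \<in># g" if "t < n" for t using * [of "Suc t"] that by simp
    then have "insert (ce j) (almost_matching j) \<subseteq> set_mset g"
      using * [of 0] unfolding almost_matching_def by auto
    moreover have "x (Suc j) \<in> ce j" by (simp add: ce_def)
    ultimately show ?thesis using insert_almost_matching [of j "ce j"] by (metis (no_types, lifting))
  next
    case False
    obtain j where j: "root v0 = x (Suc j)"
      using root_in_cycle [of v0] x_obtain_Suc [of "root v0"] depth_eq_0_iff by metis
    have M: "ce (j + 2 + 2 * t) \<in># g" if "t < n" for t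
    proof (rule mem [OF v0])
      \<comment> \<open>The root is an odd number of steps away from the start of the walk and so
        lies outside the cover; the odd depth turns the sign into a plus.\<close>
      have "j + 2 + 2 * t + 1 + (2 * (n - t) - 1) = Suc j + N" using that by (simp add: N_def)
      then have "x (Suc j) = x (j + 2 + 2 * t + 1 + (2 * (n - t) - 1))" by (simp only: x_add_N)
      moreover have "x (j + 2 + 2 * t + 1 + (2 * (n - t) - 1)) \<notin> alt_cover (j + 2 + 2 * t)"
        using alt_cover_walk [of "2 * (n - t) - 1" "j + 2 + 2 * t"] that by simp
      ultimately have "root v0 \<notin> alt_cover (j + 2 + 2 * t)" using j by metis
      moreover have "odd (depth v0)" using v0 False by blast
      ultimately show "dual (j + 2 + 2 * t) v0 = 1" unfolding dual_def by simp
    qed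
    \<comment> \<open>The root is covered because \<open>c > 0\<close>; the edge \<open>f\<close>
      covering it may be a tree edge, as in a Type-II cover.\<close>
    have "0 < inc g (x (Suc j))" using eq [of "x (Suc j)"] w(2) by (simp add: cycle_part_def)
    then obtain f where f: "f \<in># g" "x (Suc j) \<in> f" unfolding inc_pos_iff by blast
    have "insert f (almost_matching j) \<subseteq> set_mset g"
      unfolding almost_matching_def using f M by auto
    then show ?thesis using insert_almost_matching [OF f(2)] by (metis (no_types, lifting))
  qed
  then obtain L where L: "L \<subseteq> set_mset g" "range x \<subseteq> \<Union>L" "card L \<le> n + 1" by blast
  then have "short_cover L"
    unfolding short_cover_def using gh(1) card_cover_ge [of L] by (intro conjI) auto
  then show ?thesis using that L by blast
qed

end

section \<open>Counting irredundant generators\<close>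

lemma mset_set_subseteq_mset: "A \<subseteq> set_mset g \<Longrightarrow> mset_set A \<subseteq># g"
  by (rule mset_subset_eqI) (auto simp: count_mset_set' Suc_le_eq)

lemma set_mset_eq_iff_mset_set_subseteq:
  assumes "finite A"
  shows "set_mset g = A \<and> size g = j \<longleftrightarrow> (\<exists>h. g = mset_set A + h \<and> set_mset h \<subseteq> A \<and> card A + size h = j)"
proof
  assume g: "set_mset g = A \<and> size g = j"
  then have "mset_set A \<subseteq># g" by (intro mset_set_subseteq_mset) simp
  then obtain h where "g = mset_set A + h" by (metis subset_mset.le_iff_add)
  then show "\<exists>h. g = mset_set A + h \<and> set_mset h \<subseteq> A \<and> card A + size h = j"
    using g by (intro exI [of _ h]) auto
qed (use assms in auto)

text \<open>One copy of each element of \<open>A\<close> is forced and the rest is free. For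
  \<open>j < card A\<close> the convention for negative arguments gives 0.\<close>

lemma card_multisets_with_support:
  assumes "finite A" "A \<noteq> {}"
  shows "card {g. set_mset g = A \<and> size g = j} = multichoose (card A) (int j - int (card A))"
proof (cases "card A \<le> j")
  case True
  have "{g. set_mset g = A \<and> size g = j} = (\<lambda>h. mset_set A + h) ` multisets_of_size A (j - card A)"
    unfolding set_mset_eq_iff_mset_set_subseteq [OF assms(1)] multisets_of_size_def using True by auto
  then have "card {g. set_mset g = A \<and> size g = j} = card (multisets_of_size A (j - card A))"
    by (simp add: card_image inj_on_def)
  also have "\<dots> = multichoose (card A) (int j - int (card A))"
    using True assms by (simp add: card_multisets_of_size multichoose_def nat_diff_distrib' flip: of_nat_diff)
  finally show ?thesis .
next
  case False
  then have "{g. set_mset g = A \<and> size g = j} = {}"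
    unfolding set_mset_eq_iff_mset_set_subseteq [OF assms(1)] by auto
  then show ?thesis using False by (simp only: card.empty multichoose_def) simp
qed

context cycle_with_trees begin

definition generator :: "nat \<Rightarrow> 'v set multiset \<Rightarrow> 'v \<Rightarrow> nat" where
  "generator a g v = cycle_part a v + inc g v"

definition gen_index :: "nat \<Rightarrow> (nat \<times> 'v set multiset) set" where
  "gen_index s = {(a, g). set_mset g \<subseteq> E \<and> size g + a * (n + 1) = s}"

definition covered :: "'v set multiset \<Rightarrow> bool" where
  "covered g \<longleftrightarrow> (\<exists>L\<subseteq>set_mset g. short_cover L)"

lemma decomposable_iff: "decomposable E m s \<longleftrightarrow> (\<exists>(a, g)\<in>gen_index s. \<forall>v. generator a g v \<le> m v)"
  unfolding decomposable_def gen_index_def generator_def by auto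

lemma cycle_part_add: "cycle_part (a + b) v = cycle_part a v + cycle_part b v"
  by (simp add: cycle_part_def)

lemma sum_cycle_part: "(\<Sum>v\<in>UNIV. cycle_part a v) = a * N"
proof -
  have "(\<Sum>v\<in>UNIV. cycle_part a v) = (\<Sum>v\<in>range x. a)"
    by (rule sum.mono_neutral_cong_right) (auto simp: cycle_part_def depth_eq_0_iff)
  then show ?thesis by (simp add: card_cycle)
qed

text \<open>A factor \<open>u\<close> of degree \<open>2 * n + 1\<close> stands for
  \<open>n + 1\<close> edges of total degree \<open>2 * n + 2\<close>, so each factor lowers the
  degree by one.\<close>

lemma sum_generator:
  assumes "(a, g) \<in> gen_index s"
  shows "(\<Sum>v\<in>UNIV. generator a g v) + a = 2 * s"
proof -
  have "(\<Sum>v\<in>UNIV. inc g v) = 2 * size g"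
    using assms card_edge by (intro sum_inc) (auto simp: gen_index_def)
  then show ?thesis
    using assms unfolding generator_def sum.distrib sum_cycle_part gen_index_def
    by (auto simp: N_def algebra_simps)
qed

text \<open>The degree determines \<open>a\<close>, and the incidence numbers determine
  \<open>g\<close>.\<close>

lemma generator_inject:
  assumes "(a, g) \<in> gen_index s" "(b, h) \<in> gen_index s" "generator a g = generator b h"
  shows "a = b \<and> g = h"
proof -
  have "a = b" using sum_generator [OF assms(1)] sum_generator [OF assms(2)] assms(3) by simp
  moreover have "inc g v = inc h v" for v
    using fun_cong [OF assms(3), of v] \<open>a = b\<close> by (simp add: generator_def)
  then have "g = h" using assms by (intro inc_inject) (auto simp: gen_index_def)
  ultimately show ?thesis ..
qed

text \<open>The product of the edges of a short cover is the product of the cycle vertices times one more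
  variable, so a covered product of edges can be traded for one more factor of the cycle.\<close>

lemma generator_reducible:
  assumes "(a, g) \<in> gen_index s" "covered g"
  obtains h where "(Suc a, h) \<in> gen_index s" "\<And>v. generator (Suc a) h v \<le> generator a g v"
    "generator (Suc a) h \<noteq> generator a g"
proof -
  obtain L where L: "L \<subseteq> set_mset g" "short_cover L" using assms(2) covered_def by blast
  have "mset_set L \<subseteq># g" using L(1) by (rule mset_set_subseteq_mset)
  then obtain h where h: "g = mset_set L + h" by (metis subset_mset.le_iff_add)
  have "size g = (n + 1) + size h" using L(2) by (simp add: h short_cover_def)
  then have mem: "(Suc a, h) \<in> gen_index s" using assms(1) by (auto simp: gen_index_def h)
  have "cycle_part 1 v \<le> inc (mset_set L) v" for v
  proof (cases "depth v = 0")
    case True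
    then have "v \<in> \<Union>L" using L(2) by (auto simp: short_cover_def depth_eq_0_iff)
    then have "0 < inc (mset_set L) v" unfolding inc_pos_iff by auto
    then show ?thesis by (simp add: cycle_part_def)
  qed (simp add: cycle_part_def)
  then have "generator (Suc a) h v \<le> generator a g v" for v
    using cycle_part_add [of 1 a v] by (simp add: generator_def h)
  moreover have "generator (Suc a) h \<noteq> generator a g"
    using generator_inject [OF mem assms(1)] by auto
  ultimately show ?thesis using that mem by blast
qed

text \<open>Some generator with index \<open>(b, h)\<close> divides \<open>m\<close>. The degrees
  show that \<open>b - a\<close> is the degree of the quotient \<open>w\<close>, so a nontrivial
  quotient would write \<open>g\<close> as \<open>h\<close> times \<open>w\<close> times that many
  copies of \<open>u\<close> and force a cover in \<open>g\<close>.\<close>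

lemma generator_minimal:
  assumes ag: "(a, g) \<in> gen_index s" "\<not> covered g"
    and m: "decomposable E m s" "\<And>v. m v \<le> generator a g v"
  shows "m = generator a g"
proof -
  obtain b h where bh: "(b, h) \<in> gen_index s" "\<And>v. generator b h v \<le> m v"
    using m(1) unfolding decomposable_iff by auto
  define w where "w v = generator a g v - generator b h v" for v
  have le: "generator b h v \<le> generator a g v" for v using bh(2) m(2) order_trans by blast
  then have eq: "generator a g v = generator b h v + w v" for v by (simp add: w_def)
  have "a + (\<Sum>v\<in>UNIV. w v) = b"
    using sum_generator [OF ag(1)] sum_generator [OF bh(1)] by (simp add: eq sum.distrib)
  then have b: "b = a + (\<Sum>v\<in>UNIV. w v)" by simp
  have "(\<Sum>v\<in>UNIV. w v) = 0"
  proof (rule ccontr)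
    assume "(\<Sum>v\<in>UNIV. w v) \<noteq> 0"
    then have "0 < (\<Sum>v\<in>UNIV. w v)" by (simp only: neq0_conv)
    moreover have "inc g v = cycle_part (\<Sum>v\<in>UNIV. w v) v + inc h v + w v" for v
      using eq [of v] unfolding generator_def b cycle_part_add by simp
    moreover have "set_mset g \<subseteq> E" "set_mset h \<subseteq> E" using ag(1) bh(1) by (auto simp: gen_index_def)
    ultimately obtain L where "L \<subseteq> set_mset g" "short_cover L"
      using short_cover_if_excess [of g h "\<Sum>v\<in>UNIV. w v" w] by metis
    then show False using ag(2) covered_def by blast
  qed
  then have "generator a g v = generator b h v" for v using eq [of v] by simp
  then show ?thesis using bh(2) m(2) by (intro ext) (metis antisym)
qed

section \<open>Counting products of edges by their support\<close>

definition covering_sets :: "'v set set set" where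
  "covering_sets = {A. A \<subseteq> E \<and> (\<exists>L\<subseteq>A. short_cover L)}"

lemma card_covering_set:
  assumes "A \<in> covering_sets"
  shows "n + 1 \<le> card A" "card A \<le> card E" "A \<noteq> {}"
proof -
  obtain L where L: "A \<subseteq> E" "L \<subseteq> A" "card L = n + 1"
    using assms by (auto simp: covering_sets_def short_cover_def)
  then show "n + 1 \<le> card A" using card_mono [of A L] by simp
  then show "A \<noteq> {}" by auto
  show "card A \<le> card E" using L by (intro card_mono) auto
qed

text \<open>Being covered depends only on the support, so the covered multisets split into disjoint
  classes indexed by \<open>covering_sets\<close>.\<close>

lemma card_uncovered:
  "int (card {g. set_mset g \<subseteq> E \<and> size g = j \<and> \<not> covered g}) =
     int (multichoose (card E) (int j)) -
     (\<Sum>A\<in>covering_sets. int (multichoose (card A) (int j - int (card A))))"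
proof -
  let ?all = "{g. set_mset g \<subseteq> E \<and> size g = j}"
  have all: "?all = multisets_of_size E j" by (simp add: multisets_of_size_def)
  have "finite (multisets_of_size E j)" by (rule finite_multisets_of_size) simp
  then have fin: "finite ?all" by (simp add: all)
  have "card ?all = multichoose (card E) (int j)"
    using C_sub_E by (auto simp: all card_multisets_of_size multichoose_def)
  moreover have "card {g \<in> ?all. covered g} = (\<Sum>A\<in>covering_sets. card {g. set_mset g = A \<and> size g = j})"
  proof -
    have "{g \<in> ?all. covered g} = (\<Union>A\<in>covering_sets. {g. set_mset g = A \<and> size g = j})"
      by (auto simp: covering_sets_def covered_def)
    moreover have "finite {g. set_mset g = A \<and> size g = j}" if "A \<in> covering_sets" for A
      by (rule finite_subset [OF _ fin]) (use that in \<open>auto simp: covering_sets_def\<close>)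
    ultimately show ?thesis
      by (simp only:) (rule card_UN_disjoint, auto)
  qed
  moreover have "card {g. set_mset g = A \<and> size g = j} = multichoose (card A) (int j - int (card A))"
    if "A \<in> covering_sets" for A
    by (rule card_multisets_with_support) (use card_covering_set [OF that] in auto)
  moreover have "card ?all = card {g \<in> ?all. covered g} + card {g \<in> ?all. \<not> covered g}"
    using fin by (subst card_Un_disjoint [symmetric])
      (auto intro!: arg_cong [of _ _ card] elim: rev_finite_subset)
  moreover have "{g \<in> ?all. \<not> covered g} = {g. set_mset g \<subseteq> E \<and> size g = j \<and> \<not> covered g}" by auto
  ultimately have "multichoose (card E) (int j) = card {g. set_mset g \<subseteq> E \<and> size g = j \<and> \<not> covered g} +
      (\<Sum>A\<in>covering_sets. multichoose (card A) (int j - int (card A)))"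
    by simp
  then show ?thesis by (simp only: of_nat_add of_nat_sum)
qed

lemma depth_one:
  assumes "depth v > 0"
  obtains p where "depth p = 1"
  using assms
proof (induction "depth v" arbitrary: v)
  case (Suc k)
  then show ?case using depth_par [of v] by (cases k) (metis One_nat_def, metis old.nat.inject zero_less_Suc)
qed simp

text \<open>No edge cover has fewer than \<open>n + 1\<close> edges, so the point is that each type
  that occurs attains this bound.\<close>

lemma min_cover_iff:
  assumes xs: "cycle_edges xs = C" "set xs = range x"
  shows "type_I_min_cover E xs L \<or> type_II_min_cover E xs L \<longleftrightarrow> short_cover L"
proof
  assume L: "short_cover L"
  have cov: "edge_cover E xs L"
    using L unfolding edge_cover_def short_cover_def xs by (meson UnionE subsetD)
  have min: "\<not> card K < card L" if "edge_cover E xs K" for K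
  proof -
    have "K \<subseteq> E" "range x \<subseteq> \<Union>K" using that unfolding edge_cover_def xs by auto
    then show ?thesis using card_cover_ge L by (auto simp: short_cover_def not_less)
  qed
  show "type_I_min_cover E xs L \<or> type_II_min_cover E xs L"
  proof (cases "L \<subseteq> C")
    case True
    then show ?thesis using cov min
      unfolding type_I_min_cover_def is_arg_min_def type_I_cover_def xs by simp
  next
    case False
    then have "L \<inter> (E - C) \<noteq> {}" using L unfolding short_cover_def by auto
    then show ?thesis using cov min
      unfolding type_II_min_cover_def is_arg_min_def type_II_cover_def xs by simp
  qed
next
  assume *: "type_I_min_cover E xs L \<or> type_II_min_cover E xs L"
  then have "edge_cover E xs L"
    unfolding type_I_min_cover_def type_II_min_cover_def is_arg_min_def type_I_cover_def
      type_II_cover_def by metis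
  then have L: "L \<subseteq> E" "range x \<subseteq> \<Union>L"
    unfolding edge_cover_def xs by auto
  have am: "almost_matching j \<subseteq> C" for j unfolding almost_matching_def by auto
  from * have "card L \<le> n + 1"
  proof
    assume L: "type_I_min_cover E xs L"
    \<comment> \<open>The edge \<open>ce 0\<close> covers \<open>x 1\<close>, the one vertex that
      \<open>almost_matching 0\<close> misses.\<close>
    let ?K = "insert (ce 0) (almost_matching 0)"
    have K: "range x \<subseteq> \<Union>?K" "card ?K \<le> n + 1"
      by (rule insert_almost_matching; simp add: ce_def)+
    have "?K \<subseteq> C" using am by auto
    then have "type_I_cover E xs ?K"
      unfolding type_I_cover_def edge_cover_def xs using K(1) C_sub_E by (meson UnionE order_trans subsetD)
    then show ?thesis using L K(2) unfolding type_I_min_cover_def is_arg_min_def by fastforce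
  next
    assume L: "type_II_min_cover E xs L"
    then have "L \<inter> (E - C) \<noteq> {}"
      unfolding type_II_min_cover_def type_II_cover_def is_arg_min_def xs by simp
    then obtain e where "e \<in> E" "e \<notin> C" by blast
    then obtain v where "depth v > 0" by (cases e rule: E_cases) auto
    \<comment> \<open>A tree edge touching the cycle covers one cycle vertex and the others have a
      perfect matching, so its use costs no additional edge.\<close>
    then obtain p where p: "depth p = 1" by (rule depth_one)
    then have "depth (par p) = 0" using depth_par [of p] by simp
    then obtain j where j: "par p = x (Suc j)" by (rule x_obtain_Suc)
    let ?K = "insert {p, par p} (almost_matching j)"
    have K: "range x \<subseteq> \<Union>?K" "card ?K \<le> n + 1"
      by (rule insert_almost_matching; simp add: j)+
    have "p \<notin> ce i" for i using p by (auto simp: ce_def)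
    then have "{p, par p} \<in> E - C" using p tree_edge_in_E [of p] by auto
    moreover have "?K \<subseteq> E" using am [of j] C_sub_E calculation by auto
    moreover have "\<forall>v\<in>range x. \<exists>e\<in>?K. v \<in> e" using K(1) by (meson UnionE subsetD)
    ultimately have "type_II_cover E xs ?K"
      unfolding type_II_cover_def edge_cover_def xs by simp
    then show ?thesis using L K(2) unfolding type_II_min_cover_def is_arg_min_def by fastforce
  qed
  then show "short_cover L" unfolding short_cover_def using L card_cover_ge [OF L] by simp
qed

theorem card_uncovered_eq_G_number:
  assumes xs: "cycle_edges xs = C" "set xs = range x" and l: "l = card (E - C)"
  shows "int (card {g. set_mset g \<subseteq> E \<and> size g = j \<and> \<not> covered g}) = G_number E xs n l j"
proof -
  have cC: "card C = N"
  proof -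
    have "C = ce ` {..<N}"
    proof -
      have "ce i \<in> ce ` {..<N}" for i
        by (rule image_eqI [of _ _ "i mod N"]) (use N_ge in \<open>auto intro!: ce_eqI\<close>)
      then show ?thesis by auto
    qed
    moreover have "inj_on ce {..<N}" by (rule inj_onI) (simp add: ce_eq_iff)
    ultimately show ?thesis by (simp add: card_image)
  qed
  have cE: "card E = 2 * n + 1 + l"
    using card_Diff_subset [of C E] card_mono [of E C] C_sub_E unfolding l cC by (simp add: N_def)
  have cc: "cover_count E xs k = card {A \<in> covering_sets. card A = k}" for k
    unfolding cover_count_def min_cover_iff [OF xs] covering_sets_def
    by (rule arg_cong [of _ _ card]) auto
  have "(\<Sum>A\<in>covering_sets. int (multichoose (card A) (int j - int (card A)))) =
      (\<Sum>k\<in>{n + 1..n + 1 + (n + l)}. \<Sum>A\<in>{A \<in> covering_sets. card A = k}.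
        int (multichoose (card A) (int j - int (card A))))"
  \<comment> \<open>Covering sets have between \<open>n + 1\<close> and \<open>2 * n + 1 + l\<close>
    edges, so the range of cardinalities is complete.\<close>
  proof (rule sum.group [symmetric])
    have "card A \<in> {n + 1..n + 1 + (n + l)}" if "A \<in> covering_sets" for A
      using card_covering_set(1,2) [OF that] cE by simp
    then show "card ` covering_sets \<subseteq> {n + 1..n + 1 + (n + l)}" by (rule image_subsetI)
  qed simp_all
  also have "\<dots> = (\<Sum>k\<in>{n + 1..n + 1 + (n + l)}. int (cover_count E xs k) * int (multichoose k (int j - int k)))"
    by (intro sum.cong refl) (simp add: cc)
  also have "\<dots> = (\<Sum>i = 0..n + l. int (cover_count E xs (n + 1 + i)) *
              int (multichoose (n + 1 + i) (int j - int (n + 1) - int i)))"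
    by (rule sum.reindex_bij_witness [of _ "\<lambda>i. n + 1 + i" "\<lambda>k. k - (n + 1)"])
      (auto simp: algebra_simps)
  finally have sum: "(\<Sum>A\<in>covering_sets. int (multichoose (card A) (int j - int (card A)))) =
      (\<Sum>i = 0..n + l. int (cover_count E xs (n + 1 + i)) *
              int (multichoose (n + 1 + i) (int j - int (n + 1) - int i)))" .
  show ?thesis
  proof (cases "j \<le> n")
    case True
    \<comment> \<open>Here every correction term has a negative argument and vanishes, in accordance
      with the separate clause of \<open>G_number\<close>.\<close>
    have "(\<Sum>A\<in>covering_sets. int (multichoose (card A) (int j - int (card A)))) = 0"
    proof (rule sum.neutral, rule ballI)
      fix A assume "A \<in> covering_sets"
      then have "int j - int (card A) < 0" using card_covering_set(1) [of A] True by linarith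
      then show "int (multichoose (card A) (int j - int (card A))) = 0" by (simp add: multichoose_def)
    qed
    then show ?thesis unfolding card_uncovered G_number_def cE using True by simp
  next
    case False
    then show ?thesis unfolding card_uncovered sum G_number_def cE by simp
  qed
qed

end

section \<open>Unicyclic graphs\<close>

text \<open>A walk that returns to one of its vertices is cut off there.\<close>

lemma rtrancl_distinct_path:
  assumes "(a, b) \<in> r\<^sup>*"
  shows "\<exists>ys. ys \<noteq> [] \<and> hd ys = a \<and> last ys = b \<and> distinct ys \<and> successively (\<lambda>u v. (u, v) \<in> r) ys"
  using assms
proof (induction rule: rtrancl_induct)
  case base
  show ?case by (rule exI [of _ "[a]"]) simp
next
  case (step y z)
  then obtain ys where ys: "ys \<noteq> []" "hd ys = a" "last ys = y" "distinct ys"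
    "successively (\<lambda>u v. (u, v) \<in> r) ys" by blast
  show ?case
  proof (cases "z \<in> set ys")
    case True
    then obtain us vs where split: "ys = us @ z # vs" by (metis split_list)
    show ?thesis
      by (rule exI [of _ "us @ [z]"])
        (use ys split in \<open>auto simp: successively_append_iff hd_append\<close>)
  next
    case False
    then show ?thesis
      by (intro exI [of _ "ys @ [z]"]) (use ys step.hyps(2) in \<open>auto simp: successively_append_iff\<close>)
  qed
qed

text \<open>The deleted edge closes a path between its ends to a cycle; the path has at least three
  vertices because it avoids that edge.\<close>

lemma edge_in_cycle_if_connected:
  fixes E :: "'v::finite set set"
  assumes E: "simple_graph E" and f: "{a, b} \<in> E"
    and conn: "(a, b) \<in> {(u, v). {u, v} \<in> E - {{a, b}}}\<^sup>*"
  obtains ys where "is_cycle E ys" "{a, b} \<in> cycle_edges ys"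
proof -
  obtain ys where ys: "ys \<noteq> []" "hd ys = a" "last ys = b" "distinct ys"
    and succ: "successively (\<lambda>u v. (u, v) \<in> {(u, v). {u, v} \<in> E - {{a, b}}}) ys"
    using rtrancl_distinct_path [OF conn] by blast
  have step: "{ys ! i, ys ! Suc i} \<in> E - {{a, b}}" if "Suc i < length ys" for i
    using succ that by (simp add: successively_conv_nth)
  have ab: "ys ! 0 = a" "ys ! (length ys - 1) = b"
    using ys(1-3) by (simp_all add: hd_conv_nth last_conv_nth)
  have "a \<noteq> b" using E f unfolding simple_graph_def by fastforce
  then have "length ys \<noteq> 1" using ab by auto
  moreover have "length ys \<noteq> 2" using step [of 0] ab by (auto simp: numeral_2_eq_2)
  moreover have "length ys \<noteq> 0" using ys(1) by simp
  ultimately have len: "3 \<le> length ys" by linarith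
  have "{a, b} \<in> cycle_edges ys"
    unfolding cycle_edges_def
  proof (rule CollectI, rule exI [of _ "length ys - 1"])
    have "Suc (length ys - 1) = length ys" using len by simp
    then show "{a, b} = {ys ! (length ys - 1), ys ! (Suc (length ys - 1) mod length ys)} \<and>
        length ys - 1 < length ys"
      using len ab by (simp add: insert_commute)
  qed
  moreover have "cycle_edges ys \<subseteq> E"
  proof
    fix e assume "e \<in> cycle_edges ys"
    then obtain i where i: "i < length ys" "e = {ys ! i, ys ! (Suc i mod length ys)}"
      by (auto simp: cycle_edges_def)
    show "e \<in> E"
    proof (cases "Suc i < length ys")
      case True
      then show ?thesis using step [OF True] i by simp
    next
      case False
      then have "i = length ys - 1" "Suc i = length ys" using i(1) by auto
      then show ?thesis using i ab f by (simp add: insert_commute)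
    qed
  qed
  ultimately show ?thesis using that [of ys] ys(4) len by (simp add: is_cycle_def)
qed

text \<open>Parents are neighbours one step closer to the cycle. An edge that is neither on the
  cycle nor a parent edge could be deleted without disconnecting the graph, so it would lie on a
  second cycle.\<close>

lemma unicyclic_cycle_with_trees:
  fixes E :: "'v::finite set set"
  assumes uni: "unicyclic E" and cyc: "is_cycle E xs" and len: "length xs = 2 * n + 1" and n: "n \<ge> 1"
  obtains x par depth where "cycle_with_trees E n x par depth"
    "set xs = range x" "cycle_edges xs = range (\<lambda>i. {x i, x (Suc i)})"
proof -
  define x where "x i = xs ! (i mod (2 * n + 1))" for i
  define rel where "rel F = {(u, v). {u, v} \<in> F}" for F :: "'v set set"
  have simple: "simple_graph E" and conn: "\<And>u v. (u, v) \<in> (rel E)\<^sup>*"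
    using uni unfolding unicyclic_def connected_graph_def rel_def by auto
  have x_mem: "x i \<in> set xs" for i using len by (simp add: x_def)
  have range_x: "range x = set xs"
  proof
    show "set xs \<subseteq> range x"
    proof
      fix v assume "v \<in> set xs"
      then obtain i where "i < length xs" "v = xs ! i" by (auto simp: in_set_conv_nth)
      then have "v = x i" using len by (simp add: x_def)
      then show "v \<in> range x" by blast
    qed
  qed (use x_mem in auto)
  have x_eq: "x i = x j \<longleftrightarrow> i mod (2 * n + 1) = j mod (2 * n + 1)" for i j
    using cyc len nth_eq_iff_index_eq [of xs "i mod (2 * n + 1)" "j mod (2 * n + 1)"]
    by (simp add: x_def is_cycle_def)
  have C_eq: "cycle_edges xs = range (\<lambda>i. {x i, x (Suc i)})"
  proof
    show "cycle_edges xs \<subseteq> range (\<lambda>i. {x i, x (Suc i)})"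
    proof
      fix e assume "e \<in> cycle_edges xs"
      then obtain i where "i < length xs" "e = {xs ! i, xs ! (Suc i mod length xs)}"
        by (auto simp: cycle_edges_def)
      then have "e = {x i, x (Suc i)}" using len by (simp add: x_def)
      then show "e \<in> range (\<lambda>i. {x i, x (Suc i)})" by blast
    qed
    show "range (\<lambda>i. {x i, x (Suc i)}) \<subseteq> cycle_edges xs"
    proof
      fix e assume "e \<in> range (\<lambda>i. {x i, x (Suc i)})"
      then obtain i where "e = {x i, x (Suc i)}" by blast
      then have "e = {xs ! (i mod (2 * n + 1)), xs ! (Suc (i mod (2 * n + 1)) mod length xs)}"
        unfolding x_def len by (simp only: mod_Suc_eq)
      then show "e \<in> cycle_edges xs"
        unfolding cycle_edges_def using len by (auto intro!: exI [of _ "i mod (2 * n + 1)"])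
    qed
  qed
  define depth where "depth v = (LEAST k. \<exists>u\<in>set xs. (u, v) \<in> rel E ^^ k)" for v
  have ex: "\<exists>k. \<exists>u\<in>set xs. (u, v) \<in> rel E ^^ k" for v
    using conn [of "x 0" v] x_mem [of 0] by (metis rtrancl_power)
  have depth: "\<exists>u\<in>set xs. (u, v) \<in> rel E ^^ depth v" for v
    unfolding depth_def using LeastI_ex [OF ex] .
  have depth_le: "depth v \<le> k" if "u \<in> set xs" "(u, v) \<in> rel E ^^ k" for u v k
    unfolding depth_def using that by (intro Least_le) blast
  have depth_0: "depth v = 0 \<longleftrightarrow> v \<in> set xs" for v
  proof
    assume "depth v = 0"
    then show "v \<in> set xs" using depth [of v] by auto
  qed (use depth_le [of v v 0] in auto)
  have "\<exists>w. {v, w} \<in> E \<and> depth v = Suc (depth w)" if "depth v > 0" for v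
  proof -
    obtain k where k: "depth v = Suc k" using \<open>depth v > 0\<close> gr0_conv_Suc by blast
    then obtain u w where w: "u \<in> set xs" "(u, w) \<in> rel E ^^ k" "(w, v) \<in> rel E"
      using depth [of v] by auto
    \<comment> \<open>A shorter route to \<open>w\<close> would give a shorter one to
      \<open>v\<close>, so the depth of \<open>w\<close> is exactly \<open>k\<close>.\<close>
    have "depth w \<le> k" using depth_le w by blast
    moreover obtain u' where "u' \<in> set xs" "(u', w) \<in> rel E ^^ depth w" using depth by blast
    then have "depth v \<le> Suc (depth w)" using w(3) by (intro depth_le [of u']) auto
    ultimately show ?thesis using w(3) k by (intro exI [of _ w]) (auto simp: rel_def insert_commute)
  qed
  then obtain par where par: "\<And>v. depth v > 0 \<Longrightarrow> {v, par v} \<in> E \<and> depth v = Suc (depth (par v))"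
    by metis
  have "e \<in> cycle_edges xs" if e: "e \<in> E" and no_tree: "\<And>v. depth v > 0 \<Longrightarrow> e \<noteq> {v, par v}" for e
  proof (rule ccontr)
    assume e_cyc: "e \<notin> cycle_edges xs"
    obtain a b where ab: "e = {a, b}"
      using simple e unfolding simple_graph_def by (metis card_2_iff)
    have sym: "sym ((rel (E - {e}))\<^sup>*)"
      by (rule sym_rtrancl) (auto simp: sym_def rel_def insert_commute)
    have cyc_conn: "(x i, x 0) \<in> (rel (E - {e}))\<^sup>*" for i
    proof (induction i)
      case (Suc i)
      have "{x (Suc i), x i} \<in> cycle_edges xs" unfolding C_eq by (auto simp: insert_commute)
      then have "(x (Suc i), x i) \<in> rel (E - {e})"
        using e_cyc cyc by (auto simp: rel_def is_cycle_def)
      then show ?case using Suc by (rule converse_rtrancl_into_rtrancl)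
    qed simp
    have to_x: "(v, x 0) \<in> (rel (E - {e}))\<^sup>*" for v
    proof (induction "depth v" arbitrary: v)
      case 0
      then have "v \<in> range x" using depth_0 [of v] range_x by simp
      then show ?case using cyc_conn by blast
    next
      case (Suc k)
      then have pos: "depth v > 0" by simp
      then have "(v, par v) \<in> rel (E - {e})" using par no_tree [OF pos] by (auto simp: rel_def)
      moreover have "k = depth (par v)" using par [OF pos] Suc.hyps(2) by simp
      ultimately show ?case using Suc.hyps(1) by (metis converse_rtrancl_into_rtrancl)
    qed
    have "(a, b) \<in> (rel (E - {e}))\<^sup>*"
      using to_x [of a] symD [OF sym to_x [of b]] by (rule rtrancl_trans)
    then obtain ys where ys: "is_cycle E ys" "e \<in> cycle_edges ys"
      using edge_in_cycle_if_connected [OF simple, of a b] e unfolding ab rel_def by blast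
    moreover have "cycle_edges ys = cycle_edges xs"
      using uni ys(1) cyc unfolding unicyclic_def by blast
    ultimately show False using e_cyc by simp
  qed
  then have E_eq: "E = range (\<lambda>i. {x i, x (Suc i)}) \<union> {{v, par v} |v. depth v > 0}"
    unfolding C_eq [symmetric] using par cyc unfolding is_cycle_def by blast
  have "cycle_with_trees E n x par depth"
  proof
    show "n \<ge> 1" by fact
    show "x i = x j \<longleftrightarrow> i mod (2 * n + 1) = j mod (2 * n + 1)" for i j by (rule x_eq)
    show "depth v = 0 \<longleftrightarrow> v \<in> range x" for v using depth_0 range_x by simp
    show "depth v > 0 \<Longrightarrow> depth v = Suc (depth (par v))" for v using par by blast
  qed (rule E_eq)
  then show ?thesis using that range_x C_eq by blast
qed

section \<open>Commutative rings as types\<close>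

text \<open>With the whole type as carrier, the operations of the record reduce to type class
  arithmetic, and ideals can be handled through \<open>is_ideal\<close>.\<close>

definition univ_ring :: "'a::comm_ring_1 ring" where
  "univ_ring = \<lparr>carrier = UNIV, mult = (*), one = 1, zero = 0, add = (+)\<rparr>"

lemma univ_ring_simps [simp]:
  "carrier univ_ring = UNIV" "x \<otimes>\<^bsub>univ_ring\<^esub> y = x * y" "\<one>\<^bsub>univ_ring\<^esub> = 1"
  "\<zero>\<^bsub>univ_ring\<^esub> = 0" "x \<oplus>\<^bsub>univ_ring\<^esub> y = x + y"
  by (simp_all add: univ_ring_def)

lemma poly_ring_eq_univ_ring: "poly_ring = univ_ring"
  by (simp add: poly_ring_def univ_ring_def)

lemma cring_univ_ring: "cring (univ_ring :: 'a::comm_ring_1 ring)"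
proof (rule cringI)
  show "abelian_group (univ_ring :: 'a ring)"
    by (rule abelian_groupI) (auto simp: algebra_simps intro: exI [of _ "- x" for x])
  show "comm_monoid (univ_ring :: 'a ring)"
    by (rule comm_monoidI) (auto simp: algebra_simps)
qed (auto simp: algebra_simps)

interpretation univ: cring "univ_ring :: 'a::comm_ring_1 ring"
  by (rule cring_univ_ring)

lemma a_inv_univ_ring [simp]: "\<ominus>\<^bsub>univ_ring\<^esub> x = - x"
  by (rule univ.minus_equality) simp_all

lemma a_minus_univ_ring [simp]: "x \<ominus>\<^bsub>univ_ring\<^esub> y = x - y"
  by (simp add: a_minus_def)

definition is_ideal :: "'a::comm_ring_1 set \<Rightarrow> bool" where
  "is_ideal I \<longleftrightarrow> 0 \<in> I \<and> (\<forall>x\<in>I. \<forall>y\<in>I. x + y \<in> I) \<and> (\<forall>r. \<forall>x\<in>I. r * x \<in> I)"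

lemma is_idealD:
  assumes "is_ideal I"
  shows "0 \<in> I" "x \<in> I \<Longrightarrow> y \<in> I \<Longrightarrow> x + y \<in> I" "x \<in> I \<Longrightarrow> r * x \<in> I"
    "x \<in> I \<Longrightarrow> x * r \<in> I" "x \<in> I \<Longrightarrow> - x \<in> I" "x \<in> I \<Longrightarrow> y \<in> I \<Longrightarrow> x - y \<in> I"
proof -
  have *: "0 \<in> I" "\<And>x y. x \<in> I \<Longrightarrow> y \<in> I \<Longrightarrow> x + y \<in> I" "\<And>r x. x \<in> I \<Longrightarrow> r * x \<in> I"
    using assms by (auto simp: is_ideal_def)
  have **: "- x \<in> I" if "x \<in> I" for x using *(3) [OF that, of "-1"] by simp
  show "0 \<in> I" "x \<in> I \<Longrightarrow> y \<in> I \<Longrightarrow> x + y \<in> I" "x \<in> I \<Longrightarrow> r * x \<in> I" "x \<in> I \<Longrightarrow> - x \<in> I"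
    using * ** by blast+
  show "x \<in> I \<Longrightarrow> x * r \<in> I" using *(3) [of x r] by (simp add: mult.commute)
  show "x \<in> I \<Longrightarrow> y \<in> I \<Longrightarrow> x - y \<in> I" using *(2) [of x "- y"] ** by simp
qed

lemma is_ideal_sum: "is_ideal I \<Longrightarrow> (\<And>i. i \<in> A \<Longrightarrow> f i \<in> I) \<Longrightarrow> (\<Sum>i\<in>A. f i) \<in> I"
  by (induction A rule: infinite_finite_induct) (auto simp: is_ideal_def)

lemma ideal_univ_ring_iff: "ideal I univ_ring \<longleftrightarrow> is_ideal I"
proof
  assume "ideal I univ_ring"
  then interpret ideal I univ_ring .
  show "is_ideal I"
    unfolding is_ideal_def using zero_closed a_closed I_l_closed by auto
next
  assume I: "is_ideal I"
  show "ideal I univ_ring"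
  proof (rule idealI [OF univ.ring_axioms])
    show "subgroup I (add_monoid univ_ring)"
      by (rule univ.add.subgroupI) (use is_idealD [OF I] in \<open>auto simp flip: a_inv_def\<close>)
  qed (use is_idealD [OF I] in auto)
qed

lemma primeideal_univ_ring_iff:
  "primeideal p univ_ring \<longleftrightarrow> is_ideal p \<and> 1 \<notin> p \<and> (\<forall>a b. a * b \<in> p \<longrightarrow> a \<in> p \<or> b \<in> p)"
proof
  assume "primeideal p univ_ring"
  then interpret primeideal p univ_ring .
  have "is_ideal p" using ideal_axioms by (simp add: ideal_univ_ring_iff)
  then show "is_ideal p \<and> 1 \<notin> p \<and> (\<forall>a b. a * b \<in> p \<longrightarrow> a \<in> p \<or> b \<in> p)"
    using one_imp_carrier I_notcarr I_prime by auto
next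
  assume "is_ideal p \<and> 1 \<notin> p \<and> (\<forall>a b. a * b \<in> p \<longrightarrow> a \<in> p \<or> b \<in> p)"
  then show "primeideal p univ_ring"
    by (intro primeidealI univ.is_cring) (auto simp: ideal_univ_ring_iff)
qed

lemma genideal_univ_ring:
  assumes "is_ideal I" "S \<subseteq> I" "\<And>J. is_ideal J \<Longrightarrow> S \<subseteq> J \<Longrightarrow> I \<subseteq> J"
  shows "genideal univ_ring S = I"
  unfolding genideal_def ideal_univ_ring_iff using assms by blast

lemma ideal_prod_univ_ring:
  assumes "is_ideal I" "is_ideal J" "is_ideal K"
    and "\<And>a b. a \<in> I \<Longrightarrow> b \<in> J \<Longrightarrow> a * b \<in> K"
    and "\<And>L. is_ideal L \<Longrightarrow> (\<And>a b. a \<in> I \<Longrightarrow> b \<in> J \<Longrightarrow> a * b \<in> L) \<Longrightarrow> K \<subseteq> L"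
  shows "ideal_prod univ_ring I J = K"
proof
  show "ideal_prod univ_ring I J \<subseteq> K"
  proof
    fix c assume "c \<in> ideal_prod univ_ring I J"
    then show "c \<in> K"
      by (induction rule: ideal_prod.induct) (use assms(4) is_idealD [OF assms(3)] in auto)
  qed
  have "ideal (ideal_prod univ_ring I J) univ_ring"
    by (rule univ.ideal_prod_is_ideal) (simp_all add: ideal_univ_ring_iff assms)
  then show "K \<subseteq> ideal_prod univ_ring I J"
    using ideal_prod.prod [of _ I _ J univ_ring] by (intro assms(5)) (auto simp: ideal_univ_ring_iff)
qed

section \<open>Quotient modules of ideals\<close>

definition coset :: "'a::comm_ring_1 set \<Rightarrow> 'a \<Rightarrow> 'a set" where
  "coset K f = {k + f |k. k \<in> K}"

lemma coset_eq_iff: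
  assumes "is_ideal K"
  shows "coset K f = coset K g \<longleftrightarrow> f - g \<in> K"
proof
  assume "coset K f = coset K g"
  moreover have "f \<in> coset K f" unfolding coset_def using is_idealD(1) [OF assms] by force
  ultimately obtain k where "k \<in> K" "f = k + g" by (auto simp: coset_def)
  then show "f - g \<in> K" by simp
next
  assume *: "f - g \<in> K"
  have sub: "coset K f \<subseteq> coset K g" if "f - g \<in> K" for f g
  proof
    fix y assume "y \<in> coset K f"
    then obtain k where k: "k \<in> K" "y = k + f" by (auto simp: coset_def)
    then have "k + (f - g) \<in> K" "y = (k + (f - g)) + g" using that is_idealD(2) [OF assms] by auto
    then show "y \<in> coset K g" unfolding coset_def by blast
  qed
  have "g - f \<in> K" using is_idealD(5) [OF assms *] by simp
  then show "coset K f = coset K g" using sub * by blast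
qed

lemma coset_0: "coset K 0 = K"
  by (auto simp: coset_def)

lemma mem_coset_iff: "y \<in> coset K f \<longleftrightarrow> y - f \<in> K"
proof
  assume "y - f \<in> K"
  moreover have "y = (y - f) + f" by simp
  ultimately show "y \<in> coset K f" unfolding coset_def by blast
qed (auto simp: coset_def)

abbreviation ideal_quotient :: "'a::comm_ring_1 set \<Rightarrow> 'a set \<Rightarrow> ('a, 'a set) module" where
  "ideal_quotient J K \<equiv> quotient_module (ideal_module univ_ring J) K"

lemma carrier_ideal_quotient: "carrier (ideal_quotient J K) = coset K ` J"
  unfolding quotient_module_def ideal_module_def A_RCOSETS_def RCOSETS_def r_coset_def coset_def
  by (auto simp: image_def)

lemma zero_ideal_quotient: "\<zero>\<^bsub>ideal_quotient J K\<^esub> = K"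
  by (simp add: quotient_module_def)

lemma add_ideal_quotient:
  assumes "is_ideal K"
  shows "coset K f \<oplus>\<^bsub>ideal_quotient J K\<^esub> coset K g = coset K (f + g)"
proof -
  have "coset K f \<oplus>\<^bsub>ideal_quotient J K\<^esub> coset K g = {a + b |a b. a \<in> coset K f \<and> b \<in> coset K g}"
    unfolding quotient_module_def ideal_module_def set_add_def set_mult_def by auto
  also have "\<dots> = coset K (f + g)"
  proof (intro equalityI subsetI)
    fix y assume "y \<in> {a + b |a b. a \<in> coset K f \<and> b \<in> coset K g}"
    then obtain a b where *: "y = a + b" "a - f \<in> K" "b - g \<in> K" by (auto simp: mem_coset_iff)
    then have "(a - f) + (b - g) \<in> K" using is_idealD(2) [OF assms] by blast
    then show "y \<in> coset K (f + g)" by (simp add: mem_coset_iff * algebra_simps)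
  next
    fix y assume y: "y \<in> coset K (f + g)"
    then have "y - f \<in> coset K g" "f \<in> coset K f"
      using is_idealD(1) [OF assms] by (simp_all add: mem_coset_iff algebra_simps)
    then show "y \<in> {a + b |a b. a \<in> coset K f \<and> b \<in> coset K g}"
      by (smt (verit) add.commute diff_add_cancel mem_Collect_eq)
  qed
  finally show ?thesis .
qed

lemma smult_ideal_quotient:
  assumes "is_ideal K"
  shows "r \<odot>\<^bsub>ideal_quotient J K\<^esub> coset K f = coset K (r * f)"
proof -
  have "r \<odot>\<^bsub>ideal_quotient J K\<^esub> coset K f = (\<Union>x\<in>coset K f. coset K (r * x))"
    unfolding quotient_module_def ideal_module_def a_r_coset_def r_coset_def by (auto simp: coset_def)
  also have "\<dots> = (\<Union>x\<in>coset K f. coset K (r * f))"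
  proof (intro SUP_cong refl)
    fix x assume "x \<in> coset K f"
    then have "r * (x - f) \<in> K" using is_idealD(3) [OF assms] by (simp add: mem_coset_iff)
    then show "coset K (r * x) = coset K (r * f)" by (simp add: coset_eq_iff [OF assms] algebra_simps)
  qed
  also have "\<dots> = coset K (r * f)"
  proof -
    have "f \<in> coset K f" using is_idealD(1) [OF assms] by (simp add: mem_coset_iff)
    then show ?thesis by blast
  qed
  finally show ?thesis .
qed

lemma Ass_univ_ring:
  assumes "is_ideal I"
  shows "Ass univ_ring I = {p. primeideal p univ_ring \<and> (\<exists>f. p = {r. r * f \<in> I})}"
proof -
  have "r * f \<in> I \<longleftrightarrow> r \<odot>\<^bsub>ideal_quotient UNIV I\<^esub> coset I f = \<zero>\<^bsub>ideal_quotient UNIV I\<^esub>" for r f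
    unfolding smult_ideal_quotient [OF assms] zero_ideal_quotient
    using coset_eq_iff [OF assms, of "r * f" 0] by (simp add: coset_0)
  then show ?thesis
    unfolding Ass_def Ass_module_def by (simp add: carrier_ideal_quotient)
qed

text \<open>Scaling by \<open>-1\<close> produces additive inverses, which supplies the subgroup
  condition.\<close>

lemma submodule_ideal_quotient_iff:
  assumes "is_ideal J" "is_ideal K"
  shows "submodule H univ_ring (ideal_quotient J K) \<longleftrightarrow>
    H \<subseteq> coset K ` J \<and> K \<in> H \<and> (\<forall>X\<in>H. \<forall>Y\<in>H. X \<oplus>\<^bsub>ideal_quotient J K\<^esub> Y \<in> H) \<and>
    (\<forall>r. \<forall>X\<in>H. r \<odot>\<^bsub>ideal_quotient J K\<^esub> X \<in> H)"
    (is "?L \<longleftrightarrow> ?R")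
proof
  assume ?L
  then interpret submodule H univ_ring "ideal_quotient J K" .
  show ?R
    using subset m_closed one_closed smult_closed
    by (auto simp: carrier_ideal_quotient zero_ideal_quotient)
next
  assume R: ?R
  have inv: "inv\<^bsub>add_monoid (ideal_quotient J K)\<^esub> (coset K f) = coset K (- f)" if f: "f \<in> J" for f
    unfolding m_inv_def
  proof (rule the_equality)
    have "- f \<in> J" using is_idealD(5) [OF assms(1)] f by blast
    then show "coset K (- f) \<in> carrier (add_monoid (ideal_quotient J K)) \<and>
        coset K f \<otimes>\<^bsub>add_monoid (ideal_quotient J K)\<^esub> coset K (- f) = \<one>\<^bsub>add_monoid (ideal_quotient J K)\<^esub> \<and>
        coset K (- f) \<otimes>\<^bsub>add_monoid (ideal_quotient J K)\<^esub> coset K f = \<one>\<^bsub>add_monoid (ideal_quotient J K)\<^esub>"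
      by (simp add: carrier_ideal_quotient zero_ideal_quotient add_ideal_quotient assms coset_0)
  next
    fix Y assume "Y \<in> carrier (add_monoid (ideal_quotient J K)) \<and>
        coset K f \<otimes>\<^bsub>add_monoid (ideal_quotient J K)\<^esub> Y = \<one>\<^bsub>add_monoid (ideal_quotient J K)\<^esub> \<and>
        Y \<otimes>\<^bsub>add_monoid (ideal_quotient J K)\<^esub> coset K f = \<one>\<^bsub>add_monoid (ideal_quotient J K)\<^esub>"
    then obtain g where g: "Y = coset K g" "coset K (f + g) = coset K 0"
      by (auto simp: carrier_ideal_quotient zero_ideal_quotient add_ideal_quotient assms coset_0)
    then show "Y = coset K (- f)" by (simp add: coset_eq_iff assms add.commute)
  qed
  show ?L
  proof (intro submodule.intro subgroup.intro submodule_axioms.intro)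
    fix X assume X: "X \<in> H"
    then obtain f where f: "f \<in> J" "X = coset K f" using R by blast
    have "(-1) \<odot>\<^bsub>ideal_quotient J K\<^esub> X \<in> H" using R X by blast
    then show "inv\<^bsub>add_monoid (ideal_quotient J K)\<^esub> X \<in> H"
      using inv f by (simp add: smult_ideal_quotient assms)
  qed (use R in \<open>auto simp: carrier_ideal_quotient zero_ideal_quotient\<close>)
qed

section \<open>Localization at a prime\<close>

locale prime_of_ring =
  fixes p :: "'a::comm_ring_1 set"
  assumes prime: "primeideal p univ_ring"
begin

abbreviation fr :: "'a \<Rightarrow> 'a \<Rightarrow> ('a \<times> 'a) set" where "fr \<equiv> loc_frac univ_ring p"
abbreviation L :: "('a \<times> 'a) set ring" where "L \<equiv> localization univ_ring p"

lemma one_notin: "1 \<notin> p"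
  and mult_notin: "a \<notin> p \<Longrightarrow> b \<notin> p \<Longrightarrow> a * b \<notin> p"
  using prime by (auto simp: primeideal_univ_ring_iff)

lemma mem_fr_iff: "(b, u) \<in> fr a t \<longleftrightarrow> u \<notin> p \<and> (\<exists>v. v \<notin> p \<and> v * (a * u - b * t) = 0)"
  by (auto simp: loc_frac_def)

lemma fr_eq_iff:
  assumes "t \<notin> p" "u \<notin> p"
  shows "fr a t = fr b u \<longleftrightarrow> (\<exists>v. v \<notin> p \<and> v * (a * u - b * t) = 0)"
proof
  assume "fr a t = fr b u"
  moreover have "(b, u) \<in> fr b u"
    unfolding mem_fr_iff using assms one_notin by auto
  ultimately have "(b, u) \<in> fr a t" by simp
  then show "\<exists>v. v \<notin> p \<and> v * (a * u - b * t) = 0" by (simp add: mem_fr_iff)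
next
  assume *: "\<exists>v. v \<notin> p \<and> v * (a * u - b * t) = 0"
  have sub: "fr a t \<subseteq> fr b u"
    if t: "t \<notin> p" "u \<notin> p" and v: "v \<notin> p" "v * (a * u - b * t) = 0" for a b t u v
  proof (rule subrelI)
    fix c w assume "(c, w) \<in> fr a t"
    then obtain v' where w: "w \<notin> p" "v' \<notin> p" "v' * (a * w - c * t) = 0" by (auto simp: mem_fr_iff)
    \<comment> \<open>Transitivity for fractions: clearing the middle denominator costs the factor
      \<open>t\<close>, which is also outside \<open>p\<close>.\<close>
    have "v * v' * t * (b * w - c * u) =
        v * u * (v' * (a * w - c * t)) - v' * w * (v * (a * u - b * t))"
      by (simp add: algebra_simps)
    also have "\<dots> = 0" unfolding v w by simp
    finally have "v * v' * t * (b * w - c * u) = 0" .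
    moreover have "v * v' * t \<notin> p" using v w t mult_notin by blast
    ultimately show "(c, w) \<in> fr b u" unfolding mem_fr_iff using w by blast
  qed
  from * obtain v where v: "v \<notin> p" "v * (a * u - b * t) = 0" by blast
  moreover have "v * (b * t - a * u) = - (v * (a * u - b * t))" by (simp add: algebra_simps)
  then have "v * (b * t - a * u) = 0" using v by simp
  ultimately show "fr a t = fr b u" using sub assms by blast
qed

lemma fr_eqI: "t \<notin> p \<Longrightarrow> u \<notin> p \<Longrightarrow> a * u = b * t \<Longrightarrow> fr a t = fr b u"
  by (subst fr_eq_iff) (use one_notin in auto)

lemma fr_0: "t \<notin> p \<Longrightarrow> fr 0 t = fr 0 1"
  by (rule fr_eqI) (use one_notin in auto)

lemma fr_cancel: "t \<notin> p \<Longrightarrow> w \<notin> p \<Longrightarrow> fr (a * w) (t * w) = fr a t"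
  by (rule fr_eqI) (use mult_notin in \<open>auto simp: algebra_simps\<close>)

lemma self_mem_fr: "t \<notin> p \<Longrightarrow> (a, t) \<in> fr a t"
  unfolding mem_fr_iff using one_notin by auto

lemma carrier_L: "carrier L = {fr a t |a t. t \<notin> p}"
  by (simp add: localization_def)

lemma fr_in_L [simp]: "t \<notin> p \<Longrightarrow> fr a t \<in> carrier L"
  unfolding carrier_L by blast

lemma L_cases:
  assumes "X \<in> carrier L"
  obtains a t where "t \<notin> p" "X = fr a t"
  using assms unfolding carrier_L by blast

lemma one_L: "\<one>\<^bsub>L\<^esub> = fr 1 1" and zero_L: "\<zero>\<^bsub>L\<^esub> = fr 0 1"
  by (simp_all add: localization_def)

lemma mult_L:
  assumes "t \<notin> p" "u \<notin> p"
  shows "fr a t \<otimes>\<^bsub>L\<^esub> fr b u = fr (a * b) (t * u)"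
proof -
  have "fr (a' * b') (t' * u') = fr (a * b) (t * u)"
    if "(a', t') \<in> fr a t" "(b', u') \<in> fr b u" for a' t' b' u'
  proof -
    obtain v w where v: "v \<notin> p" "v * (a * t' - a' * t) = 0" "t' \<notin> p"
      and w: "w \<notin> p" "w * (b * u' - b' * u) = 0" "u' \<notin> p"
      using \<open>(a', t') \<in> fr a t\<close> \<open>(b', u') \<in> fr b u\<close> unfolding mem_fr_iff by blast
    have "v * w * (a' * b' * (t * u) - a * b * (t' * u')) =
      - (w * b * u' * (v * (a * t' - a' * t)) + v * a' * t * (w * (b * u' - b' * u)))"
      by (simp add: algebra_simps)
    also have "\<dots> = 0" unfolding v w by simp
    finally show ?thesis
      using v w assms mult_notin by (subst fr_eq_iff) blast+
  qed
  then have *: "fr (fst X * fst Y) (snd X * snd Y) = fr (a * b) (t * u)"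
    if "X \<in> fr a t" "Y \<in> fr b u" for X Y
    using that by (metis prod.collapse)
  \<comment> \<open>The product is a union over all pairs of representatives, that is, over a
    nonempty family of equal sets.\<close>
  have "fr a t \<noteq> {}" "fr b u \<noteq> {}"
    using self_mem_fr [OF assms(1), of a] self_mem_fr [OF assms(2), of b] by blast+
  then show ?thesis
    unfolding localization_def by (simp add: split_beta * cong: SUP_cong_simp)
qed

lemma add_L:
  assumes "t \<notin> p" "u \<notin> p"
  shows "fr a t \<oplus>\<^bsub>L\<^esub> fr b u = fr (a * u + b * t) (t * u)"
proof -
  have "fr (a' * u' + b' * t') (t' * u') = fr (a * u + b * t) (t * u)"
    if "(a', t') \<in> fr a t" "(b', u') \<in> fr b u" for a' t' b' u'
  proof -
    obtain v w where v: "v \<notin> p" "v * (a * t' - a' * t) = 0" "t' \<notin> p"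
      and w: "w \<notin> p" "w * (b * u' - b' * u) = 0" "u' \<notin> p"
      using \<open>(a', t') \<in> fr a t\<close> \<open>(b', u') \<in> fr b u\<close> unfolding mem_fr_iff by blast
    have "v * w * ((a' * u' + b' * t') * (t * u) - (a * u + b * t) * (t' * u')) =
      - (w * u * u' * (v * (a * t' - a' * t)) + v * t * t' * (w * (b * u' - b' * u)))"
      by (simp add: algebra_simps)
    also have "\<dots> = 0" unfolding v w by simp
    finally show ?thesis
      using v w assms mult_notin by (subst fr_eq_iff) blast+
  qed
  then have *: "fr (fst X * snd Y + fst Y * snd X) (snd X * snd Y) = fr (a * u + b * t) (t * u)"
    if "X \<in> fr a t" "Y \<in> fr b u" for X Y
    using that by (metis prod.collapse)
  have "fr a t \<noteq> {}" "fr b u \<noteq> {}"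
    using self_mem_fr [OF assms(1), of a] self_mem_fr [OF assms(2), of b] by blast+
  then show ?thesis
    unfolding localization_def by (simp add: split_beta * cong: SUP_cong_simp)
qed

lemmas L_simps = one_L zero_L mult_L add_L mult_notin one_notin

lemma cring_L: "cring L"
proof (rule cringI)
  show "abelian_group L"
  proof (rule abelian_groupI)
    fix X assume "X \<in> carrier L"
    then obtain a t where X: "t \<notin> p" "X = fr a t" by (rule L_cases)
    show "\<exists>Y\<in>carrier L. Y \<oplus>\<^bsub>L\<^esub> X = \<zero>\<^bsub>L\<^esub>"
      by (rule bexI [of _ "fr (- a) t"]) (use X fr_0 [of "t * t"] mult_notin [of t t] in \<open>simp_all add: L_simps\<close>)
    show "\<zero>\<^bsub>L\<^esub> \<oplus>\<^bsub>L\<^esub> X = X" using X by (auto simp: L_simps)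
  next
    show "\<zero>\<^bsub>L\<^esub> \<in> carrier L" by (simp add: L_simps)
  next
    fix X Y assume "X \<in> carrier L" "Y \<in> carrier L"
    then obtain a t b u where *: "t \<notin> p" "X = fr a t" "u \<notin> p" "Y = fr b u" by (elim L_cases)
    show "X \<oplus>\<^bsub>L\<^esub> Y \<in> carrier L" using * by (simp add: L_simps)
    show "X \<oplus>\<^bsub>L\<^esub> Y = Y \<oplus>\<^bsub>L\<^esub> X" using * by (auto simp: L_simps algebra_simps)
    fix Z assume "Z \<in> carrier L"
    then obtain c w where Z: "w \<notin> p" "Z = fr c w" by (rule L_cases)
    show "X \<oplus>\<^bsub>L\<^esub> Y \<oplus>\<^bsub>L\<^esub> Z = X \<oplus>\<^bsub>L\<^esub> (Y \<oplus>\<^bsub>L\<^esub> Z)"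
      using * Z by (auto simp: L_simps algebra_simps)
  qed
  show "comm_monoid L"
  proof (rule comm_monoidI)
    fix X Y assume "X \<in> carrier L" "Y \<in> carrier L"
    then obtain a t b u where *: "t \<notin> p" "X = fr a t" "u \<notin> p" "Y = fr b u" by (elim L_cases)
    show "X \<otimes>\<^bsub>L\<^esub> Y \<in> carrier L" using * by (simp add: L_simps)
    show "X \<otimes>\<^bsub>L\<^esub> Y = Y \<otimes>\<^bsub>L\<^esub> X" using * by (auto simp: L_simps algebra_simps)
    show "\<one>\<^bsub>L\<^esub> \<otimes>\<^bsub>L\<^esub> X = X" using * by (auto simp: L_simps)
    fix Z assume "Z \<in> carrier L"
    then obtain c w where Z: "w \<notin> p" "Z = fr c w" by (rule L_cases)
    show "X \<otimes>\<^bsub>L\<^esub> Y \<otimes>\<^bsub>L\<^esub> Z = X \<otimes>\<^bsub>L\<^esub> (Y \<otimes>\<^bsub>L\<^esub> Z)"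
      using * Z by (auto simp: L_simps algebra_simps)
  qed (simp add: L_simps)
  fix X Y Z assume "X \<in> carrier L" "Y \<in> carrier L" "Z \<in> carrier L"
  then obtain a t b u c w where *: "t \<notin> p" "X = fr a t" "u \<notin> p" "Y = fr b u" "w \<notin> p" "Z = fr c w"
    by (elim L_cases)
  \<comment> \<open>The common denominator contains \<open>w\<close> twice; the surplus factor
    cancels against the numerator.\<close>
  have "X \<otimes>\<^bsub>L\<^esub> Z \<oplus>\<^bsub>L\<^esub> Y \<otimes>\<^bsub>L\<^esub> Z = fr (((a * u + b * t) * c) * w) (((t * u) * w) * w)"
    using * by (simp add: L_simps algebra_simps)
  also have "\<dots> = fr ((a * u + b * t) * c) ((t * u) * w)"
    using * by (intro fr_cancel mult_notin)
  finally show "(X \<oplus>\<^bsub>L\<^esub> Y) \<otimes>\<^bsub>L\<^esub> Z = X \<otimes>\<^bsub>L\<^esub> Z \<oplus>\<^bsub>L\<^esub> Y \<otimes>\<^bsub>L\<^esub> Z"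
    using * by (simp add: L_simps)
qed

text \<open>Bounds from above the ideal that the image of \<open>J\<close> generates.\<close>

lemma ideal_of_fractions:
  assumes "is_ideal J"
  shows "ideal {fr b t |b t. b \<in> J \<and> t \<notin> p} L"
proof -
  interpret L: cring L by (rule cring_L)
  let ?J = "{fr b t |b t. b \<in> J \<and> t \<notin> p}"
  have inv: "\<ominus>\<^bsub>L\<^esub> fr b t = fr (- b) t" if "t \<notin> p" for b t
    by (rule L.minus_equality) (use that fr_0 [of "t * t"] mult_notin [of t t] in \<open>simp_all add: L_simps\<close>)
  show ?thesis
  proof (rule idealI [OF L.ring_axioms])
    show "subgroup ?J (add_monoid L)"
    proof (rule L.add.subgroupI)
      show "?J \<noteq> {}" using is_idealD(1) [OF assms] one_notin by blast
      fix X assume "X \<in> ?J"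
      then obtain b t where X: "X = fr b t" "b \<in> J" "t \<notin> p" by blast
      then have "- b \<in> J" using is_idealD [OF assms] by blast
      then show "\<ominus>\<^bsub>L\<^esub> X \<in> ?J" using X inv by auto
      fix Y assume "Y \<in> ?J"
      then obtain c u where Y: "Y = fr c u" "c \<in> J" "u \<notin> p" by blast
      have "b * u + c * t \<in> J" using X Y is_idealD [OF assms] by blast
      then show "X \<oplus>\<^bsub>L\<^esub> Y \<in> ?J" using X Y mult_notin by (auto simp: add_L)
    qed auto
    fix X Y assume "X \<in> ?J" "Y \<in> carrier L"
    then obtain b t c u where *: "X = fr b t" "b \<in> J" "t \<notin> p" "u \<notin> p" "Y = fr c u"
      by (elim L_cases) blast
    have "c * b \<in> J" "b * c \<in> J" using * is_idealD [OF assms] by blast+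
    then show "Y \<otimes>\<^bsub>L\<^esub> X \<in> ?J" "X \<otimes>\<^bsub>L\<^esub> Y \<in> ?J" using * mult_notin by (auto simp: mult_L)
  qed
qed

text \<open>Clearing denominators removes the localization from all later arguments. Conversely,
  \<open>a / 1\<close> is recovered from \<open>t * a\<close> by multiplying with
  \<open>1 / t\<close>.\<close>

lemma loc_contraction_univ_ring:
  assumes "is_ideal J"
  shows "loc_contraction univ_ring p J = {a. \<exists>t. t \<notin> p \<and> t * a \<in> J}"
proof (intro equalityI subsetI)
  interpret L: cring L by (rule cring_L)
  fix a assume "a \<in> loc_contraction univ_ring p J"
  then have "fr a 1 \<in> genideal L ((\<lambda>b. fr b 1) ` J)"
    by (simp add: loc_contraction_def loc_map_def image_def)
  also have "genideal L ((\<lambda>b. fr b 1) ` J) \<subseteq> {fr b t |b t. b \<in> J \<and> t \<notin> p}"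
    by (rule L.genideal_minimal [OF ideal_of_fractions [OF assms]]) (use one_notin in auto)
  finally obtain b t where bt: "fr a 1 = fr b t" "b \<in> J" "t \<notin> p" by blast
  then obtain v where v: "v \<notin> p" "v * (a * t - b * 1) = 0" using fr_eq_iff one_notin by blast
  then have "(v * t) * a = v * b" by (simp add: algebra_simps)
  then have "(v * t) * a \<in> J" using bt is_idealD(3) [OF assms] by simp
  then show "a \<in> {a. \<exists>t. t \<notin> p \<and> t * a \<in> J}" using v bt mult_notin by blast
next
  fix a assume "a \<in> {a. \<exists>t. t \<notin> p \<and> t * a \<in> J}"
  then obtain t where t: "t \<notin> p" "t * a \<in> J" by blast
  have "fr a 1 \<in> I" if "ideal I L" "(\<lambda>b. fr b 1) ` J \<subseteq> I" for I
  proof -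
    interpret ideal I L by fact
    have "fr (t * a) 1 \<in> I" using that(2) t(2) by blast
    then have "fr 1 t \<otimes>\<^bsub>L\<^esub> fr (t * a) 1 \<in> I" using t(1) by (intro I_l_closed) simp_all
    also have "fr 1 t \<otimes>\<^bsub>L\<^esub> fr (t * a) 1 = fr a 1"
      using t one_notin fr_cancel [of 1 t a] by (simp add: mult_L mult.commute)
    finally show ?thesis .
  qed
  then show "a \<in> loc_contraction univ_ring p J"
    by (simp add: loc_contraction_def loc_map_def genideal_def)
qed

end

lemma symbolic_power_univ_ring:
  assumes "is_ideal I" "is_ideal (ideal_power univ_ring I s)"
  shows "symbolic_power univ_ring I s =
    {a. \<forall>p. primeideal p univ_ring \<and> (\<exists>f. p = {r. r * f \<in> I}) \<longrightarrow>
      (\<exists>t. t \<notin> p \<and> t * a \<in> ideal_power univ_ring I s)}"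
proof -
  have "symbolic_power univ_ring I s =
      (\<Inter>p\<in>{p. primeideal p univ_ring \<and> (\<exists>f. p = {r. r * f \<in> I})}.
        {a. \<exists>t. t \<notin> p \<and> t * a \<in> ideal_power univ_ring I s})"
    unfolding symbolic_power_def Ass_univ_ring [OF assms(1)] univ_ring_simps Int_UNIV_left
    by (intro INF_cong refl)
      (simp add: prime_of_ring.loc_contraction_univ_ring [OF prime_of_ring.intro assms(2)])
  then show ?thesis by (simp only: INTER_eq Ball_def mem_Collect_eq)
qed

section \<open>Monomial ideals\<close>

text \<open>For up-closed \<open>U\<close> this is the ideal spanned by the monomials in
  \<open>U\<close>; products of such ideals become sumsets of exponents.\<close>

definition monomial_ideal :: "'m set \<Rightarrow> ('m::comm_monoid_add \<Rightarrow>\<^sub>0 'k::comm_ring_1) set" where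
  "monomial_ideal U = {f. Poly_Mapping.keys f \<subseteq> U}"

definition up_closed :: "'m::comm_monoid_add set \<Rightarrow> bool" where
  "up_closed U \<longleftrightarrow> (\<forall>u\<in>U. \<forall>w. u + w \<in> U)"

abbreviation monom :: "'m \<Rightarrow> 'm \<Rightarrow>\<^sub>0 'k::comm_ring_1" where
  "monom m \<equiv> Poly_Mapping.single m 1"

lemma monom_in_monomial_ideal [simp]:
  "(monom m :: 'm::comm_monoid_add \<Rightarrow>\<^sub>0 'k::comm_ring_1) \<in> monomial_ideal U \<longleftrightarrow> m \<in> U"
  by (simp add: monomial_ideal_def)

lemma is_ideal_monomial_ideal:
  assumes "up_closed U"
  shows "is_ideal (monomial_ideal U :: ('m::comm_monoid_add \<Rightarrow>\<^sub>0 'k::comm_ring_1) set)"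
  unfolding is_ideal_def
proof (intro conjI ballI allI)
  fix f g r :: "'m \<Rightarrow>\<^sub>0 'k"
  assume f: "f \<in> monomial_ideal U"
  show "f + g \<in> monomial_ideal U" if "g \<in> monomial_ideal U"
    using f that Poly_Mapping.keys_add [of f g] by (auto simp: monomial_ideal_def)
  show "r * f \<in> monomial_ideal U"
    unfolding monomial_ideal_def
  proof (rule CollectI, rule subsetI)
    fix m assume "m \<in> Poly_Mapping.keys (r * f)"
    then obtain a b where "m = b + a" "b \<in> Poly_Mapping.keys f"
      using Poly_Mapping.keys_mult [of r f] by (auto simp: add.commute)
    then show "m \<in> U" using assms f by (auto simp: up_closed_def monomial_ideal_def)
  qed
qed (simp add: monomial_ideal_def)

lemma poly_mapping_sum_single:
  "f = (\<Sum>m\<in>Poly_Mapping.keys f. Poly_Mapping.single m (Poly_Mapping.lookup f m))"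
proof (rule poly_mapping_eqI)
  fix k
  show "Poly_Mapping.lookup f k = Poly_Mapping.lookup
      (\<Sum>m\<in>Poly_Mapping.keys f. Poly_Mapping.single m (Poly_Mapping.lookup f m)) k"
    by (simp add: lookup_sum lookup_single when_def sum.If_cases in_keys_iff)
qed

lemma single_eq_mult_monom:
  "Poly_Mapping.single (w + m) c = Poly_Mapping.single w c * (monom m :: 'm::comm_monoid_add \<Rightarrow>\<^sub>0 'k::comm_ring_1)"
  by (simp add: mult_single)

lemma monomial_ideal_subset:
  fixes L :: "('m::comm_monoid_add \<Rightarrow>\<^sub>0 'k::comm_ring_1) set"
  assumes "is_ideal L" "\<And>m. m \<in> U \<Longrightarrow> monom m \<in> L"
  shows "monomial_ideal U \<subseteq> L"
proof
  fix f :: "'m \<Rightarrow>\<^sub>0 'k" assume f: "f \<in> monomial_ideal U"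
  have "Poly_Mapping.single m (Poly_Mapping.lookup f m) \<in> L" if "m \<in> Poly_Mapping.keys f" for m
  proof -
    have "monom m \<in> L" using assms(2) f that by (auto simp: monomial_ideal_def)
    then have "Poly_Mapping.single 0 (Poly_Mapping.lookup f m) * monom m \<in> L"
      by (rule is_idealD(3) [OF assms(1)])
    then show ?thesis by (simp add: mult_single)
  qed
  then show "f \<in> L"
    by (subst poly_mapping_sum_single) (rule is_ideal_sum [OF assms(1)])
qed

section \<open>Sumsets of exponents and products of ideals\<close>

definition sumset :: "'m::comm_monoid_add set \<Rightarrow> 'm set \<Rightarrow> 'm set" where
  "sumset U V = {u + v |u v. u \<in> U \<and> v \<in> V}"

lemma up_closed_sumset: "up_closed V \<Longrightarrow> up_closed (sumset U V)"
  unfolding up_closed_def sumset_def by (auto simp: add.assoc) blast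

lemma genideal_monomials:
  "genideal univ_ring (monom ` B) =
    (monomial_ideal (sumset B UNIV) :: ('m::comm_monoid_add \<Rightarrow>\<^sub>0 'k::comm_ring_1) set)"
proof (rule genideal_univ_ring)
  show "is_ideal (monomial_ideal (sumset B UNIV) :: ('m \<Rightarrow>\<^sub>0 'k) set)"
    by (intro is_ideal_monomial_ideal up_closed_sumset) (simp add: up_closed_def)
  have "b \<in> sumset B UNIV" if "b \<in> B" for b
  proof -
    have "b = b + 0" by simp
    then show ?thesis unfolding sumset_def using that by blast
  qed
  then show "monom ` B \<subseteq> (monomial_ideal (sumset B UNIV) :: ('m \<Rightarrow>\<^sub>0 'k) set)" by auto
  fix J :: "('m \<Rightarrow>\<^sub>0 'k) set" assume J: "is_ideal J" "monom ` B \<subseteq> J"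
  show "monomial_ideal (sumset B UNIV) \<subseteq> J"
  proof (rule monomial_ideal_subset [OF J(1)])
    fix m assume "m \<in> sumset B UNIV"
    then obtain b w where "m = w + b" "b \<in> B" by (auto simp: sumset_def add.commute)
    then show "monom m \<in> J" using J is_idealD(3) [OF J(1)] by (auto simp: single_eq_mult_monom)
  qed
qed

lemma ideal_prod_monomial_ideal:
  assumes "up_closed U" "up_closed V"
  shows "ideal_prod univ_ring (monomial_ideal U) (monomial_ideal V) =
    (monomial_ideal (sumset U V) :: ('m::comm_monoid_add \<Rightarrow>\<^sub>0 'k::comm_ring_1) set)"
proof (rule ideal_prod_univ_ring)
  fix a b :: "'m \<Rightarrow>\<^sub>0 'k" assume "a \<in> monomial_ideal U" "b \<in> monomial_ideal V"
  then show "a * b \<in> monomial_ideal (sumset U V)"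
    using Poly_Mapping.keys_mult [of a b] unfolding monomial_ideal_def sumset_def by blast
next
  fix L :: "('m \<Rightarrow>\<^sub>0 'k) set"
  assume L: "is_ideal L" "\<And>a b. a \<in> monomial_ideal U \<Longrightarrow> b \<in> monomial_ideal V \<Longrightarrow> a * b \<in> L"
  show "monomial_ideal (sumset U V) \<subseteq> L"
  proof (rule monomial_ideal_subset [OF L(1)])
    fix m assume "m \<in> sumset U V"
    then obtain u v where "m = u + v" "u \<in> U" "v \<in> V" by (auto simp: sumset_def)
    then show "monom m \<in> L" by (auto simp: single_eq_mult_monom intro!: L(2))
  qed
qed (use assms in \<open>auto intro!: is_ideal_monomial_ideal up_closed_sumset\<close>)

text \<open>The value at 0 is \<open>UNIV\<close> because the zeroth power of an ideal is the whole
  ring.\<close>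

primrec sumset_power :: "'m::comm_monoid_add set \<Rightarrow> nat \<Rightarrow> 'm set" where
  "sumset_power U 0 = UNIV"
| "sumset_power U (Suc s) = sumset (sumset_power U s) U"

lemma up_closed_sumset_power: "up_closed U \<Longrightarrow> up_closed (sumset_power U s)"
  by (cases s) (simp_all add: up_closed_sumset, simp add: up_closed_def)

lemma ideal_power_monomial_ideal:
  assumes "up_closed U"
  shows "ideal_power univ_ring (monomial_ideal U) s =
    (monomial_ideal (sumset_power U s) :: ('m::comm_monoid_add \<Rightarrow>\<^sub>0 'k::comm_ring_1) set)"
proof (induction s)
  case 0
  show ?case by (simp add: ideal_power_def ideals_set_def monomial_ideal_def)
next
  case (Suc s)
  have "ideal_power univ_ring (monomial_ideal U :: ('m \<Rightarrow>\<^sub>0 'k) set) (Suc s) =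
      ideal_prod univ_ring (ideal_power univ_ring (monomial_ideal U) s) (monomial_ideal U)"
    by (simp add: ideal_power_def ideals_set_def)
  then show ?case
    by (simp add: Suc ideal_prod_monomial_ideal up_closed_sumset_power assms)
qed

lemma lookup_mult_sum:
  fixes f g :: "'m::comm_monoid_add \<Rightarrow>\<^sub>0 'k::comm_ring_1"
  shows "Poly_Mapping.lookup (f * g) k = (\<Sum>a\<in>Poly_Mapping.keys f. \<Sum>b\<in>Poly_Mapping.keys g.
    if a + b = k then Poly_Mapping.lookup f a * Poly_Mapping.lookup g b else 0)"
proof -
  have "f * g = (\<Sum>a\<in>Poly_Mapping.keys f. Poly_Mapping.single a (Poly_Mapping.lookup f a)) *
      (\<Sum>b\<in>Poly_Mapping.keys g. Poly_Mapping.single b (Poly_Mapping.lookup g b))"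
    using poly_mapping_sum_single [of f] poly_mapping_sum_single [of g] by simp
  also have "\<dots> = (\<Sum>a\<in>Poly_Mapping.keys f. \<Sum>b\<in>Poly_Mapping.keys g.
      Poly_Mapping.single (a + b) (Poly_Mapping.lookup f a * Poly_Mapping.lookup g b))"
    by (simp add: sum_product mult_single)
  finally show ?thesis
    by (simp add: lookup_sum lookup_single when_def)
qed

text \<open>Successive minimization of the functionals in \<open>\<phi>s\<close>; it replaces a monomial order.\<close>

lemma unique_minimal_sum:
  fixes A B :: "'m::comm_monoid_add set"
  assumes "finite A" "A \<noteq> {}" "finite B" "B \<noteq> {}"
    and "\<And>\<phi> a b. \<phi> \<in> set \<phi>s \<Longrightarrow> \<phi> (a + b) = \<phi> a + (\<phi> b :: nat)"
  shows "\<exists>a\<in>A. \<exists>b\<in>B. \<forall>a'\<in>A. \<forall>b'\<in>B. a' + b' = a + b \<longrightarrow> (\<forall>\<phi>\<in>set \<phi>s. \<phi> a' = \<phi> a \<and> \<phi> b' = \<phi> b)"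
  using assms
proof (induction \<phi>s arbitrary: A B)
  case Nil
  then show ?case by auto
next
  case (Cons \<phi> \<phi>s)
  define A' where "A' = {a \<in> A. \<phi> a = Min (\<phi> ` A)}"
  define B' where "B' = {b \<in> B. \<phi> b = Min (\<phi> ` B)}"
  have "Min (\<phi> ` A) \<in> \<phi> ` A" "Min (\<phi> ` B) \<in> \<phi> ` B" using Cons.prems by (auto intro!: Min_in)
  then have ne: "A' \<noteq> {}" "B' \<noteq> {}" by (auto simp: A'_def B'_def)
  have "finite A'" "finite B'" using Cons.prems by (auto simp: A'_def B'_def)
  then obtain a b where ab: "a \<in> A'" "b \<in> B'"
    "\<And>a' b'. a' \<in> A' \<Longrightarrow> b' \<in> B' \<Longrightarrow> a' + b' = a + b \<Longrightarrow> \<forall>\<phi>\<in>set \<phi>s. \<phi> a' = \<phi> a \<and> \<phi> b' = \<phi> b"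
    using Cons.IH [of A' B'] ne Cons.prems(5) by (metis list.set_intros(2))
  \<comment> \<open>Both parts of the chosen sum are minimal, so an equal sum cannot exceed the
    minimum in either part.\<close>
  have *: "a' \<in> A' \<and> b' \<in> B'" if "a' \<in> A" "b' \<in> B" "a' + b' = a + b" for a' b'
  proof -
    have "\<phi> a' + \<phi> b' = \<phi> a + \<phi> b"
      using Cons.prems(5) [of \<phi>] that(3) by (metis list.set_intros(1))
    moreover have "\<phi> a \<le> \<phi> a'" "\<phi> b \<le> \<phi> b'"
      using ab(1,2) that Cons.prems by (auto simp: A'_def B'_def)
    ultimately have "\<phi> a' = \<phi> a" "\<phi> b' = \<phi> b" by linarith+
    then show ?thesis using that ab(1,2) by (simp add: A'_def B'_def)
  qed
  have **: "\<forall>\<phi>'\<in>set (\<phi> # \<phi>s). \<phi>' a' = \<phi>' a \<and> \<phi>' b' = \<phi>' b"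
    if "a' \<in> A" "b' \<in> B" "a' + b' = a + b" for a' b'
  proof -
    have m: "a' \<in> A'" "b' \<in> B'" using * [OF that] by auto
    then have "\<phi> a' = \<phi> a" "\<phi> b' = \<phi> b" using ab(1,2) by (simp_all add: A'_def B'_def)
    then show ?thesis using ab(3) [OF m that(3)] by simp
  qed
  have aA: "a \<in> A" and bB: "b \<in> B" using ab(1,2) by (simp_all add: A'_def B'_def)
  show ?case by (rule bexI [OF bexI [OF _ bB] aA]) (intro ballI impI **)
qed

definition wdeg :: "'v set \<Rightarrow> ('v::finite \<Rightarrow>\<^sub>0 nat) \<Rightarrow> nat" where
  "wdeg W m = (\<Sum>v\<in>W. Poly_Mapping.lookup m v)"

lemma wdeg_add: "wdeg W (a + b) = wdeg W a + wdeg W b"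
  by (simp add: wdeg_def lookup_add sum.distrib)

text \<open>Among the terms of lowest \<open>W\<close>-degree, the coordinates single out a sum that
  arises from only one pair of exponents, so its coefficient cannot cancel.\<close>

lemma product_lowest_monomial:
  fixes f g :: "('v::finite \<Rightarrow>\<^sub>0 nat) \<Rightarrow>\<^sub>0 'k::field"
  assumes "a0 \<in> Poly_Mapping.keys f" "b0 \<in> Poly_Mapping.keys g"
  obtains a b where "wdeg W a \<le> wdeg W a0" "wdeg W b \<le> wdeg W b0" "a + b \<in> Poly_Mapping.keys (f * g)"
proof -
  obtain vs :: "'v list" where vs: "set vs = UNIV" using finite_list [OF finite] by blast
  define \<phi>s :: "(('v \<Rightarrow>\<^sub>0 nat) \<Rightarrow> nat) list" where "\<phi>s = map (\<lambda>v m. Poly_Mapping.lookup m v) vs"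
  let ?A = "{a \<in> Poly_Mapping.keys f. wdeg W a = Min (wdeg W ` Poly_Mapping.keys f)}"
  let ?B = "{b \<in> Poly_Mapping.keys g. wdeg W b = Min (wdeg W ` Poly_Mapping.keys g)}"
  have "Min (wdeg W ` Poly_Mapping.keys f) \<in> wdeg W ` Poly_Mapping.keys f"
    "Min (wdeg W ` Poly_Mapping.keys g) \<in> wdeg W ` Poly_Mapping.keys g"
    using assms by (auto intro!: Min_in)
  then have "?A \<noteq> {}" "?B \<noteq> {}" by auto
  then obtain a b where ab: "a \<in> ?A" "b \<in> ?B"
    and uniq: "\<And>a' b'. a' \<in> ?A \<Longrightarrow> b' \<in> ?B \<Longrightarrow> a' + b' = a + b \<Longrightarrow>
      \<forall>\<phi>\<in>set \<phi>s. \<phi> a' = \<phi> a \<and> \<phi> b' = \<phi> b"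
    using unique_minimal_sum [of ?A ?B \<phi>s] by (force simp: \<phi>s_def lookup_add)
  have le: "wdeg W a \<le> wdeg W a'" if "a' \<in> Poly_Mapping.keys f" for a' using ab that by auto
  have le': "wdeg W b \<le> wdeg W b'" if "b' \<in> Poly_Mapping.keys g" for b' using ab that by auto
  \<comment> \<open>An equal sum forces lowest \<open>W\<close>-degree in both factors, so
    uniqueness within \<open>?A\<close> and \<open>?B\<close> extends to all exponents.\<close>
  have eq: "a' = a \<and> b' = b"
    if "a' \<in> Poly_Mapping.keys f" "b' \<in> Poly_Mapping.keys g" "a' + b' = a + b" for a' b'
  proof -
    have "wdeg W a' + wdeg W b' = wdeg W a + wdeg W b" using that(3) by (metis wdeg_add)
    then have "wdeg W a' = wdeg W a" "wdeg W b' = wdeg W b"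
      using le [OF that(1)] le' [OF that(2)] by linarith+
    then have "\<forall>\<phi>\<in>set \<phi>s. \<phi> a' = \<phi> a \<and> \<phi> b' = \<phi> b" using ab that by (intro uniq) auto
    then show ?thesis by (auto simp: \<phi>s_def vs intro!: poly_mapping_eqI)
  qed
  have "Poly_Mapping.lookup (f * g) (a + b) =
      (\<Sum>a'\<in>Poly_Mapping.keys f. \<Sum>b'\<in>Poly_Mapping.keys g.
        if a' = a \<and> b' = b then Poly_Mapping.lookup f a * Poly_Mapping.lookup g b else 0)"
    unfolding lookup_mult_sum by (intro sum.cong refl) (use eq in auto)
  also have "\<dots> = (\<Sum>a'\<in>Poly_Mapping.keys f. if a' = a then Poly_Mapping.lookup f a * Poly_Mapping.lookup g b else 0)"
    using ab(2) by (intro sum.cong refl) (auto simp: sum.delta)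
  also have "\<dots> = Poly_Mapping.lookup f a * Poly_Mapping.lookup g b"
    using ab(1) by (simp add: sum.delta)
  also have "\<dots> \<noteq> 0" using ab by (simp add: in_keys_iff)
  finally have "a + b \<in> Poly_Mapping.keys (f * g)" by (simp add: in_keys_iff)
  then show ?thesis using that le [OF assms(1)] le' [OF assms(2)] by blast
qed

lemma lookup_single_0_mult:
  "Poly_Mapping.lookup (Poly_Mapping.single 0 c * f) m = c * Poly_Mapping.lookup f m"
  for f :: "'m::comm_monoid_add \<Rightarrow>\<^sub>0 'k::comm_ring_1"
  by (simp add: mult_map_scale_conv_mult [symmetric] Poly_Mapping.map.rep_eq when_def)

text \<open>Upper bound: the monomials in \<open>Q\<close> generate. Lower bound: reading off the coefficients at
  \<open>Q\<close> turns generators of the module into a spanning set of a vector space of dimension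
  \<open>card Q\<close>, because multiplication by a polynomial acts on these coefficients through its
  constant term.\<close>

theorem min_gens_monomial_quotient:
  fixes U V Q :: "'m::comm_monoid_add set"
  assumes U: "up_closed U" and V: "up_closed V" and VU: "V \<subseteq> U"
    and Q: "finite Q" "Q \<subseteq> U" "Q \<inter> V = {}"
    and min: "\<And>u w. u \<in> U \<Longrightarrow> u + w \<in> Q \<Longrightarrow> w = 0"
    and gen: "\<And>u. u \<in> U \<Longrightarrow> u \<in> V \<or> (\<exists>q\<in>Q. \<exists>w. u = q + w)"
  shows "min_gens univ_ring (ideal_quotient (monomial_ideal U :: ('m \<Rightarrow>\<^sub>0 'k::field) set)
    (monomial_ideal V)) = card Q"
proof -
  let ?J = "monomial_ideal U :: ('m \<Rightarrow>\<^sub>0 'k) set"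
  let ?K = "monomial_ideal V :: ('m \<Rightarrow>\<^sub>0 'k) set"
  let ?M = "ideal_quotient ?J ?K"
  have J: "is_ideal ?J" and K: "is_ideal ?K" using U V by (simp_all add: is_ideal_monomial_ideal)
  note sub_iff = submodule_ideal_quotient_iff [OF J K]
  note K_simps = add_ideal_quotient [OF K] smult_ideal_quotient [OF K]
  show ?thesis
    unfolding min_gens_def
  proof (rule Least_equality)
    let ?F = "(\<lambda>q. coset ?K (monom q)) ` Q"
    have "inj_on (\<lambda>q. coset ?K (monom q)) Q"
    proof (rule inj_onI, rule ccontr)
      fix q q' assume *: "q \<in> Q" "q' \<in> Q" "coset ?K (monom q) = coset ?K (monom q')" "q \<noteq> q'"
      then have "monom q - monom q' \<in> ?K" by (simp add: coset_eq_iff [OF K])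
      moreover have "q \<in> Poly_Mapping.keys (monom q - monom q' :: 'm \<Rightarrow>\<^sub>0 'k)"
        using *(4) by (simp add: in_keys_iff lookup_minus lookup_single_not_eq)
      ultimately show False using Q(3) *(1) by (auto simp: monomial_ideal_def)
    qed
    moreover have "generates univ_ring ?M ?F"
      unfolding generates_def
    proof (intro conjI equalityI)
      show F: "?F \<subseteq> carrier ?M" using Q(2) by (auto simp: carrier_ideal_quotient)
      have "?K = coset ?K 0" by (simp add: coset_0)
      then have "?K \<in> coset ?K ` ?J" using is_idealD(1) [OF J] by blast
      then have "submodule (carrier ?M) univ_ring ?M"
        unfolding sub_iff carrier_ideal_quotient using is_idealD [OF J] by (auto simp: K_simps)
      then show "\<Inter> {H. submodule H univ_ring ?M \<and> ?F \<subseteq> H} \<subseteq> carrier ?M" using F by blast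
      show "carrier ?M \<subseteq> \<Inter> {H. submodule H univ_ring ?M \<and> ?F \<subseteq> H}"
      proof (rule Inter_greatest)
        fix H assume "H \<in> {H. submodule H univ_ring ?M \<and> ?F \<subseteq> H}"
        then have H: "?K \<in> H" "\<forall>X\<in>H. \<forall>Y\<in>H. X \<oplus>\<^bsub>?M\<^esub> Y \<in> H" "\<forall>r. \<forall>X\<in>H. r \<odot>\<^bsub>?M\<^esub> X \<in> H"
          and FH: "?F \<subseteq> H" by (simp_all add: sub_iff)
        have D: "is_ideal {f. coset ?K f \<in> H}"
          unfolding is_ideal_def using H by (auto simp: coset_0 simp flip: K_simps [where J = ?J])
        have "monom m \<in> {f. coset ?K f \<in> H}" if "m \<in> U" for m
          using gen [OF that]
        proof
          assume "m \<in> V"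
          then have "coset ?K (monom m) = ?K" using coset_eq_iff [OF K, of "monom m" 0] by (simp add: coset_0)
          then show ?thesis using H(1) by simp
        next
          assume "\<exists>q\<in>Q. \<exists>w. m = q + w"
          then obtain q w where m: "q \<in> Q" "m = w + q" by (auto simp: add.commute)
          then have "monom q \<in> {f. coset ?K f \<in> H}" using FH by auto
          then show ?thesis unfolding m(2) single_eq_mult_monom by (rule is_idealD(3) [OF D])
        qed
        then have "?J \<subseteq> {f. coset ?K f \<in> H}" by (rule monomial_ideal_subset [OF D])
        then show "carrier ?M \<subseteq> H" by (auto simp: carrier_ideal_quotient)
      qed
    qed
    ultimately show "\<exists>F. finite F \<and> card F = card Q \<and> generates univ_ring ?M F"
      using Q(1) by (intro exI [of _ ?F]) (simp add: card_image)
  next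
    fix k assume "\<exists>F. finite F \<and> card F = k \<and> generates univ_ring ?M F"
    then obtain F where F: "finite F" "card F = k" "generates univ_ring ?M F" by blast
    then have F_sub: "F \<subseteq> coset ?K ` ?J"
      and F_gen: "\<And>H. submodule H univ_ring ?M \<Longrightarrow> F \<subseteq> H \<Longrightarrow> carrier ?M \<subseteq> H"
      unfolding generates_def carrier_ideal_quotient by blast+
    interpret vs: vector_space "\<lambda>(c::'k) (f::'m \<Rightarrow>\<^sub>0 'k). Poly_Mapping.single 0 c * f"
      by unfold_locales (simp_all add: algebra_simps single_add mult_single flip: mult.assoc)
    define \<phi> :: "('m \<Rightarrow>\<^sub>0 'k) \<Rightarrow> ('m \<Rightarrow>\<^sub>0 'k)"
      where "\<phi> f = (\<Sum>q\<in>Q. Poly_Mapping.single q (Poly_Mapping.lookup f q))" for f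
    have \<phi>_lookup: "Poly_Mapping.lookup (\<phi> f) m = (if m \<in> Q then Poly_Mapping.lookup f m else 0)" for f m
      unfolding \<phi>_def using Q(1) by (simp add: lookup_sum lookup_single when_def)
    have \<phi>_add: "\<phi> (f + g) = \<phi> f + \<phi> g" for f g
      by (rule poly_mapping_eqI) (simp add: \<phi>_lookup lookup_add)
    have \<phi>_K: "\<phi> f = 0" if "f \<in> ?K" for f
    proof (rule poly_mapping_eqI)
      fix m
      show "Poly_Mapping.lookup (\<phi> f) m = Poly_Mapping.lookup 0 m"
        using that Q(3) by (auto simp: \<phi>_lookup monomial_ideal_def in_keys_iff)
    qed
    have \<phi>_mult: "\<phi> (r * f) = Poly_Mapping.single 0 (Poly_Mapping.lookup r 0) * \<phi> f" if f: "f \<in> ?J" for r f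
    proof (rule poly_mapping_eqI)
      fix q
      show "Poly_Mapping.lookup (\<phi> (r * f)) q =
          Poly_Mapping.lookup (Poly_Mapping.single 0 (Poly_Mapping.lookup r 0) * \<phi> f) q"
      proof (cases "q \<in> Q")
        case True
        \<comment> \<open>By \<open>min\<close>, an exponent in \<open>Q\<close> is no proper
          multiple of one in \<open>U\<close>, so only the constant term of \<open>r\<close>
          contributes.\<close>
        have iff: "a + b = q \<longleftrightarrow> a = 0 \<and> b = q" if "b \<in> Poly_Mapping.keys f" for a b
        proof
          assume *: "a + b = q"
          then have "b + a \<in> Q" using True by (simp add: add.commute)
          moreover have "b \<in> U" using f that by (auto simp: monomial_ideal_def)
          ultimately show "a = 0 \<and> b = q" using min [of b a] * by auto
        qed auto
        have "Poly_Mapping.lookup (r * f) q = (\<Sum>a\<in>Poly_Mapping.keys r. \<Sum>b\<in>Poly_Mapping.keys f.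
            if b = q then if a = 0 then Poly_Mapping.lookup r a * Poly_Mapping.lookup f b else 0 else 0)"
          unfolding lookup_mult_sum by (intro sum.cong refl) (simp add: iff)
        also have "\<dots> = (\<Sum>a\<in>Poly_Mapping.keys r.
            if a = 0 then Poly_Mapping.lookup r 0 * Poly_Mapping.lookup f q else 0)"
          by (intro sum.cong refl) (auto simp: sum.delta in_keys_iff)
        also have "\<dots> = Poly_Mapping.lookup r 0 * Poly_Mapping.lookup f q"
          by (auto simp: sum.delta in_keys_iff)
        finally show ?thesis using True by (simp add: \<phi>_lookup lookup_single_0_mult)
      qed (simp add: \<phi>_lookup lookup_single_0_mult)
    qed
    have "\<forall>X\<in>F. \<exists>f. f \<in> ?J \<and> X = coset ?K f" using F_sub by blast
    then obtain rep where rep: "\<And>X. X \<in> F \<Longrightarrow> rep X \<in> ?J \<and> X = coset ?K (rep X)" by metis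
    define T where "T = (\<lambda>X. \<phi> (rep X)) ` F"
    \<comment> \<open>These classes form a submodule containing \<open>F\<close>, hence everything;
      so all coefficient vectors at \<open>Q\<close> are spanned by those of the generators.\<close>
    define H where "H = {coset ?K f |f. f \<in> ?J \<and> \<phi> f \<in> vs.span T}"
    have "submodule H univ_ring ?M"
      unfolding sub_iff
    proof (intro conjI ballI allI)
      show "H \<subseteq> coset ?K ` ?J" by (auto simp: H_def)
      have "0 \<in> ?J" "\<phi> 0 \<in> vs.span T" using is_idealD(1) [OF J] \<phi>_K is_idealD(1) [OF K] by (auto simp: vs.span_zero)
      then have "coset ?K 0 \<in> H" unfolding H_def by blast
      then show "?K \<in> H" by (simp add: coset_0)
      fix X assume "X \<in> H"
      then obtain f where f: "X = coset ?K f" "f \<in> ?J" "\<phi> f \<in> vs.span T" by (auto simp: H_def)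
      show "r \<odot>\<^bsub>?M\<^esub> X \<in> H" for r
      proof -
        have "r * f \<in> ?J" "\<phi> (r * f) \<in> vs.span T"
          using f is_idealD(3) [OF J] vs.span_scale by (auto simp: \<phi>_mult)
        then show ?thesis unfolding f(1) K_simps H_def by blast
      qed
      fix Y assume "Y \<in> H"
      then obtain g where g: "Y = coset ?K g" "g \<in> ?J" "\<phi> g \<in> vs.span T" by (auto simp: H_def)
      have "f + g \<in> ?J" "\<phi> (f + g) \<in> vs.span T"
        using f g is_idealD(2) [OF J] vs.span_add by (auto simp: \<phi>_add)
      then show "X \<oplus>\<^bsub>?M\<^esub> Y \<in> H" unfolding f(1) g(1) K_simps H_def by blast
    qed
    moreover have "F \<subseteq> H"
    proof
      fix X assume X: "X \<in> F"
      then have "\<phi> (rep X) \<in> vs.span T" unfolding T_def by (intro vs.span_base) blast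
      then show "X \<in> H" unfolding H_def using rep [OF X] by blast
    qed
    ultimately have carrier: "coset ?K ` ?J \<subseteq> H"
      using F_gen by (simp add: carrier_ideal_quotient)
    let ?B = "monom ` Q :: ('m \<Rightarrow>\<^sub>0 'k) set"
    have "?B \<subseteq> vs.span T"
    proof
      fix b assume "b \<in> ?B"
      then obtain q where q: "q \<in> Q" "b = monom q" by blast
      then have "b \<in> ?J" using Q(2) by auto
      then have "coset ?K b \<in> H" using carrier by blast
      then obtain f where f: "coset ?K b = coset ?K f" "\<phi> f \<in> vs.span T" by (auto simp: H_def)
      then have "b - f \<in> ?K" by (simp add: coset_eq_iff [OF K])
      \<comment> \<open>Two representatives of a class have the same coefficients at
        \<open>Q\<close>, because \<open>Q\<close> avoids \<open>V\<close>.\<close>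
      then have "\<phi> (f + (b - f)) = \<phi> f" unfolding \<phi>_add by (simp add: \<phi>_K)
      moreover have "\<phi> b = b"
        by (rule poly_mapping_eqI) (auto simp: \<phi>_lookup q lookup_single when_def)
      ultimately show "b \<in> vs.span T" using f(2) by simp
    qed
    moreover have "vs.independent ?B"
      unfolding vs.dependent_def
    proof (rule notI, elim bexE)
      fix b assume b: "b \<in> ?B" "b \<in> vs.span (?B - {b})"
      then obtain q where q: "b = monom q" by blast
      have "vs.span (?B - {b}) \<subseteq> {f. Poly_Mapping.lookup f q = 0}"
      proof (rule vs.span_minimal)
        show "?B - {b} \<subseteq> {f. Poly_Mapping.lookup f q = 0}"
          using q by (auto simp: lookup_single when_def)
        show "vs.subspace {f. Poly_Mapping.lookup f q = 0}"
          by (rule vs.subspaceI) (simp_all add: lookup_add lookup_single_0_mult)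
      qed
      then show False using b(2) q by auto
    qed
    moreover have "finite T" unfolding T_def using F(1) by simp
    ultimately have "card ?B \<le> card T" using vs.independent_span_bound by blast
    also have "\<dots> \<le> card F" unfolding T_def using F(1) by (rule card_image_le)
    also have "card ?B = card Q"
      by (rule card_image) (auto intro!: inj_onI simp: poly_mapping_eq_iff fun_eq_iff lookup_single when_def split: if_splits)
    finally show "card Q \<le> k" using F(2) by simp
  qed
qed

section \<open>Powers of the edge ideal\<close>

text \<open>Every exponent function is admissible because the vertex type is finite.\<close>

definition exponents :: "('v::finite \<Rightarrow> nat) \<Rightarrow> ('v \<Rightarrow>\<^sub>0 nat)" where
  "exponents = Abs_poly_mapping"

lemma lookup_exponents [simp]: "Poly_Mapping.lookup (exponents f) = f"
  by (simp add: exponents_def)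

lemma exponents_le_iff: "(\<forall>v. f v \<le> Poly_Mapping.lookup m v) \<longleftrightarrow> (\<exists>w. m = exponents f + w)"
proof
  assume *: "\<forall>v. f v \<le> Poly_Mapping.lookup m v"
  have "m = exponents f + exponents (\<lambda>v. Poly_Mapping.lookup m v - f v)"
    using * by (intro poly_mapping_eqI) (simp add: lookup_add)
  then show "\<exists>w. m = exponents f + w" ..
qed (auto simp: lookup_add)

text \<open>Each edge of \<open>g\<close> meets \<open>W\<close> and so adds at least one to its
  weight.\<close>

lemma size_le_cover_weight:
  fixes g :: "'v::finite set multiset"
  assumes "\<And>e. e \<in># g \<Longrightarrow> e \<inter> W \<noteq> {}"
  shows "size g \<le> (\<Sum>v\<in>W. inc g v)"
  using assms
proof (induction g)
  case (add e g)
  have "(\<Sum>v\<in>W. inc (add_mset e g) v) = (\<Sum>v\<in>W. inc g v + (if v \<in> e then 1 else 0))"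
    by (intro sum.cong) auto
  also have "\<dots> = (\<Sum>v\<in>W. inc g v) + card (W \<inter> e)"
    by (simp add: sum.distrib sum.If_cases)
  finally have "(\<Sum>v\<in>W. inc (add_mset e g) v) = (\<Sum>v\<in>W. inc g v) + card (W \<inter> e)" .
  moreover have "0 < card (W \<inter> e)" using add.prems [of e] by (simp add: card_gt_0_iff Int_commute)
  moreover have "size g \<le> (\<Sum>v\<in>W. inc g v)" using add.prems by (intro add.IH) auto
  ultimately show ?case unfolding size_add_mset by linarith
qed simp

lemma inc_repeat_mset: "inc (repeat_mset k g) v = k * inc g v"
  by (induction k) simp_all

text \<open>Induction on the degree, splitting off one variable at a time.\<close>

lemma prime_monom:
  assumes p: "primeideal (p :: (('v::finite \<Rightarrow>\<^sub>0 nat) \<Rightarrow>\<^sub>0 'k::field) set) univ_ring"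
  shows "monom m \<in> p \<Longrightarrow> \<exists>v. Poly_Mapping.lookup m v > 0 \<and> vertex_var v \<in> p"
proof (induction "wdeg UNIV m" arbitrary: m)
  case 0
  then have "m = 0" by (intro poly_mapping_eqI) (simp add: wdeg_def)
  then show ?case using 0 p by (simp add: primeideal_univ_ring_iff)
next
  case (Suc d)
  then have "wdeg UNIV m \<noteq> 0" by simp
  then obtain v where v: "Poly_Mapping.lookup m v > 0" by (auto simp: wdeg_def)
  obtain m' where m': "m = Poly_Mapping.single v 1 + m'"
  proof
    show "m = Poly_Mapping.single v 1 + (m - Poly_Mapping.single v 1)"
      using v by (intro poly_mapping_eqI) (auto simp: lookup_add lookup_minus lookup_single when_def)
  qed
  have "wdeg UNIV (Poly_Mapping.single v (1::nat)) = 1"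
    by (simp add: wdeg_def lookup_single when_def)
  then have d: "d = wdeg UNIV m'" using Suc.hyps(2) by (simp add: m' wdeg_add)
  have "vertex_var v * monom m' \<in> p"
    using Suc.prems by (simp add: m' vertex_var_def mult_single)
  then consider "vertex_var v \<in> p" | "monom m' \<in> p"
    using p unfolding primeideal_univ_ring_iff by blast
  then show ?case
  proof cases
    case 1
    then show ?thesis using v by blast
  next
    case 2
    then obtain u where "Poly_Mapping.lookup m' u > 0" "vertex_var u \<in> p" using Suc.hyps(1) [OF d] by blast
    then show ?thesis by (intro exI [of _ u]) (simp add: m' lookup_add)
  qed
qed

lemma key_monom_mult:
  fixes f :: "('v \<Rightarrow>\<^sub>0 nat) \<Rightarrow>\<^sub>0 'k::field"
  assumes "m \<in> Poly_Mapping.keys f"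
  shows "a + m \<in> Poly_Mapping.keys (monom a * f)"
proof -
  have "Poly_Mapping.lookup (monom a * f) (a + m) =
      (\<Sum>b\<in>Poly_Mapping.keys f. if b = m then Poly_Mapping.lookup f b else 0)"
    unfolding lookup_mult_sum by (simp add: if_distrib cong: if_cong)
  also have "\<dots> = Poly_Mapping.lookup f m" using assms by (simp add: sum.delta)
  finally show ?thesis using assms by (simp add: in_keys_iff)
qed

text \<open>The exponents of the monomials in the \<open>s\<close>-th power of the edge ideal, as
  \<open>ideal_power_edge_ideal\<close> shows.\<close>

definition edge_monomials :: "'v::finite set set \<Rightarrow> nat \<Rightarrow> ('v \<Rightarrow>\<^sub>0 nat) set" where
  "edge_monomials E s = {m. \<exists>g. set_mset g \<subseteq> E \<and> size g = s \<and> (\<forall>v. inc g v \<le> Poly_Mapping.lookup m v)}"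

lemma up_closed_edge_monomials: "up_closed (edge_monomials E s)"
  unfolding up_closed_def edge_monomials_def by (auto simp: lookup_add intro: trans_le_add1)

lemma edge_monomials_1:
  "m \<in> edge_monomials E 1 \<longleftrightarrow> (\<exists>e\<in>E. \<forall>v\<in>e. Poly_Mapping.lookup m v > 0)"
proof
  assume "m \<in> edge_monomials E 1"
  then obtain g where g: "set_mset g \<subseteq> E" "size g = 1" "\<forall>v. inc g v \<le> Poly_Mapping.lookup m v"
    by (auto simp: edge_monomials_def)
  then obtain e where "g = {#e#}" using size_1_singleton_mset by blast
  then have "e \<in> E" "\<forall>v\<in>e. Poly_Mapping.lookup m v > 0"
    using g by (auto split: if_splits)
  then show "\<exists>e\<in>E. \<forall>v\<in>e. Poly_Mapping.lookup m v > 0" by blast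
next
  assume "\<exists>e\<in>E. \<forall>v\<in>e. Poly_Mapping.lookup m v > 0"
  then obtain e where "e \<in> E" "\<forall>v\<in>e. Poly_Mapping.lookup m v > 0" by blast
  then show "m \<in> edge_monomials E 1"
    unfolding edge_monomials_def by (auto intro!: exI [of _ "{#e#}"] simp: Suc_le_eq)
qed

lemma sumset_edge_monomials: "sumset (edge_monomials E i) (edge_monomials E j) = edge_monomials E (i + j)"
proof (intro equalityI subsetI)
  fix m assume "m \<in> sumset (edge_monomials E i) (edge_monomials E j)"
  then obtain a b g h where "m = a + b"
    and g: "set_mset g \<subseteq> E" "size g = i" "\<forall>v. inc g v \<le> Poly_Mapping.lookup a v"
    and h: "set_mset h \<subseteq> E" "size h = j" "\<forall>v. inc h v \<le> Poly_Mapping.lookup b v"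
    by (auto simp: sumset_def edge_monomials_def)
  then show "m \<in> edge_monomials E (i + j)"
    unfolding edge_monomials_def
    by (auto intro!: exI [of _ "g + h"] simp: lookup_add add_mono)
next
  fix m assume "m \<in> edge_monomials E (i + j)"
  then obtain g where g: "set_mset g \<subseteq> E" "size g = i + j" "\<forall>v. inc g v \<le> Poly_Mapping.lookup m v"
    by (auto simp: edge_monomials_def)
  \<comment> \<open>An enumeration of \<open>g\<close> is cut after \<open>i\<close> edges, and the
    cofactor of \<open>m\<close> goes to the second part.\<close>
  obtain es where es: "mset es = g" using ex_mset by blast
  obtain h h' where h: "g = h + h'" "size h = i" "size h' = j"
  proof
    show "g = mset (take i es) + mset (drop i es)" by (metis append_take_drop_id es mset_append)
    have "length es = i + j" using g(2) es by (metis size_mset)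
    then show "size (mset (take i es)) = i" "size (mset (drop i es)) = j" by simp_all
  qed
  obtain w where w: "m = exponents (inc g) + w" using g(3) exponents_le_iff by blast
  have m: "m = exponents (inc h) + (exponents (inc h') + w)"
    unfolding w h(1) by (intro poly_mapping_eqI) (simp add: lookup_add)
  have "exponents (inc h) \<in> edge_monomials E i"
    unfolding edge_monomials_def using h g(1) by (auto intro!: exI [of _ h])
  moreover have "exponents (inc h') + w \<in> edge_monomials E j"
    unfolding edge_monomials_def using h g(1) by (auto intro!: exI [of _ h'] simp: lookup_add)
  ultimately show "m \<in> sumset (edge_monomials E i) (edge_monomials E j)"
    unfolding sumset_def m by blast
qed

lemma edge_monomials_0: "edge_monomials E 0 = UNIV"
  by (auto simp: edge_monomials_def)

lemma sumset_power_edge_monomials: "sumset_power (edge_monomials E 1) s = edge_monomials E s"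
  by (induction s) (simp_all add: edge_monomials_0 sumset_edge_monomials)

lemma edge_ideal_eq:
  assumes "simple_graph (E :: 'v::finite set set)"
  shows "(edge_ideal E :: (('v \<Rightarrow>\<^sub>0 nat) \<Rightarrow>\<^sub>0 'k::field) set) = monomial_ideal (edge_monomials E 1)"
proof -
  let ?B = "{Poly_Mapping.single u 1 + Poly_Mapping.single v (1::nat) |u v. {u, v} \<in> E}"
  have neq: "u \<noteq> v" if "{u, v} \<in> E" for u v
    using assms that unfolding simple_graph_def by fastforce
  have "{vertex_var u * vertex_var v |u v. {u, v} \<in> E} = (monom ` ?B :: (('v \<Rightarrow>\<^sub>0 nat) \<Rightarrow>\<^sub>0 'k) set)"
    by (auto simp: vertex_var_def mult_single image_iff)
  then have "(edge_ideal E :: (('v \<Rightarrow>\<^sub>0 nat) \<Rightarrow>\<^sub>0 'k) set) = monomial_ideal (sumset ?B UNIV)"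
    unfolding edge_ideal_def poly_ring_eq_univ_ring by (simp only: genideal_monomials)
  also have "sumset ?B UNIV = edge_monomials E 1"
  proof (intro equalityI subsetI)
    fix m assume "m \<in> sumset ?B UNIV"
    then obtain u v w where "m = Poly_Mapping.single u 1 + Poly_Mapping.single v 1 + w" "{u, v} \<in> E"
      by (auto simp: sumset_def)
    then show "m \<in> edge_monomials E 1"
      unfolding edge_monomials_1 by (intro bexI [of _ "{u, v}"]) (auto simp: lookup_add)
  next
    fix m assume "m \<in> edge_monomials E 1"
    then obtain e where e: "e \<in> E" "\<forall>v\<in>e. Poly_Mapping.lookup m v > 0" unfolding edge_monomials_1 by blast
    then obtain u v where uv: "e = {u, v}" using assms unfolding simple_graph_def by (metis card_2_iff)
    then have "u \<noteq> v" using neq e by blast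
    then have "m = (Poly_Mapping.single u 1 + Poly_Mapping.single v 1) +
        (m - (Poly_Mapping.single u 1 + Poly_Mapping.single v 1))"
      using e(2) uv by (intro poly_mapping_eqI) (auto simp: lookup_add lookup_minus lookup_single when_def)
    then show "m \<in> sumset ?B UNIV" unfolding sumset_def using e(1) uv by blast
  qed
  finally show ?thesis .
qed

lemma ideal_power_edge_ideal:
  assumes "simple_graph (E :: 'v::finite set set)"
  shows "ideal_power univ_ring (edge_ideal E :: (('v \<Rightarrow>\<^sub>0 nat) \<Rightarrow>\<^sub>0 'k::field) set) s =
    monomial_ideal (edge_monomials E s)"
  unfolding edge_ideal_eq [OF assms]
  by (simp only: ideal_power_monomial_ideal up_closed_edge_monomials sumset_power_edge_monomials)

text \<open>The witness is the product of all variables outside \<open>W\<close>. It contains no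
  edge since \<open>W\<close> is a cover, and a further factor \<open>v\<close> from
  \<open>W\<close> completes an edge since \<open>W - {v}\<close> is not one. Primality holds
  because terms of \<open>W\<close>-degree zero in both factors produce one in the product.\<close>

lemma minimal_cover_prime:
  fixes E :: "'v::finite set set"
  assumes cov: "\<And>e. e \<in> E \<Longrightarrow> e \<inter> W \<noteq> {}"
    and min: "\<And>v. v \<in> W \<Longrightarrow> \<exists>e\<in>E. e \<inter> (W - {v}) = {}"
  defines "p \<equiv> monomial_ideal {m. wdeg W m > 0} :: (('v \<Rightarrow>\<^sub>0 nat) \<Rightarrow>\<^sub>0 'k::field) set"
  shows "primeideal p univ_ring"
    and "p = {r. r * monom (exponents (\<lambda>v. if v \<in> W then 0 else 1)) \<in> monomial_ideal (edge_monomials E 1)}"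
proof -
  let ?I = "monomial_ideal (edge_monomials E 1) :: (('v \<Rightarrow>\<^sub>0 nat) \<Rightarrow>\<^sub>0 'k) set"
  let ?c = "exponents (\<lambda>v. if v \<in> W then 0 else 1)"
  have up: "up_closed {m. wdeg W m > 0}" by (simp add: up_closed_def wdeg_add)
  have ideal: "is_ideal p" unfolding p_def by (rule is_ideal_monomial_ideal [OF up])
  have notin: "\<exists>m\<in>Poly_Mapping.keys f. wdeg W m = 0" if "f \<notin> p" for f
    using that by (auto simp: p_def monomial_ideal_def)
  show "primeideal p univ_ring"
    unfolding primeideal_univ_ring_iff
  proof (intro conjI allI impI ideal)
    show "1 \<notin> p" by (simp add: p_def monomial_ideal_def wdeg_def)
    fix f g assume fg: "f * g \<in> p"
    show "f \<in> p \<or> g \<in> p"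
    proof (rule ccontr)
      assume "\<not> (f \<in> p \<or> g \<in> p)"
      then obtain a0 b0 where 0: "a0 \<in> Poly_Mapping.keys f" "wdeg W a0 = 0"
        "b0 \<in> Poly_Mapping.keys g" "wdeg W b0 = 0" using notin by metis
      then obtain a b where "wdeg W a \<le> 0" "wdeg W b \<le> 0" "a + b \<in> Poly_Mapping.keys (f * g)"
        using product_lowest_monomial [OF 0(1,3), of W] by metis
      then show False using fg by (auto simp: p_def monomial_ideal_def wdeg_add)
    qed
  qed
  have edge: "c + ?c \<in> edge_monomials E 1 \<longleftrightarrow> wdeg W c > 0" for c
  proof
    assume "c + ?c \<in> edge_monomials E 1"
    then obtain e where e: "e \<in> E" "\<forall>v\<in>e. Poly_Mapping.lookup (c + ?c) v > 0"
      unfolding edge_monomials_1 by blast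
    then obtain v where "v \<in> e" "v \<in> W" using cov by blast
    then have "Poly_Mapping.lookup c v > 0" using e(2) by (auto simp: lookup_add)
    then show "wdeg W c > 0" using \<open>v \<in> W\<close> by (auto simp: wdeg_def sum_pos2 [of _ v])
  next
    assume "wdeg W c > 0"
    then obtain v where v: "v \<in> W" "Poly_Mapping.lookup c v > 0"
      unfolding wdeg_def by (metis bot_nat_0.not_eq_extremum sum.neutral)
    obtain e where "e \<in> E" "e \<inter> (W - {v}) = {}" using min [OF v(1)] by blast
    then show "c + ?c \<in> edge_monomials E 1"
      unfolding edge_monomials_1 using v by (intro bexI [of _ e]) (auto simp: lookup_add)
  qed
  show "p = {r. r * monom ?c \<in> ?I}"
  proof (intro equalityI subsetI CollectI)
    fix r assume r: "r \<in> p"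
    show "r * monom ?c \<in> ?I"
      unfolding monomial_ideal_def
    proof (rule CollectI, rule subsetI)
      fix m assume "m \<in> Poly_Mapping.keys (r * monom ?c)"
      then obtain c where "c \<in> Poly_Mapping.keys r" "m = c + ?c"
        using Poly_Mapping.keys_mult [of r "monom ?c"] by auto
      then show "m \<in> edge_monomials E 1" using r edge by (auto simp: p_def monomial_ideal_def)
    qed
  next
    fix r assume r: "r \<in> {r. r * monom ?c \<in> ?I}"
    show "r \<in> p"
      unfolding p_def monomial_ideal_def
    proof (rule CollectI, rule subsetI)
      fix c assume "c \<in> Poly_Mapping.keys r"
      then have "?c + c \<in> Poly_Mapping.keys (monom ?c * r)" by (rule key_monom_mult)
      then have "c + ?c \<in> edge_monomials E 1"
        using r by (auto simp: monomial_ideal_def add.commute mult.commute)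
      then show "c \<in> {m. wdeg W m > 0}" using edge by simp
    qed
  qed
qed

lemma ex_minimal_cover:
  fixes E :: "'v::finite set set"
  assumes "\<And>e. e \<in> E \<Longrightarrow> e \<inter> W \<noteq> {}"
  obtains W' where "W' \<subseteq> W" "\<And>e. e \<in> E \<Longrightarrow> e \<inter> W' \<noteq> {}" "\<And>v. v \<in> W' \<Longrightarrow> \<exists>e\<in>E. e \<inter> (W' - {v}) = {}"
proof -
  let ?P = "{W'. W' \<subseteq> W \<and> (\<forall>e\<in>E. e \<inter> W' \<noteq> {})}"
  have "W \<in> ?P" using assms by auto
  then obtain W' where W': "W' \<in> ?P" and min: "\<And>V. V \<in> ?P \<Longrightarrow> V \<subseteq> W' \<Longrightarrow> V = W'"
    using finite_has_minimal [of ?P] by (metis (no_types, lifting) empty_iff finite)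
  have "\<exists>e\<in>E. e \<inter> (W' - {v}) = {}" if "v \<in> W'" for v
  proof (rule ccontr)
    assume "\<not> ?thesis"
    then have "W' - {v} \<in> ?P" using W' by auto
    then show False using min [of "W' - {v}"] that by blast
  qed
  then show ?thesis using W' that [of W'] by blast
qed

text \<open>Look at a monomial of \<open>h\<close> that is not in the edge ideal.\<close>

lemma neighbour_outside_associated_prime:
  fixes E :: "'v::finite set set" and h :: "('v \<Rightarrow>\<^sub>0 nat) \<Rightarrow>\<^sub>0 'k::field"
  assumes simple: "simple_graph E" and prime: "primeideal p univ_ring"
    and p: "p = {r. r * h \<in> monomial_ideal (edge_monomials E 1)}" and v: "vertex_var v \<in> p"
  obtains w where "{v, w} \<in> E" "vertex_var w \<notin> p"
proof -
  have "1 \<notin> p" using prime by (simp add: primeideal_univ_ring_iff)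
  then have "h \<notin> monomial_ideal (edge_monomials E 1)" by (simp add: p)
  then obtain m where m: "m \<in> Poly_Mapping.keys h" "m \<notin> edge_monomials E 1"
    by (auto simp: monomial_ideal_def)
  \<comment> \<open>Multiplication by a single variable cannot cancel terms, so the product of that
    variable with \<open>m\<close> is a term of an element of the edge ideal.\<close>
  have var: "Poly_Mapping.single u 1 + m \<in> edge_monomials E 1" if "vertex_var u \<in> p" for u
    using that key_monom_mult [OF m(1), of "Poly_Mapping.single u 1"]
    by (auto simp: p monomial_ideal_def vertex_var_def)
  obtain e where e: "e \<in> E" "\<forall>u\<in>e. Poly_Mapping.lookup (Poly_Mapping.single v 1 + m) u > 0"
    using var [OF v] unfolding edge_monomials_1 by blast
  have "v \<in> e"
  proof (rule ccontr)
    assume "v \<notin> e"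
    then have "\<forall>u\<in>e. Poly_Mapping.lookup m u > 0"
      using e(2) by (auto simp: lookup_add lookup_single when_def split: if_splits)
    then show False using e(1) m(2) unfolding edge_monomials_1 by blast
  qed
  then obtain w where w: "e = {v, w}" "w \<noteq> v"
    using simple e(1) unfolding simple_graph_def by (metis card_2_iff doubleton_eq_iff insertE singletonD)
  have mw: "Poly_Mapping.lookup m w > 0"
    using e(2) w by (auto simp: lookup_add lookup_single when_def)
  have "vertex_var w \<notin> p"
  proof
    assume "vertex_var w \<in> p"
    then obtain e' where e': "e' \<in> E" "\<forall>u\<in>e'. Poly_Mapping.lookup (Poly_Mapping.single w 1 + m) u > 0"
      using var unfolding edge_monomials_1 by blast
    \<comment> \<open>The variable \<open>w\<close> already divides \<open>m\<close>, so another
      factor \<open>w\<close> does not enlarge the support.\<close>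
    then have "\<forall>u\<in>e'. Poly_Mapping.lookup m u > 0"
      using mw by (auto simp: lookup_add lookup_single when_def split: if_splits)
    then show False using e'(1) m(2) unfolding edge_monomials_1 by blast
  qed
  then show ?thesis using that e(1) w(1) by blast
qed

section \<open>Symbolic powers and the symbolic defect\<close>

context cycle_with_trees begin

lemma simple_graph_E: "simple_graph E"
  using card_edge by (simp add: simple_graph_def)

definition symbolic_monomials :: "nat \<Rightarrow> ('v \<Rightarrow>\<^sub>0 nat) set" where
  "symbolic_monomials s = {m. decomposable E (Poly_Mapping.lookup m) s}"

lemma up_closed_symbolic_monomials: "up_closed (symbolic_monomials s)"
  unfolding up_closed_def
proof (intro ballI allI)
  fix u w assume "u \<in> symbolic_monomials s"
  then obtain a g where "(a, g) \<in> gen_index s" "\<And>v. generator a g v \<le> Poly_Mapping.lookup u v"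
    unfolding symbolic_monomials_def decomposable_iff by auto
  then show "u + w \<in> symbolic_monomials s"
    unfolding symbolic_monomials_def decomposable_iff
    by (auto simp: lookup_add intro!: bexI [of _ "(a, g)"] trans_le_add1)
qed

lemma edge_monomials_subset: "edge_monomials E s \<subseteq> symbolic_monomials s"
  using matchable_imp_decomposable by (auto simp: edge_monomials_def symbolic_monomials_def matchable_def)

text \<open>Each of the \<open>2 * n + 1\<close> cycle edges contains a vertex of \<open>W\<close>,
  and each cycle vertex lies on two of them.\<close>

lemma card_cycle_cover_ge:
  assumes "\<And>e. e \<in> C \<Longrightarrow> e \<inter> W \<noteq> {}"
  shows "n + 1 \<le> card (W \<inter> range x)"
proof -
  let ?f = "\<lambda>i. if x i \<in> W then 1 else 0 :: nat"
  have "N = (\<Sum>i<N. 1)" by simp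
  also have "\<dots> \<le> (\<Sum>i<N. ?f i + ?f (Suc i))"
  proof (rule sum_mono)
    fix i
    have "ce i \<inter> W \<noteq> {}" using assms by blast
    then show "1 \<le> ?f i + ?f (Suc i)" by (auto simp: ce_def)
  qed
  also have "\<dots> = 2 * (\<Sum>i<N. ?f i)"
    unfolding sum.distrib by (subst sum_shift_one) simp_all
  also have "(\<Sum>i<N. ?f i) = (\<Sum>v\<in>range x. if v \<in> W then 1 else 0)"
    unfolding sum_cycle_walk [of _ 0] by simp
  also have "\<dots> = card (W \<inter> range x)"
    by (simp add: sum.If_cases Int_commute)
  finally show ?thesis by (simp add: N_def)
qed

text \<open>The variables in \<open>p\<close> form a vertex cover, which contains at least \<open>n + 1\<close> vertices of the cycle.
  Pairing these with neighbours outside \<open>p\<close> turns the product of the cycle vertices into a product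
  of \<open>n + 1\<close> edges.\<close>

lemma symbolic_monomials_mult:
  fixes h :: "('v \<Rightarrow>\<^sub>0 nat) \<Rightarrow>\<^sub>0 'k::field"
  assumes prime: "primeideal p univ_ring"
    and p: "p = {r. r * h \<in> monomial_ideal (edge_monomials E 1)}" and m: "m \<in> symbolic_monomials s"
  obtains t where "monom t \<notin> p" "t + m \<in> edge_monomials E s"
proof -
  obtain a g where g: "set_mset g \<subseteq> E" "size g + a * (n + 1) = s"
    "\<And>v. cycle_part a v + inc g v \<le> Poly_Mapping.lookup m v"
    using m unfolding symbolic_monomials_def decomposable_def by blast
  define W where "W = {v. vertex_var v \<in> p}"
  have cov: "e \<inter> W \<noteq> {}" if "e \<in> E" for e
  proof -
    obtain u v where uv: "e = {u, v}" "u \<noteq> v" using card_edge [OF \<open>e \<in> E\<close>] by (metis card_2_iff)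
    have "is_ideal (monomial_ideal (edge_monomials E 1) :: (('v \<Rightarrow>\<^sub>0 nat) \<Rightarrow>\<^sub>0 'k) set)"
      by (rule is_ideal_monomial_ideal [OF up_closed_edge_monomials])
    moreover have "Poly_Mapping.single u 1 + Poly_Mapping.single v 1 \<in> edge_monomials E 1"
      unfolding edge_monomials_1 using that uv by (intro bexI [of _ e]) (auto simp: lookup_add)
    then have "vertex_var u * vertex_var v \<in> (monomial_ideal (edge_monomials E 1) :: (('v \<Rightarrow>\<^sub>0 nat) \<Rightarrow>\<^sub>0 'k) set)"
      by (simp add: vertex_var_def mult_single)
    ultimately have "vertex_var u * vertex_var v \<in> p" unfolding p by (auto intro: is_idealD(4))
    then show ?thesis using prime uv by (auto simp: W_def primeideal_univ_ring_iff)
  qed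
  have "\<exists>w. {v, w} \<in> E \<and> w \<notin> W" if "v \<in> W" for v
    using neighbour_outside_associated_prime [OF simple_graph_E prime p, of v] that
    unfolding W_def by (metis mem_Collect_eq)
  then obtain nb where nb: "\<And>v. v \<in> W \<Longrightarrow> {v, nb v} \<in> E \<and> nb v \<notin> W" by metis
  have "n + 1 \<le> card (W \<inter> range x)"
    by (rule card_cycle_cover_ge) (use cov C_sub_E in blast)
  then obtain V where V: "V \<subseteq> W \<inter> range x" "card V = n + 1"
    by (metis obtain_subset_with_card_n)
  define g0 where "g0 = (\<Sum>v\<in>V. {#{v, nb v}#})"
  \<comment> \<open>Cover vertices may share a chosen neighbour, so \<open>c\<close> records
    multiplicities; \<open>t\<close> is the \<open>a\<close>-th power of the product of these
    neighbours.\<close>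
  define c where "c u = (\<Sum>v\<in>V. if nb v = u then 1 else 0 :: nat)" for u
  define t where "t = exponents (\<lambda>u. a * c u)"
  have g0: "set_mset g0 \<subseteq> E" "size g0 = n + 1"
    using nb V unfolding g0_def by (auto simp: set_mset_sum size_multiset_sum)
  \<comment> \<open>The vertices of \<open>V\<close> are paid for by one factor \<open>u\<close>,
    their neighbours by \<open>c\<close>.\<close>
  have inc_g0: "inc g0 u \<le> cycle_part 1 u + c u" for u
  proof -
    have "inc g0 u = (\<Sum>v\<in>V. if u \<in> {v, nb v} then 1 else 0)"
      unfolding g0_def inc_sum by (rule sum.cong) simp_all
    also have "\<dots> \<le> (\<Sum>v\<in>V. (if v = u then 1 else 0) + (if nb v = u then 1 else 0))"
      by (rule sum_mono) auto
    also have "\<dots> = (if u \<in> V then 1 else 0) + c u"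
      by (simp add: sum.distrib c_def)
    also have "\<dots> \<le> cycle_part 1 u + c u"
      using V(1) by (auto simp: cycle_part_def depth_eq_0_iff)
    finally show ?thesis .
  qed
  have "monom t \<notin> p"
  proof
    assume "monom t \<in> p"
    then obtain u where u: "Poly_Mapping.lookup t u > 0" "vertex_var u \<in> p" using prime_monom [OF prime] by blast
    then have "c u \<noteq> 0" by (auto simp: t_def)
    have "\<exists>v\<in>V. nb v = u"
    proof (rule ccontr)
      assume "\<not> (\<exists>v\<in>V. nb v = u)"
      then have "c u = 0" unfolding c_def by (intro sum.neutral) auto
      then show False using \<open>c u \<noteq> 0\<close> by simp
    qed
    then obtain v where "v \<in> V" "nb v = u" by blast
    then show False using nb V(1) u(2) unfolding W_def by blast
  qed
  moreover have "t + m \<in> edge_monomials E s"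
    unfolding edge_monomials_def
  proof (rule CollectI, intro exI conjI allI)
    have "set_mset (repeat_mset a g0) \<subseteq> set_mset g0" by (induction a) auto
    then show "set_mset (repeat_mset a g0 + g) \<subseteq> E" using g0(1) g(1) by auto
    show "size (repeat_mset a g0 + g) = s" using g0(2) g(2) by simp
    fix u
    have "a * inc g0 u \<le> a * (cycle_part 1 u + c u)" using inc_g0 by simp
    moreover have "a * cycle_part 1 u = cycle_part a u" by (simp add: cycle_part_def)
    ultimately show "inc (repeat_mset a g0 + g) u \<le> Poly_Mapping.lookup (t + m) u"
      using g(3) [of u] by (simp add: inc_repeat_mset lookup_add t_def distrib_left)
  qed
  ultimately show ?thesis using that by blast
qed

theorem symbolic_power_edge_ideal:
  "symbolic_power univ_ring (edge_ideal E :: (('v \<Rightarrow>\<^sub>0 nat) \<Rightarrow>\<^sub>0 'k::field) set) s =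
    monomial_ideal (symbolic_monomials s)"
proof -
  let ?I = "monomial_ideal (edge_monomials E 1) :: (('v \<Rightarrow>\<^sub>0 nat) \<Rightarrow>\<^sub>0 'k) set"
  let ?Is = "monomial_ideal (edge_monomials E s) :: (('v \<Rightarrow>\<^sub>0 nat) \<Rightarrow>\<^sub>0 'k) set"
  have Is: "is_ideal ?Is" by (rule is_ideal_monomial_ideal [OF up_closed_edge_monomials])
  have pow: "ideal_power univ_ring ?I s = ?Is"
    using ideal_power_edge_ideal [OF simple_graph_E] edge_ideal_eq [OF simple_graph_E] by metis
  have eq: "symbolic_power univ_ring ?I s =
      {f. \<forall>p. primeideal p univ_ring \<and> (\<exists>h. p = {r. r * h \<in> ?I}) \<longrightarrow> (\<exists>t. t \<notin> p \<and> t * f \<in> ?Is)}"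
    by (subst symbolic_power_univ_ring)
      (simp_all only: pow Is is_ideal_monomial_ideal up_closed_edge_monomials)
  have "symbolic_power univ_ring ?I s = monomial_ideal (symbolic_monomials s)"
  proof (intro equalityI subsetI)
    fix f assume f: "f \<in> symbolic_power univ_ring ?I s"
    show "f \<in> monomial_ideal (symbolic_monomials s)"
      unfolding monomial_ideal_def
    proof (rule CollectI, rule subsetI)
      fix m assume m: "m \<in> Poly_Mapping.keys f"
      have "cover_bound E (Poly_Mapping.lookup m) s"
        unfolding cover_bound_def
      proof (intro allI impI)
        fix W0 assume "\<forall>e\<in>E. e \<inter> W0 \<noteq> {}"
        \<comment> \<open>It suffices to treat minimal covers, because their variables generate
          associated primes.\<close>
        then obtain W where W: "W \<subseteq> W0" "\<And>e. e \<in> E \<Longrightarrow> e \<inter> W \<noteq> {}"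
          "\<And>v. v \<in> W \<Longrightarrow> \<exists>e\<in>E. e \<inter> (W - {v}) = {}"
          using ex_minimal_cover by metis
        let ?p = "monomial_ideal {m. wdeg W m > 0} :: (('v \<Rightarrow>\<^sub>0 nat) \<Rightarrow>\<^sub>0 'k) set"
        have "primeideal ?p univ_ring" "\<exists>h. ?p = {r. r * h \<in> ?I}"
          using minimal_cover_prime [OF W(2,3)] by blast+
        then obtain t where t: "t \<notin> ?p" "t * f \<in> ?Is" using f unfolding eq by blast
        then obtain t0 where t0: "t0 \<in> Poly_Mapping.keys t" "wdeg W t0 = 0"
          by (auto simp: monomial_ideal_def)
        \<comment> \<open>Since \<open>t0\<close> has \<open>W\<close>-degree 0, some term of
          \<open>t * f\<close> has \<open>W\<close>-degree at most that of \<open>m\<close>; lying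
          in the power, it has \<open>W\<close>-degree at least \<open>s\<close>.\<close>
        obtain a b where ab: "wdeg W a \<le> wdeg W t0" "wdeg W b \<le> wdeg W m"
          "a + b \<in> Poly_Mapping.keys (t * f)"
          by (rule product_lowest_monomial [OF t0(1) m])
        then have "a + b \<in> edge_monomials E s" using t(2) by (auto simp: monomial_ideal_def)
        then obtain g where g: "set_mset g \<subseteq> E" "size g = s"
          "\<And>v. inc g v \<le> Poly_Mapping.lookup (a + b) v" by (auto simp: edge_monomials_def)
        have "s \<le> (\<Sum>v\<in>W. inc g v)" using size_le_cover_weight [of g W] g(1,2) W(2) by blast
        also have "\<dots> \<le> wdeg W (a + b)" unfolding wdeg_def using g(3) by (rule sum_mono)
        also have "\<dots> \<le> wdeg W m" using ab(1,2) t0(2) by (simp add: wdeg_add)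
        also have "\<dots> \<le> (\<Sum>v\<in>W0. Poly_Mapping.lookup m v)"
          unfolding wdeg_def using W(1) by (intro sum_mono2) auto
        finally show "s \<le> (\<Sum>v\<in>W0. Poly_Mapping.lookup m v)" .
      qed
      then show "m \<in> symbolic_monomials s"
        unfolding symbolic_monomials_def using decomposable_if_cover_bound by blast
    qed
  next
    fix f assume f: "f \<in> (monomial_ideal (symbolic_monomials s) :: (('v \<Rightarrow>\<^sub>0 nat) \<Rightarrow>\<^sub>0 'k) set)"
    show "f \<in> symbolic_power univ_ring ?I s"
      unfolding eq
    proof (rule CollectI, intro allI impI)
      fix p assume "primeideal p univ_ring \<and> (\<exists>h. p = {r. r * h \<in> ?I})"
      then obtain h where prime: "primeideal p univ_ring" and h: "p = {r. r * h \<in> ?I}" by blast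
      interpret prime_of_ring p by (rule prime_of_ring.intro [OF prime])
      \<comment> \<open>For fixed \<open>p\<close> the condition on \<open>f\<close> defines an
        ideal, so it can be checked on monomials.\<close>
      have "is_ideal {f. \<exists>t. t \<notin> p \<and> t * f \<in> ?Is}"
        unfolding is_ideal_def
      proof (intro conjI ballI allI)
        show "0 \<in> {f. \<exists>t. t \<notin> p \<and> t * f \<in> ?Is}"
          using one_notin is_idealD(1) [OF Is] by (auto intro!: exI [of _ 1])
        fix f g r assume "f \<in> {f. \<exists>t. t \<notin> p \<and> t * f \<in> ?Is}"
        then obtain t where t: "t \<notin> p" "t * f \<in> ?Is" by blast
        then have "t * (r * f) \<in> ?Is" using is_idealD(3) [OF Is, of "t * f" r] by (simp add: mult_ac)
        then show "r * f \<in> {f. \<exists>t. t \<notin> p \<and> t * f \<in> ?Is}" using t by blast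
        assume "g \<in> {f. \<exists>t. t \<notin> p \<and> t * f \<in> ?Is}"
        then obtain u where u: "u \<notin> p" "u * g \<in> ?Is" by blast
        have "(t * u) * (f + g) = u * (t * f) + t * (u * g)" by (simp add: algebra_simps)
        then have "(t * u) * (f + g) \<in> ?Is" using t u is_idealD [OF Is] by metis
        then show "f + g \<in> {f. \<exists>t. t \<notin> p \<and> t * f \<in> ?Is}" using mult_notin t u by blast
      qed
      then have "monomial_ideal (symbolic_monomials s) \<subseteq> {f. \<exists>t. t \<notin> p \<and> t * f \<in> ?Is}"
      proof (rule monomial_ideal_subset)
        fix m assume "m \<in> symbolic_monomials s"
        then obtain t where t: "monom t \<notin> p" "t + m \<in> edge_monomials E s"
          by (rule symbolic_monomials_mult [OF prime h])
        then have "monom t * monom m \<in> ?Is" by (simp add: mult_single)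
        then show "monom m \<in> {f. \<exists>t. t \<notin> p \<and> t * f \<in> ?Is}" using t(1) by blast
      qed
      then show "\<exists>t. t \<notin> p \<and> t * f \<in> ?Is" using f by blast
    qed
  qed
  then show ?thesis by (simp only: edge_ideal_eq [OF simple_graph_E])
qed

theorem sdefect_edge_ideal:
  "sdefect univ_ring (edge_ideal E :: (('v \<Rightarrow>\<^sub>0 nat) \<Rightarrow>\<^sub>0 'k::field) set) s =
    card {(a, g) \<in> gen_index s. 0 < a \<and> \<not> covered g}"
proof -
  define P where "P = {(a, g) \<in> gen_index s. 0 < a \<and> \<not> covered g}"
  define Q where "Q = (\<lambda>(a, g). exponents (generator a g)) ` P"
  have P_D: "(a, g) \<in> gen_index s" "0 < a" "\<not> covered g" if "(a, g) \<in> P" for a g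
    using that by (auto simp: P_def)
  have "finite P"
  proof (rule finite_subset)
    have "a \<le> s \<and> g \<in> (\<Union>j\<le>s. multisets_of_size E j)" if "(a, g) \<in> gen_index s" for a g
    proof
      have "a * 1 \<le> a * (n + 1)" by (intro mult_le_mono) simp_all
      then show "a \<le> s" using that by (auto simp: gen_index_def)
      show "g \<in> (\<Union>j\<le>s. multisets_of_size E j)"
        using that by (auto simp: gen_index_def multisets_of_size_def)
    qed
    then show "P \<subseteq> {..s} \<times> (\<Union>j\<le>s. multisets_of_size E j)" by (auto simp: P_def)
    show "finite ({..s} \<times> (\<Union>j\<le>s. multisets_of_size E j))"
      by (intro finite_cartesian_product finite_UN_I finite_multisets_of_size) simp_all
  qed
  have inj: "inj_on (\<lambda>(a, g). exponents (generator a g)) P"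
  proof (rule inj_onI)
    fix y z assume *: "y \<in> P" "z \<in> P"
      "(\<lambda>(a, g). exponents (generator a g)) y = (\<lambda>(a, g). exponents (generator a g)) z"
    obtain a g b h where yz: "y = (a, g)" "z = (b, h)" by (metis surj_pair)
    then have "Poly_Mapping.lookup (exponents (generator a g)) = Poly_Mapping.lookup (exponents (generator b h))"
      using *(3) by simp
    then have "generator a g = generator b h" by simp
    then show "y = z" using generator_inject [OF P_D(1) P_D(1)] * yz by blast
  qed
  have "min_gens univ_ring (ideal_quotient (monomial_ideal (symbolic_monomials s) :: (('v \<Rightarrow>\<^sub>0 nat) \<Rightarrow>\<^sub>0 'k) set)
      (monomial_ideal (edge_monomials E s))) = card Q"
  proof (rule min_gens_monomial_quotient)
    show "finite Q" unfolding Q_def using \<open>finite P\<close> by simp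
    show "Q \<subseteq> symbolic_monomials s"
      unfolding Q_def symbolic_monomials_def decomposable_iff using P_D(1) by fastforce
    show "Q \<inter> edge_monomials E s = {}"
    proof (rule ccontr)
      assume "Q \<inter> edge_monomials E s \<noteq> {}"
      then obtain a g where ag: "(a, g) \<in> P" "exponents (generator a g) \<in> edge_monomials E s"
        by (auto simp: Q_def)
      then obtain h where h: "set_mset h \<subseteq> E" "size h = s" "\<And>v. inc h v \<le> generator a g v"
        by (auto simp: edge_monomials_def)
      have "2 * s = (\<Sum>v\<in>UNIV. inc h v)" using h card_edge by (subst sum_inc) auto
      also have "\<dots> \<le> (\<Sum>v\<in>UNIV. generator a g v)" using h(3) by (rule sum_mono)
      finally show False using sum_generator [OF P_D(1) [OF ag(1)]] P_D(2) [OF ag(1)] by linarith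
    qed
    show "w = 0" if "u \<in> symbolic_monomials s" "u + w \<in> Q" for u w
    proof -
      obtain a g where ag: "(a, g) \<in> P" "u + w = exponents (generator a g)"
        using \<open>u + w \<in> Q\<close> by (auto simp: Q_def)
      have sum: "Poly_Mapping.lookup u v + Poly_Mapping.lookup w v = generator a g v" for v
        using arg_cong [OF ag(2), of "\<lambda>m. Poly_Mapping.lookup m v"] by (simp add: lookup_add)
      then have "Poly_Mapping.lookup u v \<le> generator a g v" for v by (metis le_add1)
      then have "Poly_Mapping.lookup u = generator a g"
        using generator_minimal [OF P_D(1,3), OF ag(1) ag(1)] that(1)
        unfolding symbolic_monomials_def by blast
      then show "w = 0" using sum by (intro poly_mapping_eqI) simp
    qed
    show "u \<in> edge_monomials E s \<or> (\<exists>q\<in>Q. \<exists>w. u = q + w)" if u: "u \<in> symbolic_monomials s" for u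
    proof -
      \<comment> \<open>The largest possible \<open>a\<close> is chosen: a covered \<open>g\<close>
        could be traded for one more factor \<open>u\<close>. Degrees bound \<open>a\<close> by
        \<open>2 * s\<close>.\<close>
      define A where "A a \<longleftrightarrow> (\<exists>g. (a, g) \<in> gen_index s \<and>
        (\<forall>v. generator a g v \<le> Poly_Mapping.lookup u v))" for a
      have ex: "\<exists>a. A a"
        using u unfolding A_def symbolic_monomials_def decomposable_iff by auto
      have bound: "a \<le> 2 * s" if "A a" for a
        using that sum_generator unfolding A_def by (metis le_add2)
      define a where "a = (GREATEST a. A a)"
      have "A a" unfolding a_def by (rule GreatestI_ex_nat [OF ex]) (rule bound)
      have max: "b \<le> a" if "A b" for b
        unfolding a_def using that bound by (rule Greatest_le_nat)
      from \<open>A a\<close> obtain g where g: "(a, g) \<in> gen_index s" "\<And>v. generator a g v \<le> Poly_Mapping.lookup u v"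
        unfolding A_def by blast
      have "\<not> covered g"
      proof
        assume "covered g"
        then obtain h where h: "(Suc a, h) \<in> gen_index s" "\<And>v. generator (Suc a) h v \<le> generator a g v"
          using generator_reducible [OF g(1)] by blast
        then have "A (Suc a)" unfolding A_def using g(2) order_trans by blast
        then show False using max [of "Suc a"] by simp
      qed
      show ?thesis
      proof (cases "a = 0")
        case True
        then show ?thesis
          using g by (auto simp: edge_monomials_def gen_index_def generator_def cycle_part_def)
      next
        case False
        then have "exponents (generator a g) \<in> Q"
          unfolding Q_def P_def using g(1) \<open>\<not> covered g\<close> by force
        moreover have "\<exists>w. u = exponents (generator a g) + w" using g(2) exponents_le_iff by blast
        ultimately show ?thesis by blast
      qed
    qed
  qed (rule up_closed_symbolic_monomials up_closed_edge_monomials edge_monomials_subset)+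
  then show ?thesis
    unfolding sdefect_def symbolic_power_edge_ideal ideal_power_edge_ideal [OF simple_graph_E]
    using card_image [OF inj] by (simp add: Q_def P_def)
qed

text \<open>With \<open>a = k - j\<close> the size condition leaves \<open>j * (n + 1) + r\<close>
  edges; \<open>r \<le> n\<close> excludes \<open>a > k\<close>, and \<open>a > 0\<close> becomes
  \<open>j < k\<close>.\<close>

lemma card_gen_index:
  assumes s: "s = k * (n + 1) + r" and r: "r \<le> n"
  shows "card {(a, g) \<in> gen_index s. 0 < a \<and> \<not> covered g} =
    (\<Sum>j<k. card {g. set_mset g \<subseteq> E \<and> size g = j * (n + 1) + r \<and> \<not> covered g})"
proof -
  let ?u = "\<lambda>j. {g. set_mset g \<subseteq> E \<and> size g = j \<and> \<not> covered g}"
  have fin: "finite (?u j)" for j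
    by (rule finite_subset [of _ "multisets_of_size E j"]) (auto simp: multisets_of_size_def [symmetric] intro: finite_multisets_of_size, auto simp: multisets_of_size_def)
  have "{(a, g) \<in> gen_index s. 0 < a \<and> \<not> covered g} =
      (\<lambda>(j, g). (k - j, g)) ` (SIGMA j:{..<k}. ?u (j * (n + 1) + r))"
  proof (intro equalityI subsetI)
    fix y assume "y \<in> {(a, g) \<in> gen_index s. 0 < a \<and> \<not> covered g}"
    then obtain a g where y: "y = (a, g)" "(a, g) \<in> gen_index s" "0 < a" "\<not> covered g" by auto
    then have g: "set_mset g \<subseteq> E" "size g + a * (n + 1) = k * (n + 1) + r"
      by (auto simp: gen_index_def s)
    have "a \<le> k"
    proof (rule ccontr)
      assume "\<not> a \<le> k"
      then have "(k + 1) * (n + 1) \<le> a * (n + 1)" by (intro mult_le_mono) auto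
      then show False using g(2) r by (simp add: algebra_simps)
    qed
    then obtain j where j: "k = j + a" by (metis le_add_diff_inverse2)
    then have "size g = j * (n + 1) + r" using g(2) by (simp add: distrib_right)
    then show "y \<in> (\<lambda>(j, g). (k - j, g)) ` (SIGMA j:{..<k}. ?u (j * (n + 1) + r))"
      using y g(1) j by (intro image_eqI [of _ _ "(j, g)"]) auto
  next
    fix y assume "y \<in> (\<lambda>(j, g). (k - j, g)) ` (SIGMA j:{..<k}. ?u (j * (n + 1) + r))"
    then obtain j g where y: "y = (k - j, g)" "j < k" "g \<in> ?u (j * (n + 1) + r)" by auto
    have "j * (n + 1) + (k - j) * (n + 1) = k * (n + 1)"
      using y(2) by (simp flip: distrib_right)
    then show "y \<in> {(a, g) \<in> gen_index s. 0 < a \<and> \<not> covered g}"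
      using y by (simp add: gen_index_def s)
  qed
  moreover have "inj_on (\<lambda>(j, g). (k - j, g)) (SIGMA j:{..<k}. ?u (j * (n + 1) + r))"
    by (auto simp: inj_on_def)
  ultimately show ?thesis
    by (simp only: card_image) (simp add: card_SigmaI fin)
qed

end

theorem corollary4p9:
  fixes E :: "'v::finite set set"
    and xs :: "'v list"
    and n l s k r :: nat
  assumes "unicyclic E"
    and "is_cycle E xs"
    and "length xs = 2 * n + 1"
    and "n \<ge> 1"
    and "l = card (E - cycle_edges xs)"
    and "s = k * (n + 1) + r"
    and "k \<ge> 1"
    and "r \<le> n"
  shows "int (sdefect (poly_ring :: (('v \<Rightarrow>\<^sub>0 nat) \<Rightarrow>\<^sub>0 'k::field) ring) (edge_ideal E) s) =
    (\<Sum>j = 0..k - 1. G_number E xs n l (j * (n + 1) + r))"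
proof -
  obtain x par depth where "cycle_with_trees E n x par depth" and set: "set xs = range x"
    and cyc: "cycle_edges xs = range (\<lambda>i. {x i, x (Suc i)})"
    by (rule unicyclic_cycle_with_trees [OF assms(1-4)])
  then interpret cycle_with_trees E n x par depth by simp
  have cyc: "cycle_edges xs = C" unfolding cyc ce_def [abs_def] ..
  have "int (sdefect (poly_ring :: (('v \<Rightarrow>\<^sub>0 nat) \<Rightarrow>\<^sub>0 'k) ring) (edge_ideal E) s) =
      (\<Sum>j<k. int (card {g. set_mset g \<subseteq> E \<and> size g = j * (n + 1) + r \<and> \<not> covered g}))"
    unfolding poly_ring_eq_univ_ring sdefect_edge_ideal card_gen_index [OF assms(6,8)] by simp
  also have "\<dots> = (\<Sum>j<k. G_number E xs n l (j * (n + 1) + r))"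
    using card_uncovered_eq_G_number [OF cyc set] assms(5) cyc by simp
  \<comment> \<open>For \<open>k = 0\<close> the truncated difference would leave the term
    \<open>j = 0\<close>; \<open>k \<ge> 1\<close> excludes this.\<close>
  also have "{..<k} = {0..k - 1}" using assms(7) by auto
  finally show ?thesis .
qed

end
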